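(* Let $X(t)=x+X_0(t)$, where $X_0(t)$ is a Lévy process on $\mathbb{R}^d$ starting at zero, and let $L_x$ be the generator, with domain $D(L_x)$, of the semigroup $T(t)f(x)=E_x[f(X(t))]$ on $L^1(\mathbb{R}^d)$. Then for any $f\in D(L_x)$, both the initial value problem $$\frac{\partial}{\partial t}u(t,x)=\frac{L_xf(x)}{\sqrt{\pi t}}+L_x^2u(t,x),\qquad u(0,x)=f(x)\qquad (t>0,\ x\in\mathbb{R}^d),$$ and the fractional Cauchy problem $$\frac{\partial^{1/2}}{\partial t^{1/2}}u(t,x)=L_xu(t,x),\qquad u(0,x)=f(x)\qquad (t>0,\ x\in\mathbb{R}^d),$$ have the same unique solution, given by $$u(t,x)=\frac{2}{\sqrt{4\pi t}}\int_0^\infty T(s)f(x)\,\exp\left(-\frac{s^2}{4t}\right)ds .$$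
   Context: Here $T(t)f(x)=E[f(x+X_0(t))]$. The Lévy process $X_0$ has $E[e^{ik\cdot X_0(t)}]=e^{t\psi(k)}$ with $$\psi(k)=ik\cdot a-\tfrac12k\cdot Qk+\int_{y\ne0}\Big(e^{ik\cdot y}-1-\frac{ik\cdot y}{1+\|y\|^2}\Big)\phi(dy),$$ where $a\in\mathbb{R}^d$, $Q$ is a nonnegative definite matrix and $\phi$ is a $\sigma$-finite Borel measure with $\int_{y\neq0}\min\{1,\|y\|^2\}\phi(dy)<\infty$. With $\hat f(k)=\int_{\mathbb{R}^d}e^{-ik\cdot x}f(x)\,dx$, the domain is $D(L_x)=\{f\in L^1(\mathbb{R}^d):\psi(k)\hat f(k)=\hat h(k)\text{ for some }h\in L^1(\mathbb{R}^d)\}$ and $L_xf=h$, i.e. $\widehat{L_xf}=\psi\hat f$; for $f$ in the Sobolev space $W^{2,1}(\mathbb{R}^d)$, $$L_xf(x)=a\cdot\nabla f(x)+\tfrac12\nabla\cdot Q\nabla f(x)+\int_{y\ne0}\Big(f(x+y)-f(x)-\frac{\nabla f(x)\cdot y}{1+\|y\|^2}\Big)\phi(dy).$$ $L_x^2$ is $L_x$ applied twice. Solutions are understood as functions $t\mapsto u(t,\cdot)$ with values in $L^1(\mathbb{R}^d)$, continuous on $[0,\infty)$, with the equations holding in $L^1(\mathbb{R}^d)$ for $t>0$; uniqueness is as an element of $L^1(\mathbb{R}^d)$, i.e. $dx$-a.e. for every $t>0$. The Caputo fractional derivative $\partial^\beta g(t)/\partial t^\beta$, $0<\beta<1$, is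 the function of $t>0$ whose Laplace transform is $s^\beta\tilde g(s)-s^{\beta-1}g(0)$, where $\tilde g(s)=\int_0^\infty e^{-st}g(t)\,dt$ (so for the fractional problem the solutions considered are those for which these Laplace transforms exist for all large $s$). *)

theory Defs imports "HOL-Probability.Probability" begin

section \<open>Completeness and separability of the space of integrable functions\<close>

lemma L1_seq_complete:
  fixes g :: "nat \<Rightarrow> 'a \<Rightarrow> 'b::{banach, second_countable_topology}"
  assumes g: "\<And>n. integrable M (g n)"
    and fast: "\<And>n. (LINT x|M. norm (g (Suc n) x - g n x)) \<le> (1/2) ^ n"
  obtains h where "integrable M h" "(\<lambda>n. LINT x|M. norm (g n x - h x)) \<longlonglongrightarrow> 0"
proof -
  define d where "d k x = g (Suc k) x - g k x" for k x
  have d: "integrable M (d k)" for k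
    unfolding d_def using g by simp
  have nd: "(LINT x|M. norm (d k x)) \<le> (1/2) ^ k" for k
    using fast by (simp add: d_def)
  have sum: "summable (\<lambda>k. LINT x|M. norm (d k x))"
    by (rule summable_comparison_test'[of "\<lambda>k. (1/2::real) ^ k" 0])
      (use nd in \<open>auto simp: summable_geometric_iff\<close>)
  have "(\<integral>\<^sup>+x. (\<Sum>k. ennreal (norm (d k x))) \<partial>M) = (\<Sum>k. \<integral>\<^sup>+x. ennreal (norm (d k x)) \<partial>M)"
    using d by (intro nn_integral_suminf) auto
  also have "\<dots> = (\<Sum>k. ennreal (LINT x|M. norm (d k x)))"
    using d by (simp add: nn_integral_eq_integral)
  also have "\<dots> = ennreal (\<Sum>k. LINT x|M. norm (d k x))"
    by (rule suminf_ennreal2[OF _ sum]) simp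
  finally have "(\<integral>\<^sup>+x. (\<Sum>k. ennreal (norm (d k x))) \<partial>M) \<noteq> \<infinity>"
    by simp
  then have "AE x in M. (\<Sum>k. ennreal (norm (d k x))) \<noteq> \<infinity>"
    using d by (intro nn_integral_PInf_AE) auto
  then have AE: "AE x in M. summable (\<lambda>k. norm (d k x))"
    by eventually_elim (rule summable_suminf_not_top, auto)
  define w where "w x = (\<Sum>k. norm (d k x))" for x
  have w: "integrable M w"
    unfolding w_def using d AE sum by (intro integrable_suminf) auto
  define h where "h x = g 0 x + (\<Sum>k. d k x)" for x
  have h: "integrable M h"
    unfolding h_def using g d AE sum
    by (intro Bochner_Integration.integrable_add integrable_suminf) auto
  have tele: "g n x = g 0 x + (\<Sum>k<n. d k x)" for n x
    by (induction n) (auto simp: d_def)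
  have lim: "AE x in M. (\<lambda>n. norm (g n x - h x)) \<longlonglongrightarrow> 0"
    using AE
  proof eventually_elim
    case (elim x)
    then have "(\<lambda>n. \<Sum>k<n. d k x) \<longlonglongrightarrow> (\<Sum>k. d k x)"
      by (rule summable_LIMSEQ[OF summable_norm_cancel])
    then have "(\<lambda>n. g 0 x + (\<Sum>k<n. d k x)) \<longlonglongrightarrow> h x"
      unfolding h_def by (intro tendsto_add tendsto_const)
    then have "(\<lambda>n. g n x) \<longlonglongrightarrow> h x"
      unfolding tele[symmetric] .
    then show ?case
      by (intro tendsto_norm_zero LIM_zero)
  qed
  have bound: "AE x in M. norm (norm (g n x - h x)) \<le> w x" for n
    using AE
  proof eventually_elim
    case (elim x)
    have s: "summable (\<lambda>k. d k x)"
      using elim by (rule summable_norm_cancel)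
    have "h x - g n x = (\<Sum>k. d (k + n) x)"
      using suminf_split_initial_segment[OF s, of n] by (simp add: h_def tele[of n])
    then have "norm (g n x - h x) = norm (\<Sum>k. d (k + n) x)"
      by (metis norm_minus_commute)
    also have "\<dots> \<le> (\<Sum>k. norm (d (k + n) x))"
      using elim by (intro summable_norm) (simp add: summable_iff_shift[of "\<lambda>k. norm (d k x)"])
    also have "\<dots> \<le> w x"
      using suminf_split_initial_segment[OF elim, of n] by (simp add: w_def sum_nonneg)
    finally show ?case by simp
  qed
  have "(\<lambda>n. LINT x|M. norm (g n x - h x)) \<longlonglongrightarrow> (LINT x|M. 0)"
    by (rule integral_dominated_convergence[OF _ _ w])
      (use g h lim bound in auto)
  then show thesis
    using that h by simp
qed

lemma L1_countable_dense:
  "\<exists>D :: ('a::euclidean_space \<Rightarrow> 'b::{banach, second_countable_topology}) set.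
     countable D \<and> (\<forall>d\<in>D. integrable lborel d) \<and>
     (\<forall>f. integrable lborel f \<longrightarrow> (\<forall>e>0. \<exists>d\<in>D. (LINT x|lborel. norm (f x - d x)) < e))"
proof -
  obtain Q :: "'b set" where Q: "countable Q" "\<And>U. open U \<Longrightarrow> U \<noteq> {} \<Longrightarrow> \<exists>q\<in>Q. q \<in> U"
    using countable_dense_setE by blast
  obtain B :: "'a set set" where B: "countable B" "topological_basis B"
    using ex_countable_basis by blast
  define F where "F = {S \<in> Union ` {b. finite b \<and> b \<subseteq> B}. emeasure lborel S < \<infinity>}"
  have "countable {b. finite b \<and> b \<subseteq> B}"
    using B(1) by (rule countable_Collect_finite_subset)
  then have F: "countable F"
    unfolding F_def by (auto intro: countable_subset)
  have Fopen: "S \<in> sets borel" if "S \<in> F" for S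
    using that B(2) unfolding F_def
    by (auto intro!: borel_open open_Union dest: topological_basis_open)
  define comb where "comb l = (\<lambda>x. \<Sum>(q, S)\<leftarrow>l. indicator S x *\<^sub>R q)" for l :: "('b \<times> 'a set) list"
  define D where "D = comb ` lists (Q \<times> F)"
  have cD: "countable D"
    unfolding D_def using Q(1) F by (intro countable_image countable_lists countable_SIGMA)
  have icomb: "integrable lborel (comb l)" if "l \<in> lists (Q \<times> F)" for l
    using that
  proof (induction l)
    case Nil
    then show ?case by (simp add: comb_def)
  next
    case (Cons p l)
    obtain q S where p: "p = (q, S)" by (cases p)
    from Cons.hyps p have S: "S \<in> F" by auto
    have "integrable lborel (\<lambda>x. indicator S x *\<^sub>R q)"
      using S Fopen[OF S] by (intro integrable_scaleR_left) (auto simp: F_def intro!: integrable_real_indicator)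
    with Cons show ?case by (simp add: comb_def p)
  qed
  have iD: "integrable lborel d" if "d \<in> D" for d
    using that icomb by (auto simp: D_def)
  have approx: "\<forall>e>0. \<exists>d\<in>D. (LINT x|lborel. norm (f x - d x)) < e" if "integrable lborel f"
    for f :: "'a \<Rightarrow> 'b"
    using that
  proof (induction rule: integrable_induct)
    case (base A c)
    show ?case
    proof (intro allI impI)
      fix e :: real assume e: "0 < e"
      have A: "A \<in> sets borel" and Afin: "emeasure lborel A < \<infinity>"
        using base by auto
      obtain m where m: "0 \<le> m" "emeasure lborel A = ennreal m"
        using Afin by (cases "emeasure lborel A") auto
      define e1 where "e1 = e / (3 * (m + 1))"
      have e1: "0 < e1" using e m by (simp add: e1_def)
      have "open (ball c e1)" "ball c e1 \<noteq> {}" using e1 by auto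
      then obtain q where q: "q \<in> Q" "q \<in> ball c e1" using Q(2) by blast
      define e2 where "e2 = e / (3 * (norm q + 1))"
      have nq: "0 < norm q + 1" using norm_ge_zero[of q] by linarith
      have e2: "0 < e2" using e nq by (simp add: e2_def)
      obtain U where U: "open U" "A \<subseteq> U" "emeasure lborel (U - A) < ennreal e2"
        using outer_regular_lborel[OF A e2] by blast
      have Ub: "U \<in> sets borel" using U(1) by simp
      have "emeasure lborel U = emeasure lborel A + emeasure lborel (U - A)"
        using U A Ub by (subst plus_emeasure) (auto intro!: arg_cong[where f="emeasure lborel"])
      then have Ufin: "emeasure lborel U < \<infinity>"
        using Afin U(3) by (auto simp: less_top[symmetric] ennreal_add_eq_top)
      obtain B' where B': "B' \<subseteq> B" "\<Union>B' = U"
        using B(2) U(1) by (auto simp: topological_basis_def)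
      have "countable B'" using B' B(1) by (auto intro: countable_subset)
      have "\<exists>b. (\<forall>n::nat. finite (b n) \<and> b n \<subseteq> B') \<and> (\<forall>y\<in>B'. \<exists>n. \<forall>k\<ge>n. y \<in> b k)"
        using \<open>countable B'\<close>
        by (intro exI[of _ "\<lambda>n. {y\<in>B'. to_nat_on B' y \<le> n}"])
          (auto intro!: finite_vimage_IntI[of "{..n}" "to_nat_on B'" B' for n, THEN finite_subset[rotated]])
      then obtain b where b: "\<And>n::nat. finite (b n)" "\<And>n. b n \<subseteq> B'"
          "\<And>y. y \<in> B' \<Longrightarrow> \<exists>n. \<forall>k\<ge>n. y \<in> b k" by metis
      define S where "S n = \<Union>(b n)" for n
      have SU: "S n \<subseteq> U" for n using b(2)[of n] B'(2) by (auto simp: S_def)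
      have So: "open (S n)" for n
        using b(2)[of n] B'(1) B(2) by (auto simp: S_def intro!: open_Union dest: topological_basis_open)
      have SF: "S n \<in> F" for n
      proof -
        have "emeasure lborel (S n) \<le> emeasure lborel U"
          using SU Ub by (intro emeasure_mono) auto
        then have "emeasure lborel (S n) < \<infinity>" using Ufin by simp
        then show ?thesis
          using b(1)[of n] b(2)[of n] B'(1) by (auto simp: F_def S_def)
      qed
      have iA: "integrable lborel (indicator A :: 'a \<Rightarrow> real)"
        using A Afin by (intro integrable_real_indicator) auto
      have iU: "integrable lborel (indicator U :: 'a \<Rightarrow> real)"
        using Ub Ufin by (intro integrable_real_indicator) auto
      have iS: "integrable lborel (indicator (S n) :: 'a \<Rightarrow> real)" for n
        using SF[of n] So[of n] by (intro integrable_real_indicator) (auto simp: F_def)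
      have "(\<lambda>n. LINT x|lborel. \<bar>indicat_real U x - indicat_real (S n) x\<bar>) \<longlonglongrightarrow> (LINT (x::'a)|lborel. (0::real))"
      proof (rule integral_dominated_convergence[OF _ _ iU])
        show "AE x in lborel. (\<lambda>n. \<bar>indicat_real U x - indicat_real (S n) x\<bar>) \<longlonglongrightarrow> (0::real)"
        proof (intro AE_I2)
          fix x
          have "\<forall>\<^sub>F n in sequentially. \<bar>indicat_real U x - indicat_real (S n) x\<bar> = (0::real)"
          proof (cases "x \<in> U")
            case True
            then obtain y where y: "y \<in> B'" "x \<in> y" using B'(2) by auto
            then obtain n where "\<forall>k\<ge>n. y \<in> b k" using b(3) by blast
            then have "\<forall>k\<ge>n. x \<in> S k" using y by (auto simp: S_def)
            then show ?thesis using True by (auto simp: eventually_sequentially indicator_def intro!: exI[of _ n])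
          next
            case False
            then have "x \<notin> S n" for n using SU[of n] by blast
            with False show ?thesis by simp
          qed
          then show "(\<lambda>n. \<bar>indicat_real U x - indicat_real (S n) x\<bar>) \<longlonglongrightarrow> (0::real)"
            by (rule tendsto_eventually)
        qed
        show "AE x in lborel. norm \<bar>indicat_real U x - indicat_real (S n) x :: real\<bar> \<le> indicat_real U x" for n
          using SU[of n] by (intro AE_I2) (auto simp: indicator_def)
      qed (use Ub So in auto)
      then have "\<forall>\<^sub>F n in sequentially. (LINT x|lborel. \<bar>indicat_real U x - indicat_real (S n) x\<bar>) < e2"
        using e2 by (auto dest: order_tendstoD)
      then obtain n where n: "(LINT x|lborel. \<bar>indicat_real U x - indicat_real (S n) x\<bar>) < e2"
        by (auto simp: eventually_sequentially)
      have UA: "(LINT x|lborel. \<bar>indicat_real U x - indicat_real A x\<bar>) < e2"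
      proof -
        have "(LINT x|lborel. \<bar>indicat_real U x - indicat_real A x\<bar>) = (LINT x|lborel. indicat_real (U - A) x)"
          using U(2) by (intro Bochner_Integration.integral_cong) (auto simp: indicator_def)
        also have "\<dots> = measure lborel (U - A)" by simp
        also have "ennreal \<dots> < ennreal e2"
          using U(3) by (subst emeasure_eq_ennreal_measure[symmetric]) auto
        finally show ?thesis by (simp add: ennreal_less_iff)
      qed
      have mA: "(LINT x|lborel. indicat_real A x) = m"
        using m by (simp add: measure_def)
      define d where "d = comb [(q, S n)]"
      have dD: "d \<in> D" using q SF[of n] by (auto simp: d_def D_def)
      have d: "d x = indicat_real (S n) x *\<^sub>R q" for x by (simp add: d_def comb_def)
      have "(LINT x|lborel. norm (indicat_real A x *\<^sub>R c - d x)) \<le>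
        (LINT x|lborel. e1 * indicat_real A x + (norm q * \<bar>indicat_real U x - indicat_real A x\<bar>
           + norm q * \<bar>indicat_real U x - indicat_real (S n) x\<bar>))"
      proof (rule integral_mono)
        fix x
        have "indicat_real A x *\<^sub>R c - d x = indicat_real A x *\<^sub>R (c - q)
           + (- (indicat_real U x - indicat_real A x) *\<^sub>R q + (indicat_real U x - indicat_real (S n) x) *\<^sub>R q)"
          by (simp add: d algebra_simps)
        also have "norm \<dots> \<le> norm (indicat_real A x *\<^sub>R (c - q))
           + (norm ((indicat_real U x - indicat_real A x) *\<^sub>R q) + norm ((indicat_real U x - indicat_real (S n) x) *\<^sub>R q))"
          by (metis (no_types, opaque_lifting) add_left_mono norm_triangle_ineq norm_minus_cancel scaleR_minus_left order_trans)
        also have "\<dots> \<le> e1 * indicat_real A x + (norm q * \<bar>indicat_real U x - indicat_real A x\<bar>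
           + norm q * \<bar>indicat_real U x - indicat_real (S n) x\<bar>)"
          using q(2) by (auto simp: dist_norm indicator_def)
        finally show "norm (indicat_real A x *\<^sub>R c - d x) \<le> \<dots>" .
      next
        have "integrable lborel (\<lambda>x. indicat_real A x *\<^sub>R c)"
          using iA by simp
        then show "integrable lborel (\<lambda>x. norm (indicat_real A x *\<^sub>R c - d x))"
          using iD[OF dD] by simp
      qed (use iA iU iS in auto)
      also have "\<dots> = e1 * m + (norm q * (LINT x|lborel. \<bar>indicat_real U x - indicat_real A x\<bar>)
           + norm q * (LINT x|lborel. \<bar>indicat_real U x - indicat_real (S n) x\<bar>))"
        using iA iU iS mA by simp
      also have "\<dots> \<le> e1 * m + (norm q * e2 + norm q * e2)"
        using UA n e1 by (intro add_mono mult_left_mono) auto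
      also have "\<dots> < e"
      proof -
        have "e1 * m \<le> e / 3"
          using m(1) e by (simp add: e1_def field_simps)
        moreover have "norm q * e2 < e / 3"
          using e nq by (simp add: e2_def field_simps)
        ultimately show ?thesis by linarith
      qed
      finally show "\<exists>d\<in>D. (LINT x|lborel. norm (indicat_real A x *\<^sub>R c - d x)) < e"
        using dD by blast
    qed
  next
    case (add f g)
    show ?case
    proof (intro allI impI)
      fix e :: real assume e: "0 < e"
      obtain d1 where d1: "d1 \<in> D" "(LINT x|lborel. norm (f x - d1 x)) < e / 2"
        using add.IH(1) e by (metis half_gt_zero)
      obtain d2 where d2: "d2 \<in> D" "(LINT x|lborel. norm (g x - d2 x)) < e / 2"
        using add.IH(2) e by (metis half_gt_zero)
      obtain l1 l2 where l: "l1 \<in> lists (Q \<times> F)" "d1 = comb l1" "l2 \<in> lists (Q \<times> F)" "d2 = comb l2"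
        using d1(1) d2(1) by (auto simp: D_def)
      define d where "d = comb (l1 @ l2)"
      have d: "d x = d1 x + d2 x" for x by (simp add: d_def l comb_def)
      have dD: "d \<in> D" using l by (auto simp: d_def D_def)
      have "(LINT x|lborel. norm (f x + g x - d x))
        \<le> (LINT x|lborel. norm (f x - d1 x) + norm (g x - d2 x))"
      proof (rule integral_mono)
        show "norm (f x + g x - d x) \<le> norm (f x - d1 x) + norm (g x - d2 x)" for x
          unfolding d by (metis add_diff_add norm_triangle_ineq)
      qed (use add iD[OF dD] iD[OF d1(1)] iD[OF d2(1)] in auto)
      also have "\<dots> < e"
        using add iD[OF d1(1)] iD[OF d2(1)] d1(2) d2(2) by simp
      finally show "\<exists>d\<in>D. (LINT x|lborel. norm (f x + g x - d x)) < e"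
        using dD by blast
    qed
  next
    case (lim f s)
    show ?case
    proof (intro allI impI)
      fix e :: real assume e: "0 < e"
      have "(\<lambda>i. LINT x|lborel. norm (f x - s i x)) \<longlonglongrightarrow> (LINT (x::'a)|lborel. (0::real))"
      proof (rule integral_dominated_convergence)
        show "integrable lborel (\<lambda>x. 3 * norm (f x))" using lim by simp
        show "AE x in lborel. (\<lambda>i. norm (f x - s i x)) \<longlonglongrightarrow> 0"
        proof (intro AE_I2)
          fix x
          have "(\<lambda>i. s i x) \<longlonglongrightarrow> f x" using lim by simp
          then have "(\<lambda>i. norm (f x - s i x)) \<longlonglongrightarrow> norm (f x - f x)" by (intro tendsto_intros)
          then show "(\<lambda>i. norm (f x - s i x)) \<longlonglongrightarrow> 0" by simp
        qed
        show "AE x in lborel. norm (norm (f x - s i x)) \<le> 3 * norm (f x)" for i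
        proof (intro AE_I2)
          fix x
          have "norm (f x - s i x) \<le> norm (f x) + norm (s i x)" by (rule norm_triangle_ineq4)
          also have "norm (s i x) \<le> 2 * norm (f x)" using lim by simp
          finally show "norm (norm (f x - s i x)) \<le> 3 * norm (f x)" by simp
        qed
      qed (use lim in auto)
      then have "(\<lambda>i. LINT x|lborel. norm (f x - s i x)) \<longlonglongrightarrow> 0" by simp
      then have "\<forall>\<^sub>F i in sequentially. (LINT x|lborel. norm (f x - s i x)) < e / 2"
        by (rule order_tendstoD(2)) (use e in simp)
      then obtain i where i: "(LINT x|lborel. norm (f x - s i x)) < e / 2"
        unfolding eventually_sequentially by blast
      obtain d where d: "d \<in> D" "(LINT x|lborel. norm (s i x - d x)) < e / 2"
        using lim.IH[of i] e by (metis half_gt_zero)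
      have "(LINT x|lborel. norm (f x - d x))
        \<le> (LINT x|lborel. norm (f x - s i x) + norm (s i x - d x))"
      proof (rule integral_mono)
        show "norm (f x - d x) \<le> norm (f x - s i x) + norm (s i x - d x)" for x
          by (metis norm_triangle_ineq diff_add_cancel add_diff_eq)
      qed (use lim iD[OF d(1)] in auto)
      also have "\<dots> < e"
        using lim iD[OF d(1)] i d(2) by simp
      finally show "\<exists>d\<in>D. (LINT x|lborel. norm (f x - d x)) < e"
        using d(1) by blast
    qed
  qed
  show ?thesis
    using cD iD approx by blast
qed


section \<open>The Banach space of complex-valued integrable functions modulo null functions\<close>

definition L1_rel :: "('a::euclidean_space \<Rightarrow> complex) \<Rightarrow> ('a \<Rightarrow> complex) \<Rightarrow> bool" where
  "L1_rel f g \<longleftrightarrow> integrable lborel f \<and> integrable lborel g \<and> (AE x in lborel. f x = g x)"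

lemma part_equivp_L1_rel: "part_equivp L1_rel"
proof (rule part_equivpI)
  show "\<exists>f. L1_rel f f"
    by (rule exI[of _ "\<lambda>_. 0"]) (simp add: L1_rel_def)
  show "symp L1_rel"
    by (auto simp: L1_rel_def symp_def)
  show "transp L1_rel"
    by (auto simp: L1_rel_def transp_def)
qed

quotient_type (overloaded) 'a L1 = "'a::euclidean_space \<Rightarrow> complex" / partial: L1_rel
  by (rule part_equivp_L1_rel)

instantiation L1 :: (euclidean_space) real_vector
begin

lift_definition zero_L1 :: "'a L1" is "\<lambda>_. 0"
  by (simp add: L1_rel_def)

lift_definition plus_L1 :: "'a L1 \<Rightarrow> 'a L1 \<Rightarrow> 'a L1" is "\<lambda>f g x. f x + g x"
  by (auto simp: L1_rel_def)

lift_definition minus_L1 :: "'a L1 \<Rightarrow> 'a L1 \<Rightarrow> 'a L1" is "\<lambda>f g x. f x - g x"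
  by (auto simp: L1_rel_def)

lift_definition uminus_L1 :: "'a L1 \<Rightarrow> 'a L1" is "\<lambda>f x. - f x"
  by (auto simp: L1_rel_def)

lift_definition scaleR_L1 :: "real \<Rightarrow> 'a L1 \<Rightarrow> 'a L1" is "\<lambda>c f x. c *\<^sub>R f x"
  by (auto simp: L1_rel_def)

instance
proof
  fix f g h :: "'a L1" and a b :: real
  show "f + g + h = f + (g + h)"
    by transfer (auto simp: L1_rel_def add.assoc)
  show "f + g = g + f"
    by transfer (auto simp: L1_rel_def add.commute)
  show "0 + f = f"
    by transfer (auto simp: L1_rel_def)
  show "- f + f = 0"
    by transfer (auto simp: L1_rel_def)
  show "f - g = f + - g"
    by transfer (auto simp: L1_rel_def)
  show "a *\<^sub>R (f + g) = a *\<^sub>R f + a *\<^sub>R g"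
    by transfer (auto simp: L1_rel_def scaleR_add_right)
  show "(a + b) *\<^sub>R f = a *\<^sub>R f + b *\<^sub>R f"
    by transfer (auto simp: L1_rel_def scaleR_add_left)
  show "a *\<^sub>R b *\<^sub>R f = (a * b) *\<^sub>R f"
    by transfer (auto simp: L1_rel_def)
  show "1 *\<^sub>R f = f"
    by transfer (auto simp: L1_rel_def)
qed

end

instantiation L1 :: (euclidean_space) real_normed_vector
begin

lift_definition norm_L1 :: "'a L1 \<Rightarrow> real" is "\<lambda>f. LINT x|lborel. norm (f x)"
  by (auto simp: L1_rel_def intro!: integral_cong_AE)

definition dist_L1 :: "'a L1 \<Rightarrow> 'a L1 \<Rightarrow> real" where
  "dist_L1 f g = norm (f - g)"

definition sgn_L1 :: "'a L1 \<Rightarrow> 'a L1" where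
  "sgn_L1 f = f /\<^sub>R norm f"

definition uniformity_L1 :: "('a L1 \<times> 'a L1) filter" where
  "uniformity_L1 = (INF e\<in>{0 <..}. principal {(f, g). dist f g < e})"

definition open_L1 :: "'a L1 set \<Rightarrow> bool" where
  "open_L1 S \<longleftrightarrow> (\<forall>f\<in>S. \<forall>\<^sub>F (f', g) in uniformity. f' = f \<longrightarrow> g \<in> S)"

instance
proof
  fix f g :: "'a L1" and a :: real
  show "dist f g = norm (f - g)"
    by (fact dist_L1_def)
  show "sgn f = f /\<^sub>R norm f"
    by (fact sgn_L1_def)
  show "(uniformity :: ('a L1 \<times> 'a L1) filter) = (INF e\<in>{0 <..}. principal {(f, g). dist f g < e})"
    by (fact uniformity_L1_def)
  show "open S \<longleftrightarrow> (\<forall>f\<in>S. \<forall>\<^sub>F (f', g) in uniformity. f' = f \<longrightarrow> g \<in> S)" for S :: "'a L1 set"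
    by (fact open_L1_def)
  show "norm f = 0 \<longleftrightarrow> f = 0"
    by transfer (auto simp: L1_rel_def integral_nonneg_eq_0_iff_AE)
  show "norm (f + g) \<le> norm f + norm g"
  proof transfer
    fix f g :: "'a \<Rightarrow> complex"
    assume "L1_rel f f" "L1_rel g g"
    then have fg: "integrable lborel f" "integrable lborel g"
      by (auto simp: L1_rel_def)
    then have "(LINT x|lborel. norm (f x + g x)) \<le> (LINT x|lborel. norm (f x) + norm (g x))"
      by (intro integral_mono) (auto intro: norm_triangle_ineq)
    then show "(LINT x|lborel. norm (f x + g x))
        \<le> (LINT x|lborel. norm (f x)) + (LINT x|lborel. norm (g x))"
      using fg by simp
  qed
  show "norm (a *\<^sub>R f) = \<bar>a\<bar> * norm f"
    by transfer simp
qed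

end

lemma integrable_rep_L1 [simp]: "integrable lborel (rep_L1 f)"
  using Quotient_rep_reflp[OF Quotient_L1, of f] by (simp add: L1_rel_def)

lemma abs_rep_L1 [simp]: "abs_L1 (rep_L1 f) = f"
  by (rule Quotient_abs_rep[OF Quotient_L1])

lemma norm_diff_abs_L1:
  assumes "integrable lborel f" "integrable lborel g"
  shows "norm (abs_L1 f - abs_L1 g) = (LINT x|lborel. norm (f x - g x))"
  using assms by (simp add: minus_L1.abs_eq norm_L1.abs_eq L1_rel_def)

instance L1 :: (euclidean_space) banach
proof
  fix F :: "nat \<Rightarrow> 'a L1"
  assume F: "Cauchy F"
  have "\<exists>N. \<forall>m\<ge>N. \<forall>n\<ge>N. norm (F m - F n) < (1/2) ^ k" for k :: nat
    using F by (auto simp: Cauchy_def dist_norm)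
  then obtain N where N: "\<And>k m n. N k \<le> m \<Longrightarrow> N k \<le> n \<Longrightarrow> norm (F m - F n) < (1/2) ^ k"
    by metis
  define r where "r k = (\<Sum>i\<le>k. Suc (N i))" for k
  have r: "strict_mono r"
    by (rule strict_monoI_Suc) (simp add: r_def)
  have rN: "N k \<le> r k" for k
    by (cases k) (auto simp: r_def)
  have rN': "N k \<le> r (Suc k)" for k
    using rN[of k] strict_mono_less[OF r, of k "Suc k"] by simp
  have n: "norm (F m - F n) = (LINT x|lborel. norm (rep_L1 (F m) x - rep_L1 (F n) x))" for m n
    using norm_diff_abs_L1[of "rep_L1 (F m)" "rep_L1 (F n)"] by simp
  have fast: "(LINT x|lborel. norm (rep_L1 (F (r (Suc k))) x - rep_L1 (F (r k)) x)) \<le> (1/2) ^ k" for k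
    using N[OF rN' rN, of k] by (simp add: n)
  obtain h where h: "integrable lborel h"
      "(\<lambda>k. LINT x|lborel. norm (rep_L1 (F (r k)) x - h x)) \<longlonglongrightarrow> 0"
    using L1_seq_complete[of lborel "\<lambda>k. rep_L1 (F (r k))", OF _ fast] by auto
  have "norm (F (r k) - abs_L1 h) = (LINT x|lborel. norm (rep_L1 (F (r k)) x - h x))" for k
    using norm_diff_abs_L1[of "rep_L1 (F (r k))" h] h(1) by simp
  with h(2) have "(\<lambda>k. F (r k)) \<longlonglongrightarrow> abs_L1 h"
    by (simp add: tendsto_dist_iff[of _ "abs_L1 h"] dist_norm)
  then have "F \<longlonglongrightarrow> abs_L1 h"
    by (rule Cauchy_converges_subseq[OF F r, unfolded o_def])
  then show "convergent F"
    by (rule convergentI)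
qed

instance L1 :: (euclidean_space) second_countable_topology
proof
  obtain D0 :: "('a \<Rightarrow> complex) set" where D0': "countable D0"
      "\<forall>d\<in>D0. integrable lborel d"
      "\<forall>f. integrable lborel f \<longrightarrow> (\<forall>e>0. \<exists>d\<in>D0. (LINT x|lborel. norm (f x - d x)) < e)"
    using L1_countable_dense[where 'a='a and 'b=complex] by (elim exE conjE)
  have D0: "countable D0" "\<And>d. d \<in> D0 \<Longrightarrow> integrable lborel d"
      "\<And>f e. integrable lborel f \<Longrightarrow> 0 < e \<Longrightarrow> \<exists>d\<in>D0. (LINT x|lborel. norm (f x - d x)) < e"
    using D0' by simp_all
  define D where "D = abs_L1 ` D0"
  have dense: "\<exists>d\<in>D. dist d f < e" if e: "0 < e" for f :: "'a L1" and e :: real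
  proof -
    obtain d where d: "d \<in> D0" "(LINT x|lborel. norm (rep_L1 f x - d x)) < e"
      using D0(3)[OF integrable_rep_L1 e] by blast
    have "dist (abs_L1 d) f = (LINT x|lborel. norm (rep_L1 f x - d x))"
      using norm_diff_abs_L1[OF integrable_rep_L1[of f] D0(2)[OF d(1)]]
      by (simp add: dist_norm norm_minus_commute)
    with d show ?thesis unfolding D_def by (intro bexI[of _ "abs_L1 d"]) auto
  qed
  define B where "B = (\<lambda>(d, n). ball d (1 / real (Suc n))) ` (D \<times> UNIV)"
  have "countable B"
    unfolding B_def D_def using D0(1) by (intro countable_image countable_SIGMA) auto
  moreover have "topological_basis B"
  proof (rule topological_basisI)
    show "open U" if "U \<in> B" for U using that by (auto simp: B_def)
  next
    fix U :: "'a L1 set" and f assume U: "open U" "f \<in> U"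
    then obtain e where e: "0 < e" "ball f e \<subseteq> U" by (meson open_contains_ball)
    obtain n where n: "1 / real (Suc n) < e / 2"
      using nat_approx_posE[of "e / 2"] e(1) by auto
    obtain d where d: "d \<in> D" "dist d f < 1 / real (Suc n)"
      using dense[of "1 / real (Suc n)" f] by auto
    have "ball d (1 / real (Suc n)) \<subseteq> ball f e"
    proof
      fix g assume "g \<in> ball d (1 / real (Suc n))"
      then have "dist d g < 1 / real (Suc n)" by simp
      moreover have "dist f g \<le> dist d f + dist d g" by (metis dist_commute dist_triangle)
      ultimately have "dist f g < e" using d(2) n by linarith
      then show "g \<in> ball f e" by simp
    qed
    then show "\<exists>B'\<in>B. f \<in> B' \<and> B' \<subseteq> U"
      using d e(2) by (intro bexI[of _ "ball d (1 / real (Suc n))"]) (auto simp: B_def)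
  qed
  ultimately show "\<exists>B :: 'a L1 set set. countable B \<and> open = generate_topology B"
    using topological_basis_imp_subbasis by blast
qed


section \<open>Levy processes, semigroups and generators\<close>

text \<open>
  Path regularity (cadlag modification) is not required: all notions below depend on the process
  only through its one-dimensional distributions.
\<close>

locale levy_process = prob_space M
  for M :: "'w measure" +
  fixes X :: "real \<Rightarrow> 'w \<Rightarrow> 'a::euclidean_space"
  assumes measurable_process: "0 \<le> t \<Longrightarrow> X t \<in> borel_measurable M"
    and start_at_zero: "AE \<omega> in M. X 0 \<omega> = 0"
    and independent_increments:
      "0 \<le> \<tau> 0 \<Longrightarrow> incseq \<tau> \<Longrightarrow>
        indep_vars (\<lambda>_. borel) (\<lambda>i \<omega>. X (\<tau> (Suc i)) \<omega> - X (\<tau> i) \<omega>) {..<n::nat}"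
    and stationary_increments:
      "0 \<le> s \<Longrightarrow> s \<le> t \<Longrightarrow>
        distr M borel (\<lambda>\<omega>. X t \<omega> - X s \<omega>) = distr M borel (X (t - s))"
    and stochastically_continuous:
      "0 \<le> t \<Longrightarrow> 0 < \<epsilon> \<Longrightarrow>
        ((\<lambda>s. prob {\<omega> \<in> space M. \<epsilon> < dist (X s \<omega>) (X t \<omega>)}) \<longlongrightarrow> 0) (at t within {0..})"

text \<open>
  \<open>T(t)f(x) = E[f(x + X(t))]\<close>; by Fubini the right-hand side is integrable in \<open>x\<close>, and its
  class does not depend on the representative \<^term>\<open>rep_L1 f\<close> of \<open>f\<close>.
\<close>

definition levy_semigroup ::
    "'w measure \<Rightarrow> (real \<Rightarrow> 'w \<Rightarrow> 'a::euclidean_space) \<Rightarrow> real \<Rightarrow> 'a L1 \<Rightarrow> 'a L1" where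
  "levy_semigroup M X t f = abs_L1 (\<lambda>x. LINT \<omega>|M. rep_L1 f (x + X t \<omega>))"

definition generator_domain :: "(real \<Rightarrow> 'b \<Rightarrow> 'b) \<Rightarrow> 'b::real_normed_vector set" where
  "generator_domain T = {f. \<exists>h. ((\<lambda>t. (T t f - f) /\<^sub>R t) \<longlongrightarrow> h) (at_right 0)}"

definition generator :: "(real \<Rightarrow> 'b \<Rightarrow> 'b) \<Rightarrow> 'b \<Rightarrow> 'b::real_normed_vector" where
  "generator T f = Lim (at_right 0) (\<lambda>t. (T t f - f) /\<^sub>R t)"


section \<open>The two Cauchy problems\<close>

definition laplace_integrable :: "(real \<Rightarrow> 'b::{banach, second_countable_topology}) \<Rightarrow> real \<Rightarrow> bool" where
  "laplace_integrable g s \<longleftrightarrow> set_integrable lborel {0<..} (\<lambda>t. exp (- (s * t)) *\<^sub>R g t)"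

definition laplace :: "(real \<Rightarrow> 'b::{banach, second_countable_topology}) \<Rightarrow> real \<Rightarrow> 'b" where
  "laplace g s = (LINT t:{0<..}|lborel. exp (- (s * t)) *\<^sub>R g t)"

text \<open>
  The Caputo derivative is characterised by its Laplace transform, hence only up to null sets of
  times; \<open>has_caputo_derivative \<beta> g h\<close> says that \<open>h\<close> is a version of it (\<open>0 < \<beta> < 1\<close>).
\<close>

definition has_caputo_derivative ::
    "real \<Rightarrow> (real \<Rightarrow> 'b) \<Rightarrow> (real \<Rightarrow> 'b::{banach, second_countable_topology}) \<Rightarrow> bool" where
  "has_caputo_derivative \<beta> g h \<longleftrightarrow>
    (\<forall>\<^sub>F s in at_top. laplace_integrable g s \<and> laplace_integrable h s \<and>
       laplace h s = s powr \<beta> *\<^sub>R laplace g s - s powr (\<beta> - 1) *\<^sub>R g 0)"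

text \<open>Both problems are posed for functions of \<open>t \<ge> 0\<close>; values at negative times play no role.\<close>

definition fractional_cauchy_solution ::
    "real \<Rightarrow> (real \<Rightarrow> 'b \<Rightarrow> 'b) \<Rightarrow> 'b \<Rightarrow> (real \<Rightarrow> 'b::{banach, second_countable_topology}) \<Rightarrow> bool" where
  "fractional_cauchy_solution \<beta> T f u \<longleftrightarrow>
    continuous_on {0..} u \<and> u 0 = f \<and> (\<forall>t>0. u t \<in> generator_domain T) \<and>
    has_caputo_derivative \<beta> u (\<lambda>t. generator T (u t))"

definition second_order_ivp_solution ::
    "(real \<Rightarrow> 'b \<Rightarrow> 'b) \<Rightarrow> 'b \<Rightarrow> (real \<Rightarrow> 'b::{banach, second_countable_topology}) \<Rightarrow> bool" where
  "second_order_ivp_solution T f u \<longleftrightarrow>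
    continuous_on {0..} u \<and> u 0 = f \<and>
    (\<forall>t>0. u t \<in> generator_domain T \<and> generator T (u t) \<in> generator_domain T \<and>
       (u has_vector_derivative
         (1 / sqrt (pi * t)) *\<^sub>R generator T f + generator T (generator T (u t))) (at t))"

end

theory Submission
  imports Defs "HOL-Real_Asymp.Real_Asymp"
begin

text \<open>
  Let \<open>p t s = exp (- s\<^sup>2 / (4 t)) / sqrt (pi t)\<close>, so that \<open>u t = \<integral> p t s T s f ds\<close>. Two facts
  about integrals \<open>J q g = \<integral> q s T s g ds\<close> over the half-line give existence for every strongly
  continuous contraction semigroup: \<open>L (J q g) = - q 0 g - J q' g\<close> for smooth decaying \<open>q\<close>, and
  \<open>L (J q g) = J q (L g)\<close> for \<open>g\<close> in the domain. Since \<open>p\<close> solves the heat equation, has vanishing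
  \<open>s\<close>-derivative at \<open>s = 0\<close> and \<open>p t 0 = 1 / sqrt (pi t)\<close>, the first problem follows by
  differentiating in \<open>t\<close>; since the Laplace transform of \<open>p\<close> in \<open>t\<close> is \<open>exp (- s sqrt \<lambda>) / sqrt \<lambda>\<close>, the
  transform of \<open>u\<close> is a multiple of the resolvent of \<open>L\<close> at \<open>sqrt \<lambda>\<close>, which is the fractional problem.

  Uniqueness of the second-order problem fails for general contraction semigroups (for instance for left
  translation on the half-line), and here rests on the Fourier transform: every frequency
  \<open>k\<close> turns \<open>L\<close> into multiplication by a number \<open>\<psi> k\<close>, so the difference of two solutions satisfies
  \<open>w' = (\<psi> k)\<^sup>2 w\<close> with \<open>w 0 = 0\<close>, respectively has a Laplace transform annihilated by \<open>sqrt \<lambda> - \<psi> k\<close>.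
\<close>

section \<open>Injectivity of the Fourier and Laplace transforms\<close>

text \<open>Since \<open>f\<close> is only assumed to lie in the domain of \<open>L\<close>, not of
  \<open>L\<^sup>2\<close>, the two copies of \<open>L\<close> cannot both be moved onto
  \<open>f\<close>. One goes onto \<open>f\<close> and gives \<open>J p (L f)\<close>; the other
  goes onto the kernel by the formula valid for every vector, and its boundary term is cancelled by
  the inhomogeneity \<open>L f / sqrt (pi t)\<close>. What remains, \<open>- J p_s (L f)\<close>,
  equals \<open>J p_ss f\<close>, because the two formulas for \<open>L (J p_s f)\<close> must
  agree; this is where the vanishing of \<open>p_s\<close> at 0 enters. Of the Fourier transform
  only injectivity is used. The number \<open>\<psi> k\<close> is never computed: it is the limit of
  difference quotients of the characteristic function, and the limit exists as soon as one element
  of the domain has nonzero transform at \<open>k\<close>. Both injectivity theorems follow one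
  scheme: from polynomials in a bounded map to continuous functions, and from these to Borel
  indicators.\<close>

lemma integrable_scaleR_bounded:
  fixes f :: "'c \<Rightarrow> 'b::{banach, second_countable_topology}" and g :: "'c \<Rightarrow> real"
  assumes "integrable M f" "g \<in> borel_measurable M" "\<And>x. \<bar>g x\<bar> \<le> B"
  shows "integrable M (\<lambda>x. g x *\<^sub>R f x)"
proof (rule Bochner_Integration.integrable_bound)
  show "integrable M (\<lambda>x. B *\<^sub>R f x)" using assms(1) by simp
  have "\<bar>g x\<bar> \<le> \<bar>B\<bar>" for x using assms(3)[of x] by linarith
  then show "AE x in M. norm (g x *\<^sub>R f x) \<le> norm (B *\<^sub>R f x)"
    by (auto intro!: mult_right_mono)
qed (use assms(1,2) in measurable)

lemma integrable_cis_mult: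
  fixes f :: "'c \<Rightarrow> complex"
  assumes "integrable M f" "g \<in> borel_measurable M"
  shows "integrable M (\<lambda>x. cis (g x) * f x)"
proof (rule Bochner_Integration.integrable_bound[OF assms(1)])
  have "cis \<in> borel_measurable borel"
    by (intro borel_measurable_continuous_onI continuous_intros)
  from measurable_compose[OF assms(2) this]
  show "(\<lambda>x. cis (g x) * f x) \<in> borel_measurable M"
    using assms(1) by simp
qed (simp add: norm_mult)

text \<open>Stone-Weierstrass on the compact set \<open>S\<close> replaces \<open>h\<close> by a
  polynomial up to an error \<open>e\<close>, which costs at most \<open>e\<close> times the L1 norm
  of \<open>f\<close>. It serves the Fourier case with trigonometric \<open>\<Phi>\<close> and the
  Laplace case with exponential \<open>\<Phi>\<close>.\<close>

lemma integral_continuous_comp_eq_0: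
  fixes f :: "'c \<Rightarrow> 'b::{banach, second_countable_topology}" and \<Phi> :: "'c \<Rightarrow> 'a::euclidean_space"
  assumes f: "integrable M f" and \<Phi>: "\<Phi> \<in> borel_measurable M"
    and S: "compact S" "\<And>x. \<Phi> x \<in> S"
    and poly: "\<And>P. real_polynomial_function P \<Longrightarrow> (LINT x|M. P (\<Phi> x) *\<^sub>R f x) = 0"
    and h: "continuous_on UNIV (h :: 'a \<Rightarrow> real)"
  shows "(LINT x|M. h (\<Phi> x) *\<^sub>R f x) = 0"
proof -
  have int: "integrable M (\<lambda>x. p (\<Phi> x) *\<^sub>R f x)" if p: "continuous_on UNIV p" for p :: "'a \<Rightarrow> real"
  proof -
    have "continuous_on S p" using p by (rule continuous_on_subset) simp
    then have "bounded (p ` S)" using S(1) by (intro compact_imp_bounded compact_continuous_image)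
    then obtain B where "\<And>y. y \<in> S \<Longrightarrow> \<bar>p y\<bar> \<le> B" by (auto simp: bounded_iff)
    then show ?thesis using S(2) p \<Phi>
      by (intro integrable_scaleR_bounded[OF f, where B=B] measurable_compose[OF \<Phi>]
            borel_measurable_continuous_onI) auto
  qed
  have "norm (LINT x|M. h (\<Phi> x) *\<^sub>R f x) \<le> e * ((LINT x|M. norm (f x)))" if e: "0 < e" for e
  proof -
    obtain P where P: "real_polynomial_function P" "\<And>y. y \<in> S \<Longrightarrow> \<bar>h y - P y\<bar> < e"
      using Stone_Weierstrass_real_polynomial_function[OF S(1) continuous_on_subset[OF h subset_UNIV] e]
      by blast
    have Pc: "continuous_on UNIV P"
      using P(1) by (simp add: continuous_on_polymonial_function real_polynomial_function_eq)
    have "(LINT x|M. h (\<Phi> x) *\<^sub>R f x) = (LINT x|M. h (\<Phi> x) *\<^sub>R f x - P (\<Phi> x) *\<^sub>R f x)"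
      using int[OF h] int[OF Pc] poly[OF P(1)] by simp
    also have "norm \<dots> \<le> (LINT x|M. norm (h (\<Phi> x) *\<^sub>R f x - P (\<Phi> x) *\<^sub>R f x))"
      by (rule integral_norm_bound)
    also have "\<dots> \<le> (LINT x|M. e * norm (f x))"
    proof (rule integral_mono)
      show "norm (h (\<Phi> x) *\<^sub>R f x - P (\<Phi> x) *\<^sub>R f x) \<le> e * norm (f x)" for x
        using P(2)[OF S(2)[of x]] by (simp add: scaleR_diff_left[symmetric] mult_right_mono)
    qed (use int[OF h] int[OF Pc] f in auto)
    finally show ?thesis by simp
  qed
  note bound = this
  have "norm (LINT x|M. h (\<Phi> x) *\<^sub>R f x) \<le> 0"
  proof (rule field_le_epsilon)
    fix e :: real assume e: "0 < e"
    define I where "I = (LINT x|M. norm (f x))"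
    have I: "0 \<le> I" unfolding I_def by simp
    \<comment> \<open>The \<open>+ 1\<close> covers the case \<open>I = 0\<close>.\<close>
    have "0 < e / (I + 1)" using e I by simp
    from bound[OF this] have "norm (LINT x|M. h (\<Phi> x) *\<^sub>R f x) \<le> e / (I + 1) * I"
      unfolding I_def .
    also have "\<dots> \<le> e" using e I by (simp add: field_simps)
    finally show "norm (LINT x|M. h (\<Phi> x) *\<^sub>R f x) \<le> 0 + e" by simp
  qed
  then show ?thesis by simp
qed

text \<open>The sets with vanishing integral form a Dynkin system. It contains the closed sets, an
  intersection-stable generator, since their indicators are limits of continuous functions with
  values in [0, 1].\<close>

lemma integral_indicator_comp_eq_0:
  fixes f :: "'c \<Rightarrow> 'b::{banach, second_countable_topology}" and \<Phi> :: "'c \<Rightarrow> 'a::metric_space"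
  assumes f: "integrable M f" and \<Phi>[measurable]: "\<Phi> \<in> borel_measurable M"
    and cont: "\<And>h :: 'a \<Rightarrow> real. continuous_on UNIV h \<Longrightarrow> (\<And>y. 0 \<le> h y \<and> h y \<le> 1) \<Longrightarrow>
      (LINT x|M. h (\<Phi> x) *\<^sub>R f x) = 0"
    and A: "A \<in> sets borel"
  shows "(LINT x|M. indicat_real A (\<Phi> x) *\<^sub>R f x) = 0"
proof -
  have meas: "(\<lambda>x. indicat_real B (\<Phi> x) *\<^sub>R f x) \<in> borel_measurable M" if [measurable]: "B \<in> sets borel" for B
    using f by measurable
  have "Int_stable (Collect closed :: 'a set set)" "Collect closed \<subseteq> Pow (UNIV :: 'a set)"
    by (auto simp: Int_stable_def)
  moreover have "A \<in> sigma_sets UNIV (Collect closed)"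
    using A by (simp add: borel_eq_closed)
  ultimately show ?thesis
  proof (induction rule: sigma_sets_induct_disjoint)
    case (basic C)
    show ?case
    \<comment> \<open>By convention \<open>infdist y {}\<close> is 0, so for the empty set the
      functions \<open>h n\<close> below would be constantly 1 instead of tending to 0.\<close>
    proof (cases "C = {}")
      case False
      have C: "closed C" using basic by simp
      define h where "h n y = max 0 (1 - real n * infdist y C)" for n y
      have h: "continuous_on UNIV (h n)" "0 \<le> h n y" "h n y \<le> 1" for n y
        by (auto simp: h_def infdist_nonneg intro!: continuous_intros)
      have hm[measurable]: "h n \<in> borel_measurable borel" for n
        using h(1) by (rule borel_measurable_continuous_onI)
      have lim: "(\<lambda>n. h n y) \<longlonglongrightarrow> indicat_real C y" for y
      proof (cases "y \<in> C")
        case True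
        then show ?thesis by (simp add: h_def)
      next
        case y: False
        then have "0 < infdist y C"
          using C False in_closed_iff_infdist_zero[of C y] infdist_nonneg[of y C] by simp
        then have "\<forall>\<^sub>F n in sequentially. 1 \<le> real n * infdist y C"
          by real_asymp
        then have "\<forall>\<^sub>F n in sequentially. h n y = 0"
          by eventually_elim (simp add: h_def)
        then show ?thesis using y by (simp add: tendsto_eventually)
      qed
      have "(\<lambda>n. LINT x|M. h n (\<Phi> x) *\<^sub>R f x) \<longlonglongrightarrow> (LINT x|M. indicat_real C (\<Phi> x) *\<^sub>R f x)"
      proof (rule integral_dominated_convergence[where w="\<lambda>x. norm (f x)"])
        show "AE x in M. (\<lambda>n. h n (\<Phi> x) *\<^sub>R f x) \<longlonglongrightarrow> indicat_real C (\<Phi> x) *\<^sub>R f x"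
          by (intro AE_I2 tendsto_scaleR lim tendsto_const)
        show "AE x in M. norm (h n (\<Phi> x) *\<^sub>R f x) \<le> norm (f x)" for n
          using h(2,3)[of n] by (auto intro!: AE_I2 mult_left_le_one_le)
        show "(\<lambda>x. indicat_real C (\<Phi> x) *\<^sub>R f x) \<in> borel_measurable M"
          using C by (intro meas) simp
        show "(\<lambda>x. h n (\<Phi> x) *\<^sub>R f x) \<in> borel_measurable M" for n
          using f by measurable
      qed (use f in simp)
      moreover have "(LINT x|M. h n (\<Phi> x) *\<^sub>R f x) = 0" for n
        using cont[of "h n"] h by simp
      ultimately show ?thesis
        by (simp add: LIMSEQ_const_iff)
    qed simp
  next
    case empty
    then show ?case by simp
  next
    case (compl A)
    have [measurable]: "A \<in> sets borel" using compl by (simp add: borel_eq_closed)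
    have "integrable M (\<lambda>x. indicat_real A (\<Phi> x) *\<^sub>R f x)"
      by (intro integrable_scaleR_bounded[OF f, where B=1]) (auto simp: indicator_def)
    then have "(LINT x|M. indicat_real (UNIV - A) (\<Phi> x) *\<^sub>R f x) =
      (LINT x|M. f x) - (LINT x|M. indicat_real A (\<Phi> x) *\<^sub>R f x)"
      using f by (subst Bochner_Integration.integral_diff[symmetric])
        (simp_all add: indicator_diff scaleR_diff_left)
    \<comment> \<open>The constant function 1 shows that \<open>f\<close> itself integrates to 0,
      which gives closure under complements.\<close>
    then show ?case using compl cont[of "\<lambda>_. 1"] by simp
  next
    case (union A)
    have [measurable]: "A i \<in> sets borel" for i using union by (auto simp: borel_eq_closed)
    have "(\<lambda>n. LINT x|M. indicat_real (\<Union>i<n. A i) (\<Phi> x) *\<^sub>R f x)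
      \<longlonglongrightarrow> (LINT x|M. indicat_real (\<Union>i. A i) (\<Phi> x) *\<^sub>R f x)"
    proof (rule integral_dominated_convergence[where w="\<lambda>x. norm (f x)"])
      show "AE x in M. (\<lambda>n. indicat_real (\<Union>i<n. A i) (\<Phi> x) *\<^sub>R f x)
          \<longlonglongrightarrow> indicat_real (\<Union>i. A i) (\<Phi> x) *\<^sub>R f x"
        by (intro AE_I2 tendsto_scaleR LIMSEQ_indicator_UN tendsto_const)
      show "AE x in M. norm (indicat_real (\<Union>i<n. A i) (\<Phi> x) *\<^sub>R f x) \<le> norm (f x)" for n
        by (auto simp: indicator_def)
    qed (use f in \<open>auto intro!: meas\<close>)
    moreover have "(LINT x|M. indicat_real (\<Union>i<n. A i) (\<Phi> x) *\<^sub>R f x) = 0" for n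
    proof -
      have "(LINT x|M. indicat_real (\<Union>i<n. A i) (\<Phi> x) *\<^sub>R f x)
          = (LINT x|M. (\<Sum>i<n. indicat_real (A i) (\<Phi> x) *\<^sub>R f x))"
        using union(1) by (subst indicator_UN_disjoint)
          (auto simp: scaleR_sum_left disjoint_family_on_def)
      also have "\<dots> = (\<Sum>i<n. LINT x|M. indicat_real (A i) (\<Phi> x) *\<^sub>R f x)"
        by (intro Bochner_Integration.integral_sum integrable_scaleR_bounded[OF f, where B=1])
          (auto simp: indicator_def)
      finally show ?thesis using union by simp
    qed
    ultimately show ?case
      by (simp add: LIMSEQ_const_iff)
  qed
qed

text \<open>Multiplication by a character shifts the frequency, so the integrable functions with
  vanishing transform, collected in \<open>Z\<close>, are closed under multiplication by
  trigonometric polynomials. Hence \<open>f\<close> integrates to 0 against trigonometric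
  expressions, then against continuous functions, then over every Borel set.\<close>

lemma fourier_eq_0_imp_AE_eq_0:
  fixes f :: "'a::euclidean_space \<Rightarrow> complex"
  assumes f: "integrable lborel f" and F: "\<And>k. (LINT x|lborel. cis (- (k \<bullet> x)) * f x) = 0"
  shows "AE x in lborel. f x = 0"
proof -
  define Z where "Z = {g :: 'a \<Rightarrow> complex. integrable lborel g \<and> (\<forall>k. (LINT x|lborel. cis (- (k \<bullet> x)) * g x) = 0)}"
  have Z_add: "(\<lambda>x. g x + h x) \<in> Z" if "g \<in> Z" "h \<in> Z" for g h
    using that by (auto simp: Z_def distrib_left integrable_cis_mult)
  have Z_scale: "(\<lambda>x. c * g x) \<in> Z" if "g \<in> Z" for g c
    using that by (auto simp: Z_def mult.left_commute[of _ c])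
  have Z_sum: "(\<lambda>x. \<Sum>b\<in>B. g b x) \<in> Z" if "finite B" "\<And>b. b \<in> B \<Longrightarrow> g b \<in> Z" for g and B :: "'a set"
    using that
  proof (induction B)
    case empty
    then show ?case by (simp add: Z_def)
  next
    case (insert b B)
    then show ?case using Z_add[of "g b" "\<lambda>x. \<Sum>b\<in>B. g b x"] by simp
  qed
  have Z_cis: "(\<lambda>x. cis (l \<bullet> x) * g x) \<in> Z" if "g \<in> Z" for l g
  proof -
    have "cis (- (k \<bullet> x)) * (cis (l \<bullet> x) * g x) = cis (- ((k - l) \<bullet> x)) * g x" for k x
      by (simp add: mult.assoc[symmetric] cis_mult inner_diff_left)
    then have "(LINT x|lborel. cis (- (k \<bullet> x)) * (cis (l \<bullet> x) * g x)) = 0" for k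
      using that unfolding Z_def by (simp only: mem_Collect_eq)
    then show ?thesis using that by (simp add: Z_def integrable_cis_mult)
  qed
  text \<open>Each \<open>\<Phi> n\<close> is bounded with trigonometric components, so polynomials in it preserve \<open>Z\<close> and
    Stone-Weierstrass applies; moreover \<open>\<Phi> n x\<close> tends to \<open>x\<close>.\<close>
  define \<Phi> :: "nat \<Rightarrow> 'a \<Rightarrow> 'a"
    where "\<Phi> n x = (\<Sum>b\<in>Basis. (real (Suc n) * sin (x \<bullet> b / real (Suc n))) *\<^sub>R b)" for n x
  have \<Phi>m[measurable]: "\<Phi> n \<in> borel_measurable borel" for n
    unfolding \<Phi>_def by (intro borel_measurable_continuous_onI continuous_intros) simp
  have Z_sin: "(\<lambda>x. complex_of_real (c * sin (x \<bullet> b / m)) * g x) \<in> Z" if "g \<in> Z" for c b m g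
  proof -
    define l where "l = b /\<^sub>R m"
    have l: "x \<bullet> b / m = l \<bullet> x" for x
      by (simp add: l_def inner_commute divide_inverse mult.commute)
    have "cis y - cis (- y) = 2 * \<i> * complex_of_real (sin y)" for y
      by (simp add: complex_eq_iff)
    then have "complex_of_real (sin y) = (cis y - cis (- y)) / (2 * \<i>)" for y
      by simp
    then have "complex_of_real (c * sin (x \<bullet> b / m)) * g x
        = (c / (2 * \<i>)) * (cis (l \<bullet> x) * g x) + (- c / (2 * \<i>)) * (cis ((- l) \<bullet> x) * g x)" for x
      by (simp only: l of_real_mult inner_minus_left) (simp add: diff_divide_distrib algebra_simps)
    then show ?thesis
      using Z_add[OF Z_scale[OF Z_cis[OF that]] Z_scale[OF Z_cis[OF that]],
          of "c / (2 * \<i>)" l "- c / (2 * \<i>)" "- l"] by simp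
  qed
  have Z_poly: "(\<lambda>x. complex_of_real (P (\<Phi> n x)) * g x) \<in> Z"
    if "real_polynomial_function P" "g \<in> Z" for P n g
    using that
  \<comment> \<open>The product case first multiplies \<open>g\<close> by the second factor and then
    applies the hypothesis for the first factor to the result, so \<open>g\<close> must
    vary.\<close>
  proof (induction arbitrary: g)
    case (linear p)
    have "p (\<Phi> n x) = (\<Sum>b\<in>Basis. (real (Suc n) * p b) * sin (x \<bullet> b / real (Suc n)))" for x
      using linear(1) by (simp add: \<Phi>_def bounded_linear.linear linear_sum linear_scale ac_simps)
    then have "complex_of_real (p (\<Phi> n x)) * g x
        = (\<Sum>b\<in>Basis. complex_of_real ((real (Suc n) * p b) * sin (x \<bullet> b / real (Suc n))) * g x)" for x
      by (simp only: of_real_sum sum_distrib_right)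
    then show ?case
      using Z_sum[OF finite_Basis Z_sin[OF linear(2)], of "\<lambda>b. real (Suc n) * p b" "\<lambda>b. b" "\<lambda>_. real (Suc n)"]
      by simp
  next
    case (const c)
    then show ?case by (intro Z_scale)
  next
    case (add p q)
    then show ?case using Z_add[OF add.IH(1)[OF add.prems] add.IH(2)[OF add.prems]] by (simp add: distrib_right)
  next
    case (mult p q)
    then show ?case using mult.IH(1)[OF mult.IH(2)[OF mult.prems]] by (simp add: mult.assoc)
  qed
  have fZ: "f \<in> Z" using f F by (simp add: Z_def)
  have poly: "(LINT x|lborel. P (\<Phi> n x) *\<^sub>R f x) = 0" if "real_polynomial_function P" for P n
  proof -
    have "\<forall>k. (LINT x|lborel. cis (- (k \<bullet> x)) * (complex_of_real (P (\<Phi> n x)) * f x)) = 0"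
      using Z_poly[OF that fZ, of n] by (simp add: Z_def)
    \<comment> \<open>The induction needs all frequencies; the plain integral is frequency
      0.\<close>
    from spec[OF this, of 0] show ?thesis by (simp add: scaleR_conv_of_real)
  qed
  have h0: "(LINT x|lborel. h x *\<^sub>R f x) = 0"
    if h: "continuous_on UNIV h" and h01: "\<And>y. 0 \<le> h y \<and> h y \<le> 1" for h :: "'a \<Rightarrow> real"
  proof -
    have [measurable]: "h \<in> borel_measurable borel" using h by (rule borel_measurable_continuous_onI)
    have "(LINT x|lborel. h (\<Phi> n x) *\<^sub>R f x) = 0" for n
    proof (rule integral_continuous_comp_eq_0[OF f _ compact_cbox _ poly h])
      have "real (Suc n) * (- 1) \<le> real (Suc n) * sin y" "real (Suc n) * sin y \<le> real (Suc n) * 1" for y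
        by (rule mult_left_mono, simp, simp)+
      then show "\<Phi> n x \<in> cbox (- (\<Sum>b\<in>Basis. real (Suc n) *\<^sub>R b)) (\<Sum>b\<in>Basis. real (Suc n) *\<^sub>R b)" for x
        by (simp add: mem_box \<Phi>_def)
    qed simp
    moreover have "(\<lambda>n. LINT x|lborel. h (\<Phi> n x) *\<^sub>R f x) \<longlonglongrightarrow> (LINT x|lborel. h x *\<^sub>R f x)"
    proof (rule integral_dominated_convergence[where w="\<lambda>x. norm (f x)"])
      have "(\<lambda>n. \<Phi> n x) \<longlonglongrightarrow> x" for x
      proof -
        have "(\<lambda>n. real (Suc n) * sin (y / real (Suc n))) \<longlonglongrightarrow> y" for y by real_asymp
        then have "(\<lambda>n. \<Phi> n x) \<longlonglongrightarrow> (\<Sum>b\<in>Basis. (x \<bullet> b) *\<^sub>R b)"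
          unfolding \<Phi>_def by (intro tendsto_intros)
        then show ?thesis by (simp add: euclidean_representation)
      qed
      then have "(\<lambda>n. h (\<Phi> n x)) \<longlonglongrightarrow> h x" for x
        using h by (intro isCont_tendsto_compose[of _ h]) (auto simp: continuous_on_eq_continuous_at)
      then show "AE x in lborel. (\<lambda>n. h (\<Phi> n x) *\<^sub>R f x) \<longlonglongrightarrow> h x *\<^sub>R f x"
        by (intro AE_I2 tendsto_intros)
      show "AE x in lborel. norm (h (\<Phi> n x) *\<^sub>R f x) \<le> norm (f x)" for n
        using h01 by (auto intro!: mult_left_le_one_le)
    qed (use f in auto)
    ultimately show ?thesis by (simp add: LIMSEQ_const_iff)
  qed
  show ?thesis
  proof (rule sigma_finite_measure.density_zero[OF lborel.sigma_finite_measure_axioms f])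
    fix A :: "'a set" assume "A \<in> sets lborel"
    then show "set_lebesgue_integral lborel A f = 0"
      using integral_indicator_comp_eq_0[OF f, of "\<lambda>x. x" A] h0
      by (simp add: set_lebesgue_integral_def)
  qed
qed

text \<open>Lerch's theorem. Only the transforms at the points \<open>s + real n\<close> enter, as
  moments of the damped function \<open>G\<close> in the variable \<open>exp (- t)\<close>.
  Continuity upgrades the almost everywhere conclusion to every positive time.\<close>

lemma laplace_eq_0_imp_eq_0:
  fixes g :: "real \<Rightarrow> 'b::{banach, second_countable_topology}"
  assumes g: "continuous_on {0<..} g"
    and L: "\<forall>\<^sub>F s in at_top. laplace_integrable g s \<and> laplace g s = 0" and t: "0 < t"
  shows "g t = 0"
proof -
  obtain s where s: "\<And>r. s \<le> r \<Longrightarrow> laplace_integrable g r \<and> laplace g r = 0"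
    using L by (auto simp: eventually_at_top_linorder)
  define G where "G t = indicat_real {0<..} t *\<^sub>R (exp (- (s * t)) *\<^sub>R g t)" for t
  have G: "integrable lborel G"
    using s[of s] unfolding G_def laplace_integrable_def set_integrable_def by simp
  text \<open>After the substitution \<open>x = exp (- t)\<close> the hypothesis says that all moments vanish.\<close>
  define \<Phi> :: "real \<Rightarrow> real" where "\<Phi> t = exp (- max t 0)" for t
  have [measurable]: "\<Phi> \<in> borel_measurable borel"
    unfolding \<Phi>_def by measurable
  have powr0: "(LINT t|lborel. \<Phi> t ^ n *\<^sub>R G t) = 0"
    and powr_int: "integrable lborel (\<lambda>t. \<Phi> t ^ n *\<^sub>R G t)" for n
  proof -
    have *: "\<Phi> t ^ n *\<^sub>R G t = indicat_real {0<..} t *\<^sub>R (exp (- ((s + real n) * t)) *\<^sub>R g t)" for t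
      by (auto simp: \<Phi>_def G_def indicator_def exp_of_nat_mult[symmetric] exp_add[symmetric] algebra_simps)
    show "(LINT t|lborel. \<Phi> t ^ n *\<^sub>R G t) = 0" "integrable lborel (\<lambda>t. \<Phi> t ^ n *\<^sub>R G t)"
      using s[of "s + real n"] unfolding *
      by (auto simp: laplace_integrable_def set_integrable_def laplace_def set_lebesgue_integral_def)
  qed
  have poly: "(LINT t|lborel. P (\<Phi> t) *\<^sub>R G t) = 0" if P: "real_polynomial_function P" for P
  proof -
    obtain a n where "P = (\<lambda>x. \<Sum>i\<le>n. a i * x ^ i)"
      using P unfolding real_polynomial_function_iff_sum by blast
    then have "(LINT t|lborel. P (\<Phi> t) *\<^sub>R G t) = (LINT t|lborel. (\<Sum>i\<le>n. a i *\<^sub>R (\<Phi> t ^ i *\<^sub>R G t)))"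
      by (simp add: scaleR_sum_left)
    also have "\<dots> = (\<Sum>i\<le>n. LINT t|lborel. a i *\<^sub>R (\<Phi> t ^ i *\<^sub>R G t))"
      by (intro Bochner_Integration.integral_sum integrable_scaleR_right powr_int)
    finally show ?thesis using powr0 by (simp del: scaleR_scaleR)
  qed
  have "(LINT t|lborel. h (\<Phi> t) *\<^sub>R G t) = 0" if "continuous_on UNIV h" for h :: "real \<Rightarrow> real"
    by (rule integral_continuous_comp_eq_0[OF G _ compact_Icc[of 0 1] _ poly that])
      (auto simp: \<Phi>_def)
  then have ind: "(LINT t|lborel. indicat_real A (\<Phi> t) *\<^sub>R G t) = 0" if "A \<in> sets borel" for A
    using integral_indicator_comp_eq_0[OF G _ _ that, of \<Phi>] by simp
  have "AE t in lborel. G t = 0"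
  proof (rule sigma_finite_measure.density_zero[OF lborel.sigma_finite_measure_axioms G])
    fix B :: "real set" assume "B \<in> sets lborel"
    then have [measurable]: "B \<in> sets borel" by simp
    \<comment> \<open>On positive times \<open>- ln\<close> inverts \<open>\<Phi>\<close>, so
      \<open>\<Phi> t \<in> A\<close> says \<open>t \<in> B\<close>; at other times \<open>G\<close>
      is 0.\<close>
    define A where "A = (\<lambda>x. - ln x) -` B \<inter> space borel"
    have A: "A \<in> sets borel" unfolding A_def by measurable
    have "set_lebesgue_integral lborel B G = (LINT t|lborel. indicat_real A (\<Phi> t) *\<^sub>R G t)"
      unfolding set_lebesgue_integral_def
      by (intro Bochner_Integration.integral_cong) (auto simp: A_def \<Phi>_def G_def indicator_def)
    then show "set_lebesgue_integral lborel B G = 0" using ind[OF A] by simp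
  qed
  then have AE: "AE t in lborel. t \<in> {0<..} \<longrightarrow> g t = 0"
    by eventually_elim (auto simp: G_def)
  show ?thesis
  proof (rule ccontr)
    assume "g t \<noteq> 0"
    \<comment> \<open>A nonzero value would make the set of nonzeros open, nonempty and negligible
      at once.\<close>
    have "open (g -` (- {0}) \<inter> {0<..})"
      using g by (intro continuous_on_open_vimage[THEN iffD1, rule_format]) auto
    moreover have "t \<in> g -` (- {0}) \<inter> {0<..}" using t \<open>g t \<noteq> 0\<close> by simp
    moreover have "negligible (g -` (- {0}) \<inter> {0<..})"
    proof -
      have "g -` (- {0}) \<inter> {0<..} \<in> null_sets lborel"
        by (rule AE_iff_null_sets[THEN iffD2])
          (use AE calculation(1) in \<open>auto elim: eventually_mono\<close>)
      then show ?thesis by (simp add: negligible_iff_null_sets null_sets_completionI)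
    qed
    ultimately show False
      using open_not_negligible by blast
  qed
qed

section \<open>The heat kernel on the half-line\<close>

text \<open>The oriented integral covers negative arguments and makes the function odd. They occur
  in \<open>laplace_heat\<close>, where one argument tends to minus infinity.\<close>

definition erf :: "real \<Rightarrow> real" where
  "erf y = 2 / sqrt pi * (LBINT x=0..y. exp (- x\<^sup>2))"

lemma has_real_derivative_erf:
  "(erf has_real_derivative 2 / sqrt pi * exp (- y\<^sup>2)) (at y)"
proof -
  \<comment> \<open>The interval must contain the base point 0 and have \<open>y\<close> in its
    interior, so that the derivative within the interval is a derivative at
    \<open>y\<close>.\<close>
  define a where "a = - \<bar>y\<bar> - 1"
  define b where "b = \<bar>y\<bar> + 1"
  have ab: "a \<le> 0" "0 \<le> b" "a < y" "y < b" by (auto simp: a_def b_def)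
  have "((\<lambda>u. LBINT x=0..u. exp (- x\<^sup>2)) has_vector_derivative exp (- y\<^sup>2)) (at y within {a..b})"
    using interval_integral_FTC2[of a 0 b "\<lambda>x. exp (- x\<^sup>2)" y] ab
    by (simp add: zero_ereal_def continuous_intros)
  then have "((\<lambda>u. LBINT x=0..u. exp (- x\<^sup>2)) has_vector_derivative exp (- y\<^sup>2)) (at y)"
    using ab by (subst (asm) at_within_interior) auto
  then show ?thesis
    unfolding erf_def[abs_def] has_real_derivative_iff_has_vector_derivative[symmetric]
    by (rule DERIV_cmult)
qed

lemma erf_minus: "erf (- y) = - erf y"
proof -
  have "(LBINT x=0..-y. exp (- x\<^sup>2)) = (LBINT x=y..0. exp (- x\<^sup>2))"
    by (subst interval_integral_reflect) simp
  also have "\<dots> = - (LBINT x=0..y. exp (- x\<^sup>2))"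
    by (rule interval_integral_endpoints_reverse)
  finally show ?thesis by (simp add: erf_def)
qed

lemma erf_at_top: "(erf \<longlongrightarrow> 1) at_top"
proof -
  have g: "integrable lborel (\<lambda>x::real. indicat_real {0..} x *\<^sub>R exp (- x\<^sup>2))"
      "(LINT x::real|lborel. indicat_real {0..} x *\<^sub>R exp (- x\<^sup>2)) = sqrt pi / 2"
    using integrable.intros[OF gaussian_moment_0] has_bochner_integral_integral_eq[OF gaussian_moment_0]
    by simp_all
  have "((\<lambda>y::real. LINT x|lborel. indicat_real {..y} x *\<^sub>R (indicat_real {0..} x *\<^sub>R exp (- x\<^sup>2)))
      \<longlongrightarrow> sqrt pi / 2) at_top"
    using tendsto_integral_at_top[OF sets_lborel g(1)] unfolding g(2) .
  then have "((\<lambda>y. 2 / sqrt pi * (LINT x|lborel. indicat_real {..y::real} x *\<^sub>R (indicat_real {0..} x *\<^sub>R exp (- x\<^sup>2))))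
      \<longlongrightarrow> 2 / sqrt pi * (sqrt pi / 2)) at_top"
    by (intro tendsto_intros)
  moreover have "\<forall>\<^sub>F y in at_top. 2 / sqrt pi *
      (LINT x|lborel. indicat_real {..y::real} x *\<^sub>R (indicat_real {0..} x *\<^sub>R exp (- x\<^sup>2))) = erf y"
    using eventually_ge_at_top[of 0]
  proof eventually_elim
    case (elim y)
    have "indicat_real {..y} x *\<^sub>R (indicat_real {0..} x *\<^sub>R exp (- x\<^sup>2))
        = indicat_real {0..y} x *\<^sub>R exp (- x\<^sup>2)" for x :: real
      by (auto simp: indicator_def)
    then have "(LINT x|lborel. indicat_real {..y} x *\<^sub>R (indicat_real {0..} x *\<^sub>R exp (- x\<^sup>2)))
        = (LINT x|lborel. indicat_real {0..y} x *\<^sub>R exp (- x\<^sup>2))" by (simp only:)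
    with elim show ?case
      by (simp add: erf_def zero_ereal_def interval_integral_Icc set_lebesgue_integral_def)
  qed
  ultimately have "(erf \<longlongrightarrow> 2 / sqrt pi * (sqrt pi / 2)) at_top"
    by (rule Lim_transform_eventually)
  then show ?thesis by simp
qed

lemma erf_at_bot: "(erf \<longlongrightarrow> - 1) at_bot"
  using tendsto_minus[OF erf_at_top]
  by (simp add: filterlim_at_bot_mirror erf_minus)

text \<open>This is twice the Gauss kernel, so it has mass one on the half-line.\<close>

definition heat :: "real \<Rightarrow> real \<Rightarrow> real" where
  "heat t s = exp (- (s\<^sup>2 / (4 * t))) / sqrt (pi * t)"

definition heat_ds :: "real \<Rightarrow> real \<Rightarrow> real" where
  "heat_ds t s = - (s / (2 * t)) * heat t s"

text \<open>One function for two derivatives: that of \<open>heat\<close> in \<open>t\<close> and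
  that of \<open>heat_ds\<close> in \<open>s\<close>. Their coincidence is the heat
  equation.\<close>

definition heat_dt :: "real \<Rightarrow> real \<Rightarrow> real" where
  "heat_dt t s = (s\<^sup>2 / (4 * t\<^sup>2) - 1 / (2 * t)) * heat t s"

lemma heat_nonneg [simp]: "0 \<le> t \<Longrightarrow> 0 \<le> heat t s"
  by (simp add: heat_def)

lemma has_derivative_heat_s:
  assumes "0 < t"
  shows "(heat t has_real_derivative heat_ds t s) (at s)"
proof -
  have "((\<lambda>s. - (s\<^sup>2 / (4 * t))) has_real_derivative - (s / (2 * t))) (at s)"
    using assms by (auto intro!: derivative_eq_intros)
  from DERIV_cdivide[OF DERIV_chain2[OF DERIV_exp this], of "sqrt (pi * t)"]
  show ?thesis by (simp add: heat_def[abs_def] heat_ds_def mult.commute)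
qed

lemma has_derivative_heat_ds:
  assumes "0 < t"
  shows "(heat_ds t has_real_derivative heat_dt t s) (at s)"
proof -
  have "((\<lambda>s. - (s / (2 * t))) has_real_derivative - (1 / (2 * t))) (at s)"
    using assms by (auto intro!: derivative_eq_intros)
  then have "((\<lambda>s. - (s / (2 * t)) * heat t s) has_real_derivative
      - (1 / (2 * t)) * heat t s + heat_ds t s * - (s / (2 * t))) (at s)"
    using has_derivative_heat_s[OF assms] by (rule DERIV_mult)
  moreover have "- (1 / (2 * t)) * heat t s + heat_ds t s * - (s / (2 * t)) = heat_dt t s"
    by (simp add: heat_ds_def heat_dt_def power2_eq_square algebra_simps)
  moreover have "heat_ds t = (\<lambda>s. - (s / (2 * t)) * heat t s)"
    by (rule ext) (rule heat_ds_def)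
  ultimately show ?thesis by metis
qed

lemma has_derivative_heat_t:
  assumes "0 < t"
  shows "((\<lambda>t. heat t s) has_real_derivative heat_dt t s) (at t)"
proof -
  have "((\<lambda>t. exp (- (s\<^sup>2 / (4 * t))) / sqrt (pi * t)) has_real_derivative
     ((s\<^sup>2 / (4 * t\<^sup>2)) * exp (- (s\<^sup>2 / (4 * t))) * sqrt (pi * t)
       - exp (- (s\<^sup>2 / (4 * t))) * (pi / (2 * sqrt (pi * t)))) / (sqrt (pi * t) * sqrt (pi * t))) (at t)"
    using assms
    by (auto intro!: derivative_eq_intros simp: divide_simps power2_eq_square mult_less_0_iff)
  moreover have "((s\<^sup>2 / (4 * t\<^sup>2)) * exp (- (s\<^sup>2 / (4 * t))) * sqrt (pi * t)
       - exp (- (s\<^sup>2 / (4 * t))) * (pi / (2 * sqrt (pi * t)))) / (sqrt (pi * t) * sqrt (pi * t)) = heat_dt t s"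
  proof -
    define w where "w = sqrt (pi * t)"
    have w: "0 < w" "pi * t = w * w" using assms by (auto simp: w_def)
    define e where "e = exp (- (s\<^sup>2 / (4 * t)))"
    have "((s\<^sup>2 / (4 * t\<^sup>2)) * e * w - e * (pi / (2 * w))) / (w * w) = (s\<^sup>2 / (4 * t\<^sup>2) - pi / (2 * (w * w))) * (e / w)"
      using w(1) by (simp add: field_simps)
    also have "pi / (2 * (w * w)) = 1 / (2 * t)"
      using assms by (simp add: w(2)[symmetric])
    finally show ?thesis
      by (simp add: heat_dt_def heat_def e_def w_def)
  qed
  ultimately show ?thesis by (simp add: heat_def)
qed

text \<open>One constant for all times in [t1, t2] yields a majorant independent of
  \<open>t\<close>, as differentiation under the integral requires. Gaussian decay beats any
  exponential, so it absorbs the polynomial prefactors of the derivatives as well.\<close>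

lemma heat_bounds:
  assumes "0 < t1" "t1 \<le> t2"
  obtains C where
    "\<And>t s. t1 \<le> t \<Longrightarrow> t \<le> t2 \<Longrightarrow> 0 \<le> s \<Longrightarrow> \<bar>heat t s\<bar> \<le> C * exp (- s)"
    "\<And>t s. t1 \<le> t \<Longrightarrow> t \<le> t2 \<Longrightarrow> 0 \<le> s \<Longrightarrow> \<bar>heat_ds t s\<bar> \<le> C * exp (- s)"
    "\<And>t s. t1 \<le> t \<Longrightarrow> t \<le> t2 \<Longrightarrow> 0 \<le> s \<Longrightarrow> \<bar>heat_dt t s\<bar> \<le> C * exp (- s)"
proof -
  \<comment> \<open>\<open>K\<close> is chosen so that \<open>K * (1 + s + s\<^sup>2)\<close>
    dominates the prefactors of all three functions; \<open>H\<close> collects the constants of the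
    estimate \<open>main\<close>.\<close>
  define K where "K = 1 + 1 / (2 * t1) + 1 / (4 * t1\<^sup>2)"
  define H where "H = 2 * exp (9 * t2) / sqrt (pi * t1)"
  have K: "1 \<le> K" "1 / (2 * t1) \<le> K" "1 / (4 * t1\<^sup>2) + 1 / (2 * t1) \<le> K" 
  proof -
    have "0 \<le> 1 / (2 * t1)" "0 \<le> 1 / (4 * t1\<^sup>2)" using assms by simp_all
    then show "1 \<le> K" "1 / (2 * t1) \<le> K" "1 / (4 * t1\<^sup>2) + 1 / (2 * t1) \<le> K"
      unfolding K_def by linarith+
  qed
  have main: "(1 + s + s\<^sup>2) * heat t s \<le> H * exp (- s)" if t: "t1 \<le> t" "t \<le> t2" and s: "0 \<le> s" for t s
  proof -
    have t0: "0 < t" using assms t by simp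
    \<comment> \<open>This square gives \<open>s\<^sup>2 / (4 * t) \<ge> 3 * s - 9 * t\<close>. Of
      the three units of decay one is kept as \<open>exp (- s)\<close>; the other two absorb the
      polynomial through \<open>1 + s + s\<^sup>2 \<le> 2 * exp (2 * s)\<close>.\<close>
    have "0 \<le> (s / (2 * sqrt t) - 3 * sqrt t)\<^sup>2" by simp
    also have "\<dots> = s\<^sup>2 / (4 * t) - 3 * s + 9 * t"
      using t0 by (simp add: power2_diff power_divide power_mult_distrib)
    finally have "- (s\<^sup>2 / (4 * t)) \<le> 9 * t2 + (- s) + - (2 * s)" using t by simp
    then have "exp (- (s\<^sup>2 / (4 * t))) \<le> exp (9 * t2 + (- s) + - (2 * s))" by simp
    also have "\<dots> = exp (9 * t2) * exp (- s) * exp (- (2 * s))" by (simp only: exp_add)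
    finally have e: "exp (- (s\<^sup>2 / (4 * t))) \<le> exp (9 * t2) * exp (- s) * exp (- (2 * s))" .
    have "1 + s + s\<^sup>2 / 2 \<le> exp s" using s by (rule exp_lower_Taylor_quadratic)
    then have "1 + s + s\<^sup>2 \<le> 2 * exp s" using s by simp
    also have "\<dots> \<le> 2 * exp (2 * s)" using s by simp
    finally have p: "1 + s + s\<^sup>2 \<le> 2 * exp (2 * s)" .
    have "(1 + s + s\<^sup>2) * exp (- (s\<^sup>2 / (4 * t))) \<le> 2 * exp (2 * s) * (exp (9 * t2) * exp (- s) * exp (- (2 * s)))"
      using p e s by (intro mult_mono) auto
    also have "\<dots> = 2 * exp (9 * t2) * exp (- s) * (exp (2 * s) * exp (- (2 * s)))" by simp
    also have "exp (2 * s) * exp (- (2 * s)) = 1" by (simp flip: exp_add)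
    finally have "(1 + s + s\<^sup>2) * exp (- (s\<^sup>2 / (4 * t))) \<le> 2 * exp (9 * t2) * exp (- s)" by simp
    then have "(1 + s + s\<^sup>2) * exp (- (s\<^sup>2 / (4 * t))) / sqrt (pi * t)
        \<le> (2 * exp (9 * t2) * exp (- s)) / sqrt (pi * t1)"
      using assms t s by (intro frac_le) auto
    then show ?thesis by (simp add: heat_def H_def)
  qed
  have H: "0 \<le> H" using assms by (simp add: H_def)
  show thesis
  proof (rule that[of "K * H"])
    fix t s assume t: "t1 \<le> t" "t \<le> t2" and s: "0 \<le> (s::real)"
    have t0: "0 < t" using assms t by simp
    have h: "0 \<le> heat t s" using t0 by simp
    have *: "c * heat t s \<le> K * H * exp (- s)" if c: "c \<le> K * (1 + s + s\<^sup>2)" for c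
    proof -
      have "c * heat t s \<le> K * (1 + s + s\<^sup>2) * heat t s" using c h by (rule mult_right_mono)
      also have "\<dots> = K * ((1 + s + s\<^sup>2) * heat t s)" by simp
      also have "\<dots> \<le> K * (H * exp (- s))" using main[OF t s] K by (intro mult_left_mono) auto
      finally show ?thesis by simp
    qed
    have i1: "1 / (2 * t) \<le> 1 / (2 * t1)" and i2: "1 / (4 * t\<^sup>2) \<le> 1 / (4 * t1\<^sup>2)"
      using assms t by (auto intro!: frac_le power_mono)
    have s2: "0 \<le> K * s" "0 \<le> K * s\<^sup>2" using K s by auto
    have "1 \<le> K * (1 + s + s\<^sup>2)" using K s2 unfolding distrib_left by linarith
    from *[OF this] show "\<bar>heat t s\<bar> \<le> K * H * exp (- s)" using h by simp
    have "s / (2 * t) = 1 / (2 * t) * s" by simp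
    also have "\<dots> \<le> K * s" using i1 K s by (intro mult_right_mono) auto
    also have "\<dots> \<le> K * (1 + s + s\<^sup>2)" using K s2 unfolding distrib_left by linarith
    finally have "s / (2 * t) \<le> K * (1 + s + s\<^sup>2)" .
    from *[OF this] show "\<bar>heat_ds t s\<bar> \<le> K * H * exp (- s)"
      using h s t0 by (simp add: heat_ds_def abs_mult)
    have "\<bar>s\<^sup>2 / (4 * t\<^sup>2) - 1 / (2 * t)\<bar> \<le> s\<^sup>2 / (4 * t\<^sup>2) + 1 / (2 * t)"
      using t0 s by (intro abs_leI) auto
    also have "\<dots> = 1 / (4 * t\<^sup>2) * s\<^sup>2 + 1 / (2 * t)" by simp
    also have "\<dots> \<le> K * s\<^sup>2 + K"
    proof (intro add_mono mult_right_mono)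
      show "1 / (4 * t\<^sup>2) \<le> K" using i2 assms by (simp add: K_def add_increasing)
    qed (use i1 K in auto)
    also have "\<dots> \<le> K * (1 + s + s\<^sup>2)" using K s2 unfolding distrib_left by linarith
    finally have "\<bar>s\<^sup>2 / (4 * t\<^sup>2) - 1 / (2 * t)\<bar> \<le> K * (1 + s + s\<^sup>2)" .
    from *[OF this] show "\<bar>heat_dt t s\<bar> \<le> K * H * exp (- s)"
      using h by (simp add: heat_dt_def abs_mult)
  qed
qed

lemma set_integrable_exp_bound:
  fixes q :: "real \<Rightarrow> real"
  assumes "q \<in> borel_measurable borel" "\<And>s. 0 < s \<Longrightarrow> \<bar>q s\<bar> \<le> C * exp (- s)"
  shows "set_integrable lborel {0<..} q"
  unfolding set_integrable_def
proof (rule Bochner_Integration.integrable_bound)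
  show "integrable lborel (\<lambda>s. C * (indicat_real {0<..} s *\<^sub>R exp (- (s * 1))))"
    using integrable_I0i_exp_mscale[of 1] by (intro integrable_mult_right) (simp add: set_integrable_def)
  show "AE s in lborel. norm (indicat_real {0<..} s *\<^sub>R q s) \<le> norm (C * (indicat_real {0<..} s *\<^sub>R exp (- (s * 1))))"
    using assms(2) by (auto intro!: AE_I2 order_trans[OF assms(2) abs_ge_self] simp: indicator_def)
qed (use assms(1) in simp)

lemma heat_bounds_at:
  assumes "0 < t"
  obtains C where
    "\<And>s. 0 \<le> s \<Longrightarrow> \<bar>heat t s\<bar> \<le> C * exp (- s)"
    "\<And>s. 0 \<le> s \<Longrightarrow> \<bar>heat_ds t s\<bar> \<le> C * exp (- s)"
    "\<And>s. 0 \<le> s \<Longrightarrow> \<bar>heat_dt t s\<bar> \<le> C * exp (- s)"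
proof -
  obtain C where "\<And>\<tau> s. t \<le> \<tau> \<Longrightarrow> \<tau> \<le> t \<Longrightarrow> 0 \<le> s \<Longrightarrow> \<bar>heat \<tau> s\<bar> \<le> C * exp (- s)"
      "\<And>\<tau> s. t \<le> \<tau> \<Longrightarrow> \<tau> \<le> t \<Longrightarrow> 0 \<le> s \<Longrightarrow> \<bar>heat_ds \<tau> s\<bar> \<le> C * exp (- s)"
      "\<And>\<tau> s. t \<le> \<tau> \<Longrightarrow> \<tau> \<le> t \<Longrightarrow> 0 \<le> s \<Longrightarrow> \<bar>heat_dt \<tau> s\<bar> \<le> C * exp (- s)"
    by (rule heat_bounds[OF assms order_refl]) (rule that)
  from this[OF order_refl order_refl] show ?thesis by (rule that)
qed

lemma heat_measurable: "heat t \<in> borel_measurable borel" "heat_ds t \<in> borel_measurable borel"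
    "heat_dt t \<in> borel_measurable borel"
  unfolding heat_def[abs_def] heat_ds_def[abs_def] heat_dt_def[abs_def] by measurable

lemma heat_integrable:
  assumes "0 < t"
  shows "set_integrable lborel {0<..} (heat t)" "set_integrable lborel {0<..} (heat_ds t)"
    "set_integrable lborel {0<..} (heat_dt t)"
proof -
  obtain C where C:
      "\<And>s. 0 \<le> s \<Longrightarrow> \<bar>heat t s\<bar> \<le> C * exp (- s)"
      "\<And>s. 0 \<le> s \<Longrightarrow> \<bar>heat_ds t s\<bar> \<le> C * exp (- s)"
      "\<And>s. 0 \<le> s \<Longrightarrow> \<bar>heat_dt t s\<bar> \<le> C * exp (- s)"
    by (rule heat_bounds_at[OF assms]) (rule that)
  show "set_integrable lborel {0<..} (heat t)" "set_integrable lborel {0<..} (heat_ds t)"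
    "set_integrable lborel {0<..} (heat_dt t)"
    using C heat_measurable by (auto intro!: set_integrable_exp_bound[where C=C])
qed

lemma has_bochner_integral_heat:
  assumes t: "0 < t"
  shows "has_bochner_integral lborel (\<lambda>s. indicat_real {0..} s *\<^sub>R heat t s) 1"
proof -
  have "has_bochner_integral lborel
      (\<lambda>s. indicat_real {0..} (0 + 1 / (2 * sqrt t) * s) *\<^sub>R exp (- (0 + 1 / (2 * sqrt t) * s)\<^sup>2))
      (sqrt pi / 2 /\<^sub>R \<bar>1 / (2 * sqrt t)\<bar>)"
    using t by (intro lborel_has_bochner_integral_real_affine_iff[THEN iffD1] gaussian_moment_0) simp
  then have "has_bochner_integral lborel (\<lambda>s. (1 / sqrt (pi * t)) *
      (indicat_real {0..} (0 + 1 / (2 * sqrt t) * s) *\<^sub>R exp (- (0 + 1 / (2 * sqrt t) * s)\<^sup>2)))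
      ((1 / sqrt (pi * t)) * (sqrt pi / 2 /\<^sub>R \<bar>1 / (2 * sqrt t)\<bar>))"
    by (intro has_bochner_integral_mult_right)
  moreover have "(1 / sqrt (pi * t)) *
      (indicat_real {0..} (0 + 1 / (2 * sqrt t) * s) *\<^sub>R exp (- (0 + 1 / (2 * sqrt t) * s)\<^sup>2))
      = indicat_real {0..} s *\<^sub>R heat t s" for s
    using t by (simp add: heat_def indicator_def power_mult_distrib power_divide zero_le_divide_iff)
  moreover have "(1 / sqrt (pi * t)) * (sqrt pi / 2 /\<^sub>R \<bar>1 / (2 * sqrt t)\<bar>) = 1"
    using t by (simp add: real_sqrt_mult)
  ultimately show ?thesis by simp
qed

text \<open>Here \<open>s\<close> is the Laplace variable and \<open>r\<close> the point of the
  half-line. Up to the factor \<open>1 / sqrt s\<close> the result is the kernel whose orbit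
  integral is the resolvent at \<open>sqrt s\<close>.\<close>

lemma laplace_heat:
  assumes s: "0 < s" and r: "0 < r"
  shows "set_integrable lborel {0<..} (\<lambda>t. exp (- (s * t)) * heat t r)"
    and "(LINT t:{0<..}|lborel. exp (- (s * t)) * heat t r) = exp (- (r * sqrt s)) / sqrt s"
proof -
  text \<open>The antiderivative comes from completing the square:
    \<open>s * t + r\<^sup>2 / (4 * t) = (p t)\<^sup>2 - r * sqrt s = (m t)\<^sup>2 + r * sqrt s\<close>.\<close>
  define p where "p t = sqrt (s * t) + r / (2 * sqrt t)" for t
  define m where "m t = sqrt (s * t) - r / (2 * sqrt t)" for t
  define G where "G t = (exp (r * sqrt s) * erf (p t) + exp (- (r * sqrt s)) * erf (m t)) / (2 * sqrt s)" for t
  have deriv: "(G has_real_derivative exp (- (s * t)) * heat t r) (at t)" if t: "0 < t" for t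
  proof -
    define x where "x = sqrt t"
    have x: "0 < x" "t = x * x" using t by (auto simp: x_def)
    define a where "a = sqrt s"
    have a: "0 < a" "s = a * a" using s by (auto simp: a_def)
    \<comment> \<open>The derivatives of \<open>p\<close> and \<open>m\<close>. By \<open>E\<close>
      below both Gaussian factors reduce to the same expression, so only \<open>dp + dm\<close>
      matters, and there the terms with \<open>r\<close> cancel.\<close>
    define dp where "dp = a / (2 * x) - r / (4 * (x * x * x))"
    define dm where "dm = a / (2 * x) + r / (4 * (x * x * x))"
    have pt: "p t = a * x + r / (2 * x)" "m t = a * x - r / (2 * x)"
      by (auto simp: p_def m_def a_def x_def real_sqrt_mult)
    have sq: "(sqrt has_real_derivative 1 / (2 * x)) (at t)"
      using t by (auto intro!: derivative_eq_intros simp: x_def divide_simps)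
    have q': "((\<lambda>t. r / (2 * sqrt t)) has_real_derivative - (r / (4 * (x * x * x)))) (at t)"
      using x by (intro DERIV_cong[OF DERIV_divide[OF DERIV_const[of r] DERIV_cmult[OF sq, of 2]]])
        (auto simp: divide_simps)
    have p': "(p has_real_derivative dp) (at t)"
      unfolding p_def[abs_def] real_sqrt_mult a_def[symmetric]
      by (rule DERIV_cong[OF DERIV_add[OF DERIV_cmult[OF sq] q']]) (simp add: dp_def)
    have m': "(m has_real_derivative dm) (at t)"
      unfolding m_def[abs_def] real_sqrt_mult a_def[symmetric]
      by (rule DERIV_cong[OF DERIV_diff[OF DERIV_cmult[OF sq] q']]) (simp add: dm_def)
    have E: "exp (- (s * t)) * exp (- (r\<^sup>2 / (4 * t))) = exp (r * a) * exp (- (p t)\<^sup>2)"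
            "exp (- (s * t)) * exp (- (r\<^sup>2 / (4 * t))) = exp (- (r * a)) * exp (- (m t)\<^sup>2)"
      unfolding exp_add[symmetric] pt using x a
      by (auto simp: power2_eq_square divide_simps algebra_simps)
    have "(G has_real_derivative (exp (r * a) * (2 / sqrt pi * exp (- (p t)\<^sup>2) * dp)
         + exp (- (r * a)) * (2 / sqrt pi * exp (- (m t)\<^sup>2) * dm)) / (2 * a)) (at t)"
      unfolding G_def[abs_def] a_def[symmetric]
      by (intro DERIV_cdivide DERIV_add DERIV_cmult DERIV_chain2[OF has_real_derivative_erf] p' m')
    also have "(exp (r * a) * (2 / sqrt pi * exp (- (p t)\<^sup>2) * dp)
         + exp (- (r * a)) * (2 / sqrt pi * exp (- (m t)\<^sup>2) * dm)) / (2 * a)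
       = (exp (r * a) * exp (- (p t)\<^sup>2) * dp + exp (- (r * a)) * exp (- (m t)\<^sup>2) * dm) / (sqrt pi * a)"
      by (simp add: divide_simps)
    also have "\<dots> = exp (- (s * t)) * exp (- (r\<^sup>2 / (4 * t))) * (dp + dm) / (sqrt pi * a)"
      unfolding E(1)[symmetric] E(2)[symmetric] by (simp add: distrib_left)
    also have "(dp + dm) = a / x" by (simp add: dp_def dm_def field_simps)
    also have "exp (- (s * t)) * exp (- (r\<^sup>2 / (4 * t))) * (a / x) / (sqrt pi * a) = exp (- (s * t)) * heat t r"
    proof -
      have "sqrt (pi * t) = sqrt pi * x" by (simp add: real_sqrt_mult x_def)
      then show ?thesis using a(1) x(1) by (simp add: heat_def)
    qed
    finally show ?thesis .
  qed
  have cont: "isCont (\<lambda>t. exp (- (s * t)) * heat t r) t" if "0 < t" for t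
    using DERIV_isCont[OF has_derivative_heat_t[OF that]] by (intro continuous_intros)
  \<comment> \<open>As \<open>r\<close> is positive, \<open>p\<close> tends to plus and
    \<open>m\<close> to minus infinity at 0, whereas both tend to plus infinity at infinity. In the
    difference of the boundary values the \<open>exp (r * sqrt s)\<close> terms cancel and the
    others add up.\<close>
  have G0: "(G \<longlongrightarrow> (exp (r * sqrt s) * 1 + exp (- (r * sqrt s)) * (- 1)) / (2 * sqrt s)) (at_right 0)"
  proof -
    have "filterlim p at_top (at_right 0)" "filterlim m at_bot (at_right 0)"
      unfolding p_def m_def using s r by real_asymp+
    then show ?thesis unfolding G_def using s
      by (intro tendsto_intros filterlim_compose[OF erf_at_top] filterlim_compose[OF erf_at_bot]) auto
  qed
  have Gi: "(G \<longlongrightarrow> (exp (r * sqrt s) * 1 + exp (- (r * sqrt s)) * 1) / (2 * sqrt s)) at_top"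
  proof -
    have "filterlim p at_top at_top" "filterlim m at_top at_top"
      unfolding p_def m_def using s r by real_asymp+
    then show ?thesis unfolding G_def using s
      by (intro tendsto_intros filterlim_compose[OF erf_at_top]) auto
  qed
  have ei: "einterval 0 \<infinity> = {0<..}" by (auto simp: einterval_def)
  note FTC = interval_integral_FTC_nonneg[of 0 \<infinity> G "\<lambda>t. exp (- (s * t)) * heat t r"
      "(exp (r * sqrt s) * 1 + exp (- (r * sqrt s)) * (- 1)) / (2 * sqrt s)"
      "(exp (r * sqrt s) * 1 + exp (- (r * sqrt s)) * 1) / (2 * sqrt s)"]
  have A: "((G \<circ> real_of_ereal) \<longlongrightarrow> (exp (r * sqrt s) * 1 + exp (- (r * sqrt s)) * (- 1)) / (2 * sqrt s)) (at_right 0)"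
    using G0 by (simp add: zero_ereal_def ereal_tendsto_simps)
  have B: "((G \<circ> real_of_ereal) \<longlongrightarrow> (exp (r * sqrt s) * 1 + exp (- (r * sqrt s)) * 1) / (2 * sqrt s)) (at_left \<infinity>)"
    using Gi by (simp add: ereal_tendsto_simps)
  show "set_integrable lborel {0<..} (\<lambda>t. exp (- (s * t)) * heat t r)"
    using FTC(1)[OF _ _ _ _ A B] deriv cont ei by auto
  have "(LBINT t=0..\<infinity>. exp (- (s * t)) * heat t r) = (exp (r * sqrt s) * 1 + exp (- (r * sqrt s)) * 1) / (2 * sqrt s)
      - (exp (r * sqrt s) * 1 + exp (- (r * sqrt s)) * (- 1)) / (2 * sqrt s)"
    using deriv cont by (intro FTC(2)[OF _ _ _ _ A B]) auto
  then show "(LINT t:{0<..}|lborel. exp (- (s * t)) * heat t r) = exp (- (r * sqrt s)) / sqrt s"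
    by (simp add: interval_lebesgue_integral_def ei diff_divide_distrib[symmetric])
qed

section \<open>Contraction semigroups and averages of their orbits\<close>

text \<open>The limit is tested on sequences. Measurability and the bound hold only eventually, so
  each sequence is used from an index \<open>N\<close> on.\<close>

lemma integral_dominated_convergence_at:
  fixes f :: "'m::first_countable_topology \<Rightarrow> 'c \<Rightarrow> 'b::{banach, second_countable_topology}"
  assumes f: "\<forall>\<^sub>F t in at x within S. f t \<in> borel_measurable M" and g: "g \<in> borel_measurable M"
    and w: "integrable M w"
    and lim: "AE y in M. ((\<lambda>t. f t y) \<longlongrightarrow> g y) (at x within S)"
    and bound: "\<forall>\<^sub>F t in at x within S. AE y in M. norm (f t y) \<le> w y"
  shows "((\<lambda>t. LINT y|M. f t y) \<longlongrightarrow> (LINT y|M. g y)) (at x within S)"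
  unfolding tendsto_at_iff_sequentially o_def
proof (intro allI impI)
  fix X assume X: "\<forall>i. X i \<in> S - {x}" "X \<longlonglongrightarrow> x"
  then have X': "filterlim X (at x within S) sequentially"
    by (auto simp: filterlim_at intro: always_eventually)
  have "\<forall>\<^sub>F n in sequentially. f (X n) \<in> borel_measurable M \<and> (AE y in M. norm (f (X n) y) \<le> w y)"
    using X' eventually_conj[OF f bound] by (rule eventually_compose_filterlim[rotated])
  then obtain N where N: "\<And>n. N \<le> n \<Longrightarrow> f (X n) \<in> borel_measurable M"
      "\<And>n. N \<le> n \<Longrightarrow> AE y in M. norm (f (X n) y) \<le> w y"
    by (auto simp: eventually_sequentially)
  show "(\<lambda>n. LINT y|M. f (X n) y) \<longlonglongrightarrow> (LINT y|M. g y)"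
  proof (rule LIMSEQ_offset[where k=N], rule integral_dominated_convergence[OF g _ w])
    show "AE y in M. (\<lambda>n. f (X (n + N)) y) \<longlonglongrightarrow> g y"
      using lim by eventually_elim (intro LIMSEQ_ignore_initial_segment filterlim_compose[OF _ X'])
  qed (use N in auto)
qed

lemma has_vector_derivative_slope:
  fixes f :: "real \<Rightarrow> 'b::real_normed_vector"
  assumes "((\<lambda>y. (f y - f x) /\<^sub>R (y - x)) \<longlongrightarrow> D) (at x)"
  shows "(f has_vector_derivative D) (at x)"
proof -
  have "((\<lambda>y. norm ((f y - f x) /\<^sub>R (y - x) - D)) \<longlongrightarrow> 0) (at x)"
    using assms by (intro tendsto_norm_zero LIM_zero)
  moreover have "\<forall>\<^sub>F y in at x. norm ((f y - f x) /\<^sub>R (y - x) - D)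
      = norm (f y - f x - (y - x) *\<^sub>R D) / norm (y - x)"
    unfolding eventually_at_filter
  proof (intro always_eventually allI impI)
    fix y assume "y \<noteq> x"
    then have "f y - f x - (y - x) *\<^sub>R D = (y - x) *\<^sub>R ((f y - f x) /\<^sub>R (y - x) - D)"
      by (simp add: scaleR_diff_right)
    also have "norm \<dots> = norm ((f y - f x) /\<^sub>R (y - x) - D) * norm (y - x)"
      by (simp only: norm_scaleR real_norm_def mult.commute)
    finally show "norm ((f y - f x) /\<^sub>R (y - x) - D) = norm (f y - f x - (y - x) *\<^sub>R D) / norm (y - x)"
      using \<open>y \<noteq> x\<close> by (simp only:) simp
  qed
  ultimately have "((\<lambda>y. norm (f y - f x - (y - x) *\<^sub>R D) / norm (y - x)) \<longlongrightarrow> 0) (at x)"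
    by (rule Lim_transform_eventually)
  then show ?thesis
    by (simp add: has_vector_derivative_def has_derivative_iff_norm bounded_linear_scaleR_left)
qed

locale contraction_semigroup =
  fixes T :: "real \<Rightarrow> 'b \<Rightarrow> 'b::{banach, second_countable_topology}"
  assumes linear: "0 \<le> t \<Longrightarrow> linear (T t)"
    and contraction: "0 \<le> t \<Longrightarrow> norm (T t g) \<le> norm g"
    and T_0 [simp]: "T 0 g = g"
    and T_add: "0 \<le> s \<Longrightarrow> 0 \<le> t \<Longrightarrow> T (s + t) g = T s (T t g)"
    and continuous: "continuous_on {0..} (\<lambda>t. T t g)"
begin

lemma bounded_linear_T: "0 \<le> t \<Longrightarrow> bounded_linear (T t)"
  using linear[of t] contraction[of t]
  by (intro bounded_linear.intro bounded_linear_axioms.intro) (auto intro: exI[of _ 1])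

lemma T_commute: "0 \<le> s \<Longrightarrow> 0 \<le> t \<Longrightarrow> T s (T t g) = T t (T s g)"
  by (metis T_add add.commute)

text \<open>A relation in place of \<open>generator\<close>, whose \<open>Lim\<close> is arbitrary
  where no limit exists. One statement carries domain membership and value together, and uniqueness
  of the value lets two computations be compared.\<close>

definition has_generator :: "'b \<Rightarrow> 'b \<Rightarrow> bool" where
  "has_generator g h \<longleftrightarrow> ((\<lambda>t. (T t g - g) /\<^sub>R t) \<longlongrightarrow> h) (at_right 0)"

lemma has_generator_imp:
  assumes "has_generator g h"
  shows "g \<in> generator_domain T" "generator T g = h"
  using assms unfolding has_generator_def generator_domain_def generator_def
  by (auto intro!: tendsto_Lim)

lemma has_generator_generator:
  "g \<in> generator_domain T \<Longrightarrow> has_generator g (generator T g)"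
  using has_generator_imp by (auto simp: generator_domain_def has_generator_def)

text \<open>Cutting off at zero keeps the junk values of \<open>T\<close> at negative times out of the integrals.\<close>

definition orbit :: "'b \<Rightarrow> real \<Rightarrow> 'b" where
  "orbit g s = indicat_real {0<..} s *\<^sub>R T s g"

lemma orbit_measurable [measurable]: "orbit g \<in> borel_measurable borel"
  unfolding orbit_def[abs_def]
  by (intro borel_measurable_continuous_on_indicator continuous_on_subset[OF continuous]) auto

lemma norm_orbit: "norm (orbit g s) \<le> norm g"
  by (auto simp: orbit_def indicator_def contraction)

lemma orbit_add: "orbit (g + h) s = orbit g s + orbit h s"
  by (simp add: orbit_def indicator_def linear_add[OF linear])

lemma orbit_scaleR: "orbit (c *\<^sub>R g) s = c *\<^sub>R orbit g s"
  by (simp add: orbit_def indicator_def linear_scale[OF linear])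

lemma T_scaleR_orbit: "0 \<le> t \<Longrightarrow> T t (c *\<^sub>R orbit g s) = c *\<^sub>R orbit (T t g) s"
  by (cases "0 < s") (simp_all add: orbit_def linear_scale[OF linear] linear_0[OF linear] T_commute[of t s])

text \<open>This is \<open>J q g\<close> of the overview. The restriction to the half-line sits
  inside \<open>orbit\<close>, so changes of variable can be made on the whole line.\<close>

definition orbit_integral :: "(real \<Rightarrow> real) \<Rightarrow> 'b \<Rightarrow> 'b" where
  "orbit_integral q g = (LINT s|lborel. q s *\<^sub>R orbit g s)"

lemma orbit_integral_eq: "orbit_integral q g = (LINT s:{0<..}|lborel. q s *\<^sub>R T s g)"
  unfolding orbit_integral_def set_lebesgue_integral_def orbit_def
  by (simp add: mult.commute)

context
  fixes q :: "real \<Rightarrow> real"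
  assumes q: "set_integrable lborel {0<..} q"
begin

lemma orbit_integrable: "integrable lborel (\<lambda>s. q s *\<^sub>R orbit g s)"
proof (rule Bochner_Integration.integrable_bound)
  show "integrable lborel (\<lambda>s. norm g * (indicat_real {0<..} s * q s))"
    using q by (simp add: set_integrable_def)
  \<comment> \<open>The hypothesis makes \<open>q\<close> measurable only after the cut-off; the
    indicator may be inserted because \<open>orbit\<close> vanishes off the half-line.\<close>
  have "(\<lambda>s. (indicat_real {0<..} s * q s) *\<^sub>R orbit g s) \<in> borel_measurable lborel"
    using q unfolding set_integrable_def by (intro borel_measurable_scaleR) auto
  also have "(\<lambda>s. (indicat_real {0<..} s * q s) *\<^sub>R orbit g s) = (\<lambda>s. q s *\<^sub>R orbit g s)"
    by (auto simp: orbit_def indicator_def)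
  finally show "(\<lambda>s. q s *\<^sub>R orbit g s) \<in> borel_measurable lborel" .
  show "AE s in lborel. norm (q s *\<^sub>R orbit g s) \<le> norm (norm g * (indicat_real {0<..} s * q s))"
    by (auto intro!: AE_I2 mult_left_mono contraction simp: orbit_def indicator_def abs_mult mult.commute[of "norm g"])
qed

lemma bounded_linear_orbit_integral: "bounded_linear (orbit_integral q)"
proof (rule bounded_linear_intro)
  show "orbit_integral q (g + h) = orbit_integral q g + orbit_integral q h" for g h
    unfolding orbit_integral_def orbit_add scaleR_add_right
    by (rule Bochner_Integration.integral_add[OF orbit_integrable orbit_integrable])
  show "orbit_integral q (c *\<^sub>R g) = c *\<^sub>R orbit_integral q g" for c g
    unfolding orbit_integral_def orbit_scaleR scaleR_left_commute[of _ c]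
    by (rule integral_scaleR_right)
  show "norm (orbit_integral q g) \<le> norm g * (LINT s|lborel. \<bar>indicat_real {0<..} s * q s\<bar>)" for g
  proof -
    have "norm (orbit_integral q g) \<le> (LINT s|lborel. norm (q s *\<^sub>R orbit g s))"
      unfolding orbit_integral_def by (rule integral_norm_bound)
    also have "\<dots> \<le> (LINT s|lborel. norm g * \<bar>indicat_real {0<..} s * q s\<bar>)"
    proof (rule integral_mono[OF integrable_norm[OF orbit_integrable]])
      show "integrable lborel (\<lambda>s. norm g * \<bar>indicat_real {0<..} s * q s\<bar>)"
        using q by (intro integrable_mult_right integrable_abs) (simp add: set_integrable_def)
      show "norm (q s *\<^sub>R orbit g s) \<le> norm g * \<bar>indicat_real {0<..} s * q s\<bar>" for s
        by (auto simp: orbit_def indicator_def mult.commute[of "norm g"] intro!: mult_left_mono contraction)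
    qed
    finally show ?thesis by simp
  qed
qed

lemma T_orbit_integral:
  assumes "0 \<le> t"
  shows "T t (orbit_integral q g) = orbit_integral q (T t g)"
  using integral_bounded_linear[OF bounded_linear_T[OF assms] orbit_integrable, of g]
  by (simp add: orbit_integral_def T_scaleR_orbit[OF assms])

text \<open>The operator \<open>orbit_integral q\<close> is bounded and commutes with every
  \<open>T t\<close>, so it passes through the difference quotient and its limit.\<close>

lemma has_generator_orbit_integral:
  assumes "has_generator g h"
  shows "has_generator (orbit_integral q g) (orbit_integral q h)"
proof -
  interpret J: bounded_linear "orbit_integral q" by (rule bounded_linear_orbit_integral)
  have "((\<lambda>t. orbit_integral q ((T t g - g) /\<^sub>R t)) \<longlongrightarrow> orbit_integral q h) (at_right 0)"
    using assms unfolding has_generator_def by (rule J.tendsto)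
  moreover have "\<forall>\<^sub>F t in at_right 0. orbit_integral q ((T t g - g) /\<^sub>R t)
      = (T t (orbit_integral q g) - orbit_integral q g) /\<^sub>R t"
    using eventually_at_right_less[of 0]
    by eventually_elim (simp add: J.scaleR J.diff T_orbit_integral)
  ultimately show ?thesis
    unfolding has_generator_def by (rule Lim_transform_eventually)
qed

end

text \<open>Integration by parts without differentiating the orbit, hence for every
  \<open>g\<close>: \<open>T h\<close> shifts the orbit, a change of variable moves the shift onto
  \<open>q\<close>, and the difference quotient falls on \<open>q\<close>. The initial piece of
  length \<open>h\<close> that is lost in the shift produces the boundary term.\<close>

lemma has_generator_orbit_integral_smooth:
  assumes q[measurable]: "q \<in> borel_measurable borel" and q'[measurable]: "q' \<in> borel_measurable borel"
    and deriv: "\<And>s. 0 \<le> s \<Longrightarrow> (q has_real_derivative q' s) (at s)"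
    and bound: "\<And>s. 0 \<le> s \<Longrightarrow> \<bar>q s\<bar> \<le> C * exp (- s)"
    and bound': "\<And>s. 0 \<le> s \<Longrightarrow> \<bar>q' s\<bar> \<le> C * exp (- s)"
  shows "has_generator (orbit_integral q g) (- (q 0 *\<^sub>R g) - orbit_integral q' g)"
proof -
  have C: "0 \<le> C" using bound[of 0] by simp
  have iq: "set_integrable lborel {0<..} q"
    by (rule set_integrable_exp_bound[OF q bound]) simp
  \<comment> \<open>The part beyond \<open>h\<close>, carrying the difference quotient of
    \<open>q\<close>.\<close>
  define A where "A h = (LINT s|lborel. (indicat_real {h<..} s * ((q (s - h) - q s) / h)) *\<^sub>R orbit g s)" for h
  \<comment> \<open>The mean over the lost piece (0, h], rescaled to (0, 1] so that the domain does
    not depend on \<open>h\<close>; \<open>orbit\<close> removes negative \<open>s\<close>.\<close>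
  define B where "B h = (LINT s|lborel. (indicat_real {..1} s * q (h * s)) *\<^sub>R orbit g (h * s))" for h
  have eq: "(T h (orbit_integral q g) - orbit_integral q g) /\<^sub>R h = A h - B h" if h: "0 < h" for h
  proof -
    have shift: "T h (q s *\<^sub>R orbit g s) = q s *\<^sub>R (indicat_real {0<..} s *\<^sub>R orbit g (s + h))" for s
      using h by (auto simp: orbit_def indicator_def linear_scale[OF linear] linear_0[OF linear]
          T_add[of h s, symmetric] add.commute)
    have i0: "integrable lborel (\<lambda>s. q s *\<^sub>R (indicat_real {0<..} s *\<^sub>R orbit g (s + h)))"
      using integrable_bounded_linear[OF bounded_linear_T orbit_integrable[OF iq], of h g] h
      unfolding shift by simp
    have ind: "indicat_real {0<..} (s - h) = indicat_real {h<..} s" for s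
      by (simp add: indicator_def)
    have i1: "integrable lborel (\<lambda>s. q (s - h) *\<^sub>R (indicat_real {h<..} s *\<^sub>R orbit g s))"
      using lborel_integrable_real_affine[OF i0, of 1 "- h"] by (simp add: ind)
    have "T h (orbit_integral q g) = (LINT s|lborel. q s *\<^sub>R (indicat_real {0<..} s *\<^sub>R orbit g (s + h)))"
      using integral_bounded_linear[OF bounded_linear_T orbit_integrable[OF iq], of h g] h
      unfolding shift orbit_integral_def by (simp only: less_imp_le simp_thms)
    also have "\<dots> = (LINT s|lborel. q (s - h) *\<^sub>R (indicat_real {h<..} s *\<^sub>R orbit g s))"
      by (subst lborel_integral_real_affine[where c=1 and t="- h"]) (simp_all add: ind)
    finally have 1: "T h (orbit_integral q g) = (LINT s|lborel. q (s - h) *\<^sub>R (indicat_real {h<..} s *\<^sub>R orbit g s))" .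
    have i2: "integrable lborel (\<lambda>s. indicat_real {h<..} s *\<^sub>R (q s *\<^sub>R orbit g s))"
      by (rule integrable_scaleR_bounded[OF orbit_integrable[OF iq], where B=1]) (auto simp: indicator_def)
    have i3: "integrable lborel (\<lambda>s. indicat_real {..h} s *\<^sub>R (q s *\<^sub>R orbit g s))"
      by (rule integrable_scaleR_bounded[OF orbit_integrable[OF iq], where B=1]) (auto simp: indicator_def)
    have 2: "orbit_integral q g = (LINT s|lborel. indicat_real {h<..} s *\<^sub>R (q s *\<^sub>R orbit g s))
        + (LINT s|lborel. indicat_real {..h} s *\<^sub>R (q s *\<^sub>R orbit g s))"
      unfolding orbit_integral_def
      by (subst Bochner_Integration.integral_add[symmetric, OF i2 i3])
        (auto intro!: Bochner_Integration.integral_cong simp: indicator_def)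
    have ind2: "indicat_real {..h} (h * s) = indicat_real {..1} s" for s
      using h by (simp add: indicator_def)
    have 3: "(LINT s|lborel. indicat_real {..h} s *\<^sub>R (q s *\<^sub>R orbit g s)) = h *\<^sub>R B h"
      unfolding B_def
      by (subst lborel_integral_real_affine[where c=h and t=0]) (use h in \<open>simp_all add: ind2\<close>)
    have "h *\<^sub>R A h = (LINT s|lborel. q (s - h) *\<^sub>R (indicat_real {h<..} s *\<^sub>R orbit g s)
        - indicat_real {h<..} s *\<^sub>R (q s *\<^sub>R orbit g s))"
    proof -
      have "h *\<^sub>R ((indicat_real {h<..} s * ((q (s - h) - q s) / h)) *\<^sub>R orbit g s)
          = q (s - h) *\<^sub>R (indicat_real {h<..} s *\<^sub>R orbit g s) - indicat_real {h<..} s *\<^sub>R (q s *\<^sub>R orbit g s)" for s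
        using h by (cases "h < s") (simp_all add: scaleR_diff_left)
      then show ?thesis
        unfolding A_def integral_scaleR_right[symmetric] by (simp only:)
    qed
    also have "\<dots> = T h (orbit_integral q g) - (LINT s|lborel. indicat_real {h<..} s *\<^sub>R (q s *\<^sub>R orbit g s))"
      unfolding 1 by (rule Bochner_Integration.integral_diff[OF i1 i2])
    finally have "T h (orbit_integral q g) - orbit_integral q g = h *\<^sub>R (A h - B h)"
      unfolding 2 3 by (simp add: scaleR_diff_right)
    then show ?thesis using h by simp
  qed
  have A: "(A \<longlongrightarrow> (LINT s|lborel. (- q' s) *\<^sub>R orbit g s)) (at_right 0)"
    unfolding A_def[abs_def]
  proof (rule integral_dominated_convergence_at)
    \<comment> \<open>For \<open>h < 1\<close> the mean value point \<open>z\<close> exceeds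
      \<open>s - 1\<close>, so \<open>exp (- z) \<le> exp 1 * exp (- s)\<close>. This explains the
      factor \<open>exp 1\<close>.\<close>
    show "integrable lborel (\<lambda>s. norm g * (C * exp 1) * (indicat_real {0<..} s *\<^sub>R exp (- (s * 1))))"
      using integrable_I0i_exp_mscale[of 1] by (intro integrable_mult_right) (simp add: set_integrable_def)
    show "AE s in lborel. ((\<lambda>h. (indicat_real {h<..} s * ((q (s - h) - q s) / h)) *\<^sub>R orbit g s)
        \<longlongrightarrow> - q' s *\<^sub>R orbit g s) (at_right 0)"
    proof (rule AE_I2)
      fix s :: real
      show "((\<lambda>h. (indicat_real {h<..} s * ((q (s - h) - q s) / h)) *\<^sub>R orbit g s)
        \<longlongrightarrow> - q' s *\<^sub>R orbit g s) (at_right 0)"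
      proof (cases "0 < s")
        case True
        have "((\<lambda>h. q (s - h)) has_real_derivative q' s * (0 - 1)) (at 0)"
          using deriv[of s] True
          by (intro DERIV_chain2[of q] derivative_intros) auto
        then have "((\<lambda>h. (q (s - h) - q s) / h) \<longlongrightarrow> - q' s) (at_right 0)"
          by (simp add: DERIV_def filterlim_at_split)
        moreover have "\<forall>\<^sub>F h in at_right 0. (q (s - h) - q s) / h = indicat_real {h<..} s * ((q (s - h) - q s) / h)"
          using eventually_at_right_real[OF True] by eventually_elim simp
        ultimately show ?thesis
          by (intro tendsto_intros) (rule Lim_transform_eventually)
      next
        case False
        then show ?thesis by (simp add: orbit_def)
      qed
    qed
    show "\<forall>\<^sub>F h in at_right 0. AE s in lborel.
        norm ((indicat_real {h<..} s * ((q (s - h) - q s) / h)) *\<^sub>R orbit g s)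
        \<le> norm g * (C * exp 1) * (indicat_real {0<..} s *\<^sub>R exp (- (s * 1)))"
      using eventually_at_right_real[OF zero_less_one]
    proof eventually_elim
      case (elim h)
      show ?case
      proof (rule AE_I2)
        fix s :: real
        show "norm ((indicat_real {h<..} s * ((q (s - h) - q s) / h)) *\<^sub>R orbit g s)
          \<le> norm g * (C * exp 1) * (indicat_real {0<..} s *\<^sub>R exp (- (s * 1)))"
        proof (cases "h < s")
          case True
          obtain z where z: "s - h < z" "z < s" "q s - q (s - h) = (s - (s - h)) * q' z"
            using MVT2[of "s - h" s q q'] deriv elim True by auto
          have "\<bar>(q (s - h) - q s) / h\<bar> = \<bar>(q s - q (s - h)) / h\<bar>"
            by (simp add: abs_minus_commute)
          also have "\<dots> = \<bar>q' z\<bar>" using elim by (simp add: z(3))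
          also have "\<dots> \<le> C * exp (- z)" using z True by (intro bound') simp
          also have "\<dots> \<le> C * exp (1 + (- s))" using z elim C by (intro mult_left_mono) auto
          finally have "\<bar>(q (s - h) - q s) / h\<bar> \<le> C * exp 1 * exp (- s)" by (simp only: exp_add mult.assoc)
          then have "\<bar>(q (s - h) - q s) / h\<bar> * norm (orbit g s) \<le> (C * exp 1 * exp (- s)) * norm g"
            using C by (intro mult_mono norm_orbit) auto
          then show ?thesis using True elim by (simp add: ac_simps)
        next
          case False
          then show ?thesis using C by simp
        qed
      qed
    qed
  qed (auto intro: always_eventually)
  have B: "(B \<longlongrightarrow> (LINT s|lborel. (indicat_real {0<..1::real} s * q 0) *\<^sub>R g)) (at_right 0)"
    unfolding B_def[abs_def]
  proof (rule integral_dominated_convergence_at)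
    show "integrable lborel (\<lambda>s. norm g * C * indicat_real {0<..1::real} s)"
      by (intro integrable_mult_right integrable_real_indicator) auto
    show "AE s in lborel. ((\<lambda>h. (indicat_real {..1} s * q (h * s)) *\<^sub>R orbit g (h * s))
        \<longlongrightarrow> (indicat_real {0<..1} s * q 0) *\<^sub>R g) (at_right 0)"
    proof (rule AE_I2)
      fix s :: real
      show "((\<lambda>h. (indicat_real {..1} s * q (h * s)) *\<^sub>R orbit g (h * s))
        \<longlongrightarrow> (indicat_real {0<..1} s * q 0) *\<^sub>R g) (at_right 0)"
      proof (cases "0 < s \<and> s \<le> 1")
        case True
        have "((\<lambda>h. h * s) \<longlongrightarrow> 0) (at_right 0)"
          by (intro tendsto_eq_intros) auto
        moreover have "isCont q 0" using deriv[of 0] by (intro DERIV_isCont) simp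
        ultimately have "((\<lambda>h. q (h * s)) \<longlongrightarrow> q 0) (at_right 0)"
          by (rule isCont_tendsto_compose[rotated])
        moreover have "((\<lambda>h. T (h * s) g) \<longlongrightarrow> T 0 g) (at_right 0)"
        proof (rule continuous_on_tendsto_compose[OF continuous])
          show "((\<lambda>h. h * s) \<longlongrightarrow> 0) (at_right 0)" by fact
          show "\<forall>\<^sub>F h in at_right 0. h * s \<in> {0..}"
            using eventually_at_right_less[of 0] by eventually_elim (use True in simp)
        qed simp
        ultimately have "((\<lambda>h. q (h * s) *\<^sub>R T (h * s) g) \<longlongrightarrow> q 0 *\<^sub>R T 0 g) (at_right 0)"
          by (intro tendsto_intros)
        moreover have "\<forall>\<^sub>F h in at_right 0. q (h * s) *\<^sub>R T (h * s) g =
            (indicat_real {..1} s * q (h * s)) *\<^sub>R orbit g (h * s)"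
          using eventually_at_right_less[of 0] by eventually_elim (use True in \<open>simp add: orbit_def\<close>)
        ultimately have "((\<lambda>h. (indicat_real {..1} s * q (h * s)) *\<^sub>R orbit g (h * s))
            \<longlongrightarrow> q 0 *\<^sub>R T 0 g) (at_right 0)"
          by (rule Lim_transform_eventually)
        then show ?thesis using True by simp
      next
        case False
        have "\<forall>\<^sub>F h in at_right 0. (indicat_real {..1} s * q (h * s)) *\<^sub>R orbit g (h * s) = 0"
          using eventually_at_right_less[of 0]
          by eventually_elim (use False in \<open>auto simp: orbit_def indicator_def zero_less_mult_iff\<close>)
        then show ?thesis using False by (auto simp: tendsto_eventually)
      qed
    qed
    show "\<forall>\<^sub>F h in at_right 0. AE s in lborel. norm ((indicat_real {..1} s * q (h * s)) *\<^sub>R orbit g (h * s))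
        \<le> norm g * C * indicat_real {0<..1} s"
      using eventually_at_right_less[of 0]
    proof eventually_elim
      case (elim h)
      show ?case
      proof (rule AE_I2)
        fix s :: real
        show "norm ((indicat_real {..1} s * q (h * s)) *\<^sub>R orbit g (h * s)) \<le> norm g * C * indicat_real {0<..1} s"
        proof (cases "0 < s \<and> s \<le> 1")
          case True
          then have hs: "0 \<le> h * s" using elim by simp
          have "\<bar>q (h * s)\<bar> \<le> C * exp (- (h * s))" using hs by (rule bound)
          also have "\<dots> \<le> C * 1" using hs C by (intro mult_left_mono) auto
          finally have "\<bar>q (h * s)\<bar> * norm (orbit g (h * s)) \<le> C * norm g"
            using C by (intro mult_mono norm_orbit) auto
          then show ?thesis using True by (simp add: ac_simps)
        next
          case False
          then show ?thesis using elim by (auto simp: orbit_def indicator_def zero_less_mult_iff)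
        qed
      qed
    qed
  qed (auto intro: always_eventually)
  have "(LINT s|lborel. (indicat_real {0<..1::real} s * q 0) *\<^sub>R g) = q 0 *\<^sub>R g"
  proof -
    have "integrable lborel (\<lambda>s. indicat_real {0<..1::real} s * q 0)"
      by (intro integrable_mult_left integrable_real_indicator) auto
    from integral_scaleR_left[OF this, of g] show ?thesis by simp
  qed
  moreover have "(LINT s|lborel. (- q' s) *\<^sub>R orbit g s) = - orbit_integral q' g"
    by (simp add: orbit_integral_def)
  ultimately have "((\<lambda>h. A h - B h) \<longlongrightarrow> - orbit_integral q' g - q 0 *\<^sub>R g) (at_right 0)"
    using tendsto_diff[OF A B] by simp
  moreover have "\<forall>\<^sub>F h in at_right 0. A h - B h = (T h (orbit_integral q g) - orbit_integral q g) /\<^sub>R h"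
    using eventually_at_right_less[of 0] by eventually_elim (simp only: eq)
  ultimately have "((\<lambda>h. (T h (orbit_integral q g) - orbit_integral q g) /\<^sub>R h)
      \<longlongrightarrow> - orbit_integral q' g - q 0 *\<^sub>R g) (at_right 0)"
    by (rule Lim_transform_eventually)
  then show ?thesis
    unfolding has_generator_def minus_diff_commute[of "q 0 *\<^sub>R g"] .
qed

text \<open>Differentiation under the integral. The mean value inequality turns the bound on
  \<open>k'\<close>, uniform over the window from \<open>a\<close> to \<open>b\<close>, into a
  common majorant of the difference quotients.\<close>

lemma orbit_integral_has_vector_derivative:
  assumes k: "\<forall>\<^sub>F \<tau> in nhds t. k \<tau> \<in> borel_measurable borel" and k': "k' t \<in> borel_measurable borel"
    and t: "a < t" "t < b"
    and deriv: "\<And>\<tau> s. a < \<tau> \<Longrightarrow> \<tau> < b \<Longrightarrow> 0 < s \<Longrightarrow> ((\<lambda>\<tau>. k \<tau> s) has_real_derivative k' \<tau> s) (at \<tau>)"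
    and int: "\<And>\<tau>. a < \<tau> \<Longrightarrow> \<tau> < b \<Longrightarrow> set_integrable lborel {0<..} (k \<tau>)"
    and bound: "\<And>\<tau> s. a < \<tau> \<Longrightarrow> \<tau> < b \<Longrightarrow> 0 < s \<Longrightarrow> \<bar>k' \<tau> s\<bar> \<le> C * exp (- s)"
  shows "((\<lambda>\<tau>. orbit_integral (k \<tau>) g) has_vector_derivative orbit_integral (k' t) g) (at t)"
proof -
  have "((\<lambda>\<tau>. LINT s|lborel. ((k \<tau> s - k t s) / (\<tau> - t)) *\<^sub>R orbit g s)
      \<longlongrightarrow> (LINT s|lborel. k' t s *\<^sub>R orbit g s)) (at t)"
  proof (rule integral_dominated_convergence_at)
    show "\<forall>\<^sub>F \<tau> in at t. (\<lambda>s. ((k \<tau> s - k t s) / (\<tau> - t)) *\<^sub>R orbit g s) \<in> borel_measurable lborel"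
    proof -
      have kt[measurable]: "k t \<in> borel_measurable borel" using eventually_nhds_x_imp_x[OF k] .
      have "\<forall>\<^sub>F \<tau> in at t. k \<tau> \<in> borel_measurable borel"
        using k by (simp add: eventually_at_filter eventually_mono)
      then show ?thesis
      proof eventually_elim
        case (elim \<tau>)
        note [measurable] = elim
        show ?case by measurable
      qed
    qed
    show "(\<lambda>s. k' t s *\<^sub>R orbit g s) \<in> borel_measurable lborel" using k' by measurable
    show "integrable lborel (\<lambda>s. norm g * \<bar>C\<bar> * (indicat_real {0<..} s *\<^sub>R exp (- (s * 1))))"
      using integrable_I0i_exp_mscale[of 1] by (intro integrable_mult_right) (simp add: set_integrable_def)
    show "AE s in lborel. ((\<lambda>\<tau>. ((k \<tau> s - k t s) / (\<tau> - t)) *\<^sub>R orbit g s) \<longlongrightarrow> k' t s *\<^sub>R orbit g s) (at t)"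
    proof (rule AE_I2)
      fix s :: real
      show "((\<lambda>\<tau>. ((k \<tau> s - k t s) / (\<tau> - t)) *\<^sub>R orbit g s) \<longlongrightarrow> k' t s *\<^sub>R orbit g s) (at t)"
      proof (cases "0 < s")
        case True
        then show ?thesis using deriv[OF t True]
          by (intro tendsto_intros) (simp add: has_field_derivative_iff)
      qed (simp add: orbit_def)
    qed
    have "\<forall>\<^sub>F \<tau> in at t. \<tau> \<in> {a<..<b}" using t by (intro eventually_at_in_open') auto
    moreover have "\<forall>\<^sub>F \<tau> in at t. \<tau> \<noteq> t" by (simp add: eventually_at_filter)
    ultimately show "\<forall>\<^sub>F \<tau> in at t. AE s in lborel. norm (((k \<tau> s - k t s) / (\<tau> - t)) *\<^sub>R orbit g s)
        \<le> norm g * \<bar>C\<bar> * (indicat_real {0<..} s *\<^sub>R exp (- (s * 1)))"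
    proof eventually_elim
      case (elim \<tau>)
      show ?case
      proof (rule AE_I2)
        fix s :: real
        show "norm (((k \<tau> s - k t s) / (\<tau> - t)) *\<^sub>R orbit g s)
            \<le> norm g * \<bar>C\<bar> * (indicat_real {0<..} s *\<^sub>R exp (- (s * 1)))"
        proof (cases "0 < s")
          case True
          have "norm (k \<tau> s - k t s) \<le> (\<bar>C\<bar> * exp (- s)) * norm (\<tau> - t)"
          proof (rule field_differentiable_bound[where S="{a<..<b}"])
            show "((\<lambda>\<tau>. k \<tau> s) has_field_derivative k' z s) (at z within {a<..<b})" if "z \<in> {a<..<b}" for z
              using that True by (intro has_field_derivative_at_within[OF deriv]) auto
            show "norm (k' z s) \<le> \<bar>C\<bar> * exp (- s)" if "z \<in> {a<..<b}" for z
            proof -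
              have "\<bar>k' z s\<bar> \<le> C * exp (- s)" using that True by (intro bound) auto
              also have "\<dots> \<le> \<bar>C\<bar> * exp (- s)" by (intro mult_right_mono) auto
              finally show ?thesis by simp
            qed
          qed (use elim t in auto)
          then have "\<bar>(k \<tau> s - k t s) / (\<tau> - t)\<bar> \<le> \<bar>C\<bar> * exp (- s)"
            using elim by (simp add: abs_divide divide_le_eq)
          then have "\<bar>(k \<tau> s - k t s) / (\<tau> - t)\<bar> * norm (orbit g s) \<le> (\<bar>C\<bar> * exp (- s)) * norm g"
            by (intro mult_mono norm_orbit) auto
          then show ?thesis using True by (simp add: ac_simps)
        qed (simp add: orbit_def)
      qed
    qed
  qed
  moreover have "\<forall>\<^sub>F \<tau> in at t. (LINT s|lborel. ((k \<tau> s - k t s) / (\<tau> - t)) *\<^sub>R orbit g s)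
      = (orbit_integral (k \<tau>) g - orbit_integral (k t) g) /\<^sub>R (\<tau> - t)"
  proof -
    have "\<forall>\<^sub>F \<tau> in at t. \<tau> \<in> {a<..<b}" using t by (intro eventually_at_in_open') auto
    then show ?thesis
    proof eventually_elim
      case (elim \<tau>)
      have "(orbit_integral (k \<tau>) g - orbit_integral (k t) g) /\<^sub>R (\<tau> - t)
          = (LINT s|lborel. (k \<tau> s *\<^sub>R orbit g s - k t s *\<^sub>R orbit g s) /\<^sub>R (\<tau> - t))"
        unfolding orbit_integral_def using elim t
        by (simp only: Bochner_Integration.integral_diff[OF orbit_integrable[OF int] orbit_integrable[OF int]]
            integral_scaleR_right greaterThanLessThan_iff)
      then show ?case
        by (simp add: scaleR_diff_left[symmetric] divide_inverse mult.commute)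
    qed
  qed
  ultimately have "((\<lambda>\<tau>. (orbit_integral (k \<tau>) g - orbit_integral (k t) g) /\<^sub>R (\<tau> - t))
      \<longlongrightarrow> orbit_integral (k' t) g) (at t)"
    unfolding orbit_integral_def[of "k' t"] by (rule Lim_transform_eventually)
  then show ?thesis by (rule has_vector_derivative_slope)
qed

section \<open>Orbit averages with the heat kernel\<close>

lemma orbit_integral_heat_eq:
  assumes "0 < t"
  shows "(2 / sqrt (4 * pi * t)) *\<^sub>R (LINT s:{0<..}|lborel. exp (- (s\<^sup>2 / (4 * t))) *\<^sub>R T s g)
    = orbit_integral (heat t) g"
proof -
  have "2 / sqrt (4 * pi * t) = 1 / sqrt (pi * t)"
    by (simp add: real_sqrt_mult)
  then show ?thesis
    unfolding orbit_integral_eq heat_def set_lebesgue_integral_def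
    by (subst integral_scaleR_right[symmetric]) (auto intro!: Bochner_Integration.integral_cong)
qed

text \<open>A smoothing effect: the average lies in the domain for every \<open>g\<close>. Applied
  to \<open>generator T f\<close>, it allows a second application of the generator to the solution
  and yields the boundary term that cancels the inhomogeneity.\<close>

lemma has_generator_orbit_integral_heat:
  assumes "0 < t"
  shows "has_generator (orbit_integral (heat t) g)
    (- ((1 / sqrt (pi * t)) *\<^sub>R g) - orbit_integral (heat_ds t) g)"
proof -
  obtain C where C:
      "\<And>s. 0 \<le> s \<Longrightarrow> \<bar>heat t s\<bar> \<le> C * exp (- s)"
      "\<And>s. 0 \<le> s \<Longrightarrow> \<bar>heat_ds t s\<bar> \<le> C * exp (- s)"
      "\<And>s. 0 \<le> s \<Longrightarrow> \<bar>heat_dt t s\<bar> \<le> C * exp (- s)"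
    by (rule heat_bounds_at[OF assms]) (rule that)
  have "heat t 0 = 1 / sqrt (pi * t)" by (simp add: heat_def)
  then show ?thesis
    using has_generator_orbit_integral_smooth[OF heat_measurable(1,2) has_derivative_heat_s[OF assms] C(1,2)] by simp
qed

text \<open>The generator of \<open>orbit_integral (heat_ds t) g\<close> is computed twice, once by
  moving it onto the kernel and once by moving it onto \<open>g\<close>. The boundary term of the
  first computation vanishes because \<open>heat_ds t 0 = 0\<close>.\<close>

lemma orbit_integral_heat_dt:
  assumes t: "0 < t" and g: "has_generator g h"
  shows "orbit_integral (heat_dt t) g = - orbit_integral (heat_ds t) h"
proof -
  obtain C where C:
      "\<And>s. 0 \<le> s \<Longrightarrow> \<bar>heat t s\<bar> \<le> C * exp (- s)"
      "\<And>s. 0 \<le> s \<Longrightarrow> \<bar>heat_ds t s\<bar> \<le> C * exp (- s)"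
      "\<And>s. 0 \<le> s \<Longrightarrow> \<bar>heat_dt t s\<bar> \<le> C * exp (- s)"
    by (rule heat_bounds_at[OF t]) (rule that)
  have "heat_ds t 0 = 0" by (simp add: heat_ds_def)
  then have "has_generator (orbit_integral (heat_ds t) g) (- orbit_integral (heat_dt t) g)"
    using has_generator_orbit_integral_smooth[OF heat_measurable(2,3) has_derivative_heat_ds[OF t] C(2,3), of g] by simp
  moreover have "has_generator (orbit_integral (heat_ds t) g) (orbit_integral (heat_ds t) h)"
    by (rule has_generator_orbit_integral[OF heat_integrable(2)[OF t] g])
  ultimately have "- orbit_integral (heat_dt t) g = orbit_integral (heat_ds t) h"
    by (auto dest!: has_generator_imp(2))
  then show ?thesis by (simp add: minus_equation_iff)
qed

lemma orbit_integral_heat_has_vector_derivative: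
  assumes t: "0 < t"
  shows "((\<lambda>t. orbit_integral (heat t) g) has_vector_derivative orbit_integral (heat_dt t) g) (at t)"
proof -
  \<comment> \<open>The window stays away from the singular time 0, so one constant serves all its
    times.\<close>
  have t2: "0 < t / 2" "t / 2 \<le> 2 * t" using t by simp_all
  obtain C where "\<And>\<tau> s. t / 2 \<le> \<tau> \<Longrightarrow> \<tau> \<le> 2 * t \<Longrightarrow> 0 \<le> s \<Longrightarrow> \<bar>heat \<tau> s\<bar> \<le> C * exp (- s)"
      "\<And>\<tau> s. t / 2 \<le> \<tau> \<Longrightarrow> \<tau> \<le> 2 * t \<Longrightarrow> 0 \<le> s \<Longrightarrow> \<bar>heat_ds \<tau> s\<bar> \<le> C * exp (- s)"
      "\<And>\<tau> s. t / 2 \<le> \<tau> \<Longrightarrow> \<tau> \<le> 2 * t \<Longrightarrow> 0 \<le> s \<Longrightarrow> \<bar>heat_dt \<tau> s\<bar> \<le> C * exp (- s)"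
    by (rule heat_bounds[OF t2]) (rule that)
  note C = this(3)
  show ?thesis
  proof (rule orbit_integral_has_vector_derivative[where a="t / 2" and b="2 * t" and C=C])
    show "\<forall>\<^sub>F \<tau> in nhds t. heat \<tau> \<in> borel_measurable borel"
      by (simp add: heat_measurable)
    show "((\<lambda>\<tau>. heat \<tau> s) has_real_derivative heat_dt \<tau> s) (at \<tau>)" if "t / 2 < \<tau>" for \<tau> s
      using that t by (intro has_derivative_heat_t) simp
    show "set_integrable lborel {0<..} (heat \<tau>)" if "t / 2 < \<tau>" for \<tau>
      using that t by (intro heat_integrable) simp
  qed (use t C heat_measurable in auto)
qed

text \<open>The substitution \<open>s = 2 * sqrt t * \<sigma>\<close> takes \<open>t\<close> out of
  the weight and puts it into the orbit. The formula then also holds at \<open>t = 0\<close>, where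
  total mass one gives \<open>g\<close>, and dominated convergence works at every nonnegative
  time.\<close>

lemma heat_average_continuous:
  assumes u0: "u 0 = g" and u: "\<And>t. 0 < t \<Longrightarrow> u t = orbit_integral (heat t) g"
  shows "continuous_on {0..} u"
proof -
  \<comment> \<open>At time 1/4 the exponent of the kernel is \<open>- \<sigma>\<^sup>2\<close>, the
    form it takes after the substitution.\<close>
  define w where "w \<sigma> = indicat_real {0..} \<sigma> *\<^sub>R heat (1/4) \<sigma>" for \<sigma>
  have w: "integrable lborel w" "(LINT \<sigma>|lborel. w \<sigma>) = 1"
    using has_bochner_integral_heat[of "1/4"] unfolding w_def[abs_def]
    by (auto dest: integrable.intros has_bochner_integral_integral_eq)
  have w0: "0 \<le> w \<sigma>" for \<sigma> by (simp add: w_def)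
  have meas: "(\<lambda>\<sigma>. w \<sigma> *\<^sub>R T (2 * sqrt t * \<sigma>) g) \<in> borel_measurable lborel" if t: "0 \<le> t" for t
  proof -
    have "(\<lambda>\<sigma>. indicat_real {0..} \<sigma> *\<^sub>R T (2 * sqrt t * \<sigma>) g) \<in> borel_measurable borel"
      using t by (intro borel_measurable_continuous_on_indicator continuous_on_compose2[OF continuous]
          continuous_intros) auto
    then have "(\<lambda>\<sigma>. heat (1/4) \<sigma> *\<^sub>R (indicat_real {0..} \<sigma> *\<^sub>R T (2 * sqrt t * \<sigma>) g)) \<in> borel_measurable lborel"
      using heat_measurable(1) by (rule_tac borel_measurable_scaleR) simp_all
    moreover have "heat (1/4) \<sigma> *\<^sub>R (indicat_real {0..} \<sigma> *\<^sub>R T (2 * sqrt t * \<sigma>) g) = w \<sigma> *\<^sub>R T (2 * sqrt t * \<sigma>) g" for \<sigma>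
      by (simp add: w_def mult.commute)
    ultimately show ?thesis by (simp only:)
  qed
  have u_eq: "u t = (LINT \<sigma>|lborel. w \<sigma> *\<^sub>R T (2 * sqrt t * \<sigma>) g)" if t: "0 \<le> t" for t
  proof (cases "t = 0")
    case True
    have "(LINT \<sigma>|lborel. w \<sigma> *\<^sub>R T (2 * sqrt t * \<sigma>) g) = (LINT \<sigma>|lborel. w \<sigma> *\<^sub>R g)"
      using True by simp
    also have "\<dots> = g" using w by simp
    finally show ?thesis using True u0 by simp
  next
    case False
    with t have t: "0 < t" by simp
    have "u t = \<bar>2 * sqrt t\<bar> *\<^sub>R (LINT \<sigma>|lborel. heat t (0 + 2 * sqrt t * \<sigma>) *\<^sub>R orbit g (0 + 2 * sqrt t * \<sigma>))"
      unfolding u[OF t] orbit_integral_def using t by (intro lborel_integral_real_affine) simp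
    also have "\<dots> = (LINT \<sigma>|lborel. (2 * sqrt t * heat t (2 * sqrt t * \<sigma>)) *\<^sub>R orbit g (2 * sqrt t * \<sigma>))"
      using t by (subst integral_scaleR_right[symmetric]) simp
    also have "\<dots> = (LINT \<sigma>|lborel. w \<sigma> *\<^sub>R T (2 * sqrt t * \<sigma>) g)"
    proof (rule integral_cong_AE)
      \<comment> \<open>At \<open>\<sigma> = 0\<close> the integrands differ: \<open>orbit\<close>
        is cut off to 0 there, while \<open>T 0 g = g\<close>.\<close>
      have "AE \<sigma> in lborel. \<sigma> \<noteq> (0::real)" by (rule AE_lborel_singleton)
      then show "AE \<sigma> in lborel. (2 * sqrt t * heat t (2 * sqrt t * \<sigma>)) *\<^sub>R orbit g (2 * sqrt t * \<sigma>)
          = w \<sigma> *\<^sub>R T (2 * sqrt t * \<sigma>) g"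
      proof eventually_elim
        case (elim \<sigma>)
        have "2 * sqrt t * heat t (2 * sqrt t * \<sigma>) = heat (1/4) \<sigma>"
        proof -
          have "(2 * sqrt t * \<sigma>)\<^sup>2 / (4 * t) = \<sigma>\<^sup>2" "\<sigma>\<^sup>2 / (4 * (1 / 4)) = \<sigma>\<^sup>2"
            using t by (simp_all add: power_mult_distrib)
          moreover have "sqrt (pi * t) = sqrt pi * sqrt t" "sqrt (pi * (1 / 4)) = sqrt pi / 2"
            by (simp_all add: real_sqrt_mult real_sqrt_divide)
          ultimately show ?thesis using t by (simp only: heat_def) simp
        qed
        then show ?case
          using elim t by (auto simp: w_def orbit_def indicator_def zero_less_mult_iff)
      qed
      show "(\<lambda>\<sigma>. (2 * sqrt t * heat t (2 * sqrt t * \<sigma>)) *\<^sub>R orbit g (2 * sqrt t * \<sigma>)) \<in> borel_measurable lborel"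
        using heat_measurable(1) by measurable
    qed (use meas t in simp)
    finally show ?thesis .
  qed
  show ?thesis
    unfolding continuous_on_def
  proof
    fix t :: real assume "t \<in> {0..}"
    then have t: "0 \<le> t" by simp
    have ev: "\<forall>\<^sub>F r in at t within {0..}. 0 \<le> r"
      by (auto simp: eventually_at_filter)
    have "((\<lambda>r. LINT \<sigma>|lborel. w \<sigma> *\<^sub>R T (2 * sqrt r * \<sigma>) g) \<longlongrightarrow>
        (LINT \<sigma>|lborel. w \<sigma> *\<^sub>R T (2 * sqrt t * \<sigma>) g)) (at t within {0..})"
    proof (rule integral_dominated_convergence_at)
      show "\<forall>\<^sub>F r in at t within {0..}. (\<lambda>\<sigma>. w \<sigma> *\<^sub>R T (2 * sqrt r * \<sigma>) g) \<in> borel_measurable lborel"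
        using ev by eventually_elim (rule meas)
      show "integrable lborel (\<lambda>\<sigma>. w \<sigma> * norm g)" using w by simp
      show "AE \<sigma> in lborel. ((\<lambda>r. w \<sigma> *\<^sub>R T (2 * sqrt r * \<sigma>) g) \<longlongrightarrow> w \<sigma> *\<^sub>R T (2 * sqrt t * \<sigma>) g) (at t within {0..})"
      proof (rule AE_I2)
        fix \<sigma> :: real
        show "((\<lambda>r. w \<sigma> *\<^sub>R T (2 * sqrt r * \<sigma>) g) \<longlongrightarrow> w \<sigma> *\<^sub>R T (2 * sqrt t * \<sigma>) g) (at t within {0..})"
        proof (cases "0 \<le> \<sigma>")
          case True
          have "((\<lambda>r. T (2 * sqrt r * \<sigma>) g) \<longlongrightarrow> T (2 * sqrt t * \<sigma>) g) (at t within {0..})"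
          proof (rule continuous_on_tendsto_compose[OF continuous])
            show "((\<lambda>r. 2 * sqrt r * \<sigma>) \<longlongrightarrow> 2 * sqrt t * \<sigma>) (at t within {0..})"
              by (intro tendsto_intros)
            show "\<forall>\<^sub>F r in at t within {0..}. 2 * sqrt r * \<sigma> \<in> {0..}"
              using ev by eventually_elim (use True in simp)
          qed (use True t in simp)
          then show ?thesis by (intro tendsto_intros)
        qed (simp add: w_def)
      qed
      show "\<forall>\<^sub>F r in at t within {0..}. AE \<sigma> in lborel. norm (w \<sigma> *\<^sub>R T (2 * sqrt r * \<sigma>) g) \<le> w \<sigma> * norm g"
        using ev
      proof eventually_elim
        case (elim r)
        show ?case
        proof (rule AE_I2)
          show "norm (w \<sigma> *\<^sub>R T (2 * sqrt r * \<sigma>) g) \<le> w \<sigma> * norm g" for \<sigma>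
          proof (cases "0 \<le> \<sigma>")
            case True
            then show ?thesis using elim w0 by (auto intro!: mult_left_mono contraction)
          qed (simp add: w_def)
        qed
      qed
    qed (use meas t in simp)
    moreover have "\<forall>\<^sub>F r in at t within {0..}. (LINT \<sigma>|lborel. w \<sigma> *\<^sub>R T (2 * sqrt r * \<sigma>) g) = u r"
      using ev by eventually_elim (simp only: u_eq)
    ultimately show "(u \<longlongrightarrow> u t) (at t within {0..})"
      unfolding u_eq[OF t] by (rule Lim_transform_eventually)
  qed
qed

text \<open>By Fubini the integral over \<open>t\<close> may be taken first, which is
  \<open>laplace_heat\<close>. Joint integrability holds since integrating the norm over
  \<open>r\<close> first leaves at most \<open>norm g * exp (- (t * s))\<close>, the kernel having
  mass one.\<close>

lemma laplace_orbit_integral_heat: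
  assumes s: "0 < s" and u: "\<And>t. 0 < t \<Longrightarrow> u t = orbit_integral (heat t) g"
  shows "laplace_integrable u s"
    and "laplace u s = (1 / sqrt s) *\<^sub>R orbit_integral (\<lambda>r. exp (- (r * sqrt s))) g"
proof -
  define F where "F t r = (indicat_real {0<..} t * (exp (- (s * t)) * heat t r)) *\<^sub>R orbit g r" for t r
  have u': "indicat_real {0<..} t *\<^sub>R (exp (- (s * t)) *\<^sub>R u t) = (LINT r|lborel. F t r)" for t
  proof (cases "0 < t")
    case True
    then show ?thesis
      by (simp add: u F_def orbit_integral_def integral_scaleR_right[symmetric] del: integral_scaleR_right)
  qed (simp add: F_def)
  have "integrable (lborel \<Otimes>\<^sub>M lborel) (case_prod F)"
  proof (rule lborel_pair.Fubini_integrable)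
    show "case_prod F \<in> borel_measurable (lborel \<Otimes>\<^sub>M lborel)"
      unfolding F_def heat_def case_prod_beta by measurable
    have int: "integrable lborel (F t)" for t
    proof (cases "0 < t")
      case True
      have "integrable lborel (\<lambda>r. exp (- (s * t)) *\<^sub>R (heat t r *\<^sub>R orbit g r))"
        using orbit_integrable[OF heat_integrable(1)[OF True], of g] by (intro integrable_scaleR_right)
      then show ?thesis using True by (simp add: F_def[abs_def])
    qed (simp add: F_def[abs_def])
    then show "AE t in lborel. integrable lborel (\<lambda>r. case_prod F (t, r))" by simp
    show "integrable lborel (\<lambda>t. LINT r|lborel. norm (case_prod F (t, r)))"
    proof (rule Bochner_Integration.integrable_bound)
      show "integrable lborel (\<lambda>t. norm g * (indicat_real {0<..} t *\<^sub>R exp (- (t * s))))"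
        using integrable_I0i_exp_mscale[OF s] by (intro integrable_mult_right) (simp add: set_integrable_def)
      have "(\<lambda>(t, r). norm (F t r)) \<in> borel_measurable (lborel \<Otimes>\<^sub>M lborel)"
        unfolding F_def heat_def case_prod_beta by measurable
      then show "(\<lambda>t. LINT r|lborel. norm (case_prod F (t, r))) \<in> borel_measurable lborel"
        by (simp add: lborel.borel_measurable_lebesgue_integral)
      show "AE t in lborel. norm (LINT r|lborel. norm (case_prod F (t, r)))
          \<le> norm (norm g * (indicat_real {0<..} t *\<^sub>R exp (- (t * s))))"
      proof (rule AE_I2)
        fix t
        show "norm (LINT r|lborel. norm (case_prod F (t, r)))
          \<le> norm (norm g * (indicat_real {0<..} t *\<^sub>R exp (- (t * s))))"
        proof (cases "0 < t")
          case True
          have h: "integrable lborel (\<lambda>r. indicat_real {0..} r *\<^sub>R heat t r)"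
              "(LINT r|lborel. indicat_real {0..} r *\<^sub>R heat t r) = 1"
            using has_bochner_integral_heat[OF True]
            by (auto dest: integrable.intros has_bochner_integral_integral_eq)
          have "(LINT r|lborel. norm (F t r)) \<le> (LINT r|lborel. norm g * exp (- (t * s)) * (indicat_real {0..} r *\<^sub>R heat t r))"
          proof (rule integral_mono)
            show "integrable lborel (\<lambda>r. norm (F t r))" using int by simp
            show "integrable lborel (\<lambda>r. norm g * exp (- (t * s)) * (indicat_real {0..} r *\<^sub>R heat t r))"
              using h(1) by (rule integrable_mult_right)
            show "norm (F t r) \<le> norm g * exp (- (t * s)) * (indicat_real {0..} r *\<^sub>R heat t r)" for r
            proof (cases "0 < r")
              case r: True
              have "norm (F t r) = (exp (- (t * s)) * heat t r) * norm (orbit g r)"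
                using True by (simp add: F_def mult.commute)
              also have "\<dots> \<le> (exp (- (t * s)) * heat t r) * norm g"
                using True by (intro mult_left_mono norm_orbit) simp
              finally show ?thesis using r by (simp add: ac_simps)
            next
              case False
              then show ?thesis using True by (simp add: F_def orbit_def)
            qed
          qed
          also have "\<dots> = norm g * exp (- (t * s))"
            unfolding integral_mult_right_zero h(2) by simp
          finally show ?thesis using True by simp
        qed (simp add: F_def)
      qed
    qed
  qed
  note F = this
  show "laplace_integrable u s"
    unfolding laplace_integrable_def set_integrable_def u'
    using lborel_pair.integrable_fst'[OF F] by simp
  have "laplace u s = (LINT t|lborel. LINT r|lborel. F t r)"
    unfolding laplace_def set_lebesgue_integral_def u' ..
  also have "\<dots> = (LINT r|lborel. LINT t|lborel. F t r)"
    by (rule lborel_pair.Fubini_integral[OF F, symmetric])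
  also have "\<dots> = (LINT r|lborel. (1 / sqrt s) *\<^sub>R (exp (- (r * sqrt s)) *\<^sub>R orbit g r))"
  proof (intro Bochner_Integration.integral_cong refl)
    fix r :: real
    show "(LINT t|lborel. F t r) = (1 / sqrt s) *\<^sub>R (exp (- (r * sqrt s)) *\<^sub>R orbit g r)"
    proof (cases "0 < r")
      case True
      have "integrable lborel (\<lambda>t. indicat_real {0<..} t * (exp (- (s * t)) * heat t r))"
        "(LINT t|lborel. indicat_real {0<..} t * (exp (- (s * t)) * heat t r)) = exp (- (r * sqrt s)) / sqrt s"
        using laplace_heat[OF s True] by (simp_all add: set_integrable_def set_lebesgue_integral_def)
      then show ?thesis
        unfolding F_def by (subst integral_scaleR_left) simp_all
    qed (simp add: F_def orbit_def)
  qed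
  also have "\<dots> = (1 / sqrt s) *\<^sub>R orbit_integral (\<lambda>r. exp (- (r * sqrt s))) g"
    unfolding orbit_integral_def by (rule integral_scaleR_right)
  finally show "laplace u s = (1 / sqrt s) *\<^sub>R orbit_integral (\<lambda>r. exp (- (r * sqrt s))) g" .
qed

text \<open>The resolvent identity. The kernel is its own derivative up to the factor
  \<open>- l\<close>, so the two formulas for the generator of its orbit integral give the claim
  when compared. The bound \<open>1 \<le> l\<close> lets \<open>exp (- r)\<close> dominate the
  kernel.\<close>

lemma orbit_integral_exp_generator:
  assumes l: "1 \<le> l" and g: "has_generator g h"
  shows "orbit_integral (\<lambda>r. exp (- (r * l))) h = l *\<^sub>R orbit_integral (\<lambda>r. exp (- (r * l))) g - g"
proof -
  define q where "q r = exp (- (r * l))" for r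
  have [measurable]: "q \<in> borel_measurable borel" unfolding q_def by measurable
  have q0: "\<bar>q s\<bar> \<le> 1 * exp (- s)" if "0 \<le> s" for s
    using mult_left_mono[OF l that] by (simp add: q_def)
  have q: "\<bar>q s\<bar> \<le> l * exp (- s)" if "0 \<le> s" for s
  proof -
    have "1 * exp (- s) \<le> l * exp (- s)" using l by (intro mult_right_mono) auto
    with q0[OF that] show ?thesis by linarith
  qed
  have iq: "set_integrable lborel {0<..} q"
    by (rule set_integrable_exp_bound[where C=l]) (auto intro: q)
  interpret J: bounded_linear "orbit_integral q" by (rule bounded_linear_orbit_integral[OF iq])
  have "has_generator (orbit_integral q g) (- (q 0 *\<^sub>R g) - orbit_integral (\<lambda>r. - l * q r) g)"
  proof (rule has_generator_orbit_integral_smooth[where C=l])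
    show "(q has_real_derivative - l * q s) (at s)" for s
      unfolding q_def by (auto intro!: derivative_eq_intros)
    show "\<bar>- l * q s\<bar> \<le> l * exp (- s)" if "0 \<le> s" for s
      using mult_left_mono[OF q0[OF that], of l] l by (simp add: abs_mult)
  qed (use q in auto)
  moreover have "orbit_integral (\<lambda>r. - l * q r) g = - (l *\<^sub>R orbit_integral q g)"
    unfolding orbit_integral_def scaleR_scaleR[symmetric] integral_scaleR_right by simp
  moreover have "has_generator (orbit_integral q g) (orbit_integral q h)"
    by (rule has_generator_orbit_integral[OF iq g])
  ultimately have "orbit_integral q h = l *\<^sub>R orbit_integral q g - g"
  proof -
    assume "has_generator (orbit_integral q g) (- (q 0 *\<^sub>R g) - orbit_integral (\<lambda>r. - l * q r) g)"
      "orbit_integral (\<lambda>r. - l * q r) g = - (l *\<^sub>R orbit_integral q g)"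
      "has_generator (orbit_integral q g) (orbit_integral q h)"
    then have "orbit_integral q h = - (q 0 *\<^sub>R g) - - (l *\<^sub>R orbit_integral q g)"
      using has_generator_imp(2) by metis
    then show ?thesis by (simp add: q_def)
  qed
  then show ?thesis by (simp add: q_def[abs_def])
qed

section \<open>Existence for both problems\<close>

context
  fixes f :: 'b and u :: "real \<Rightarrow> 'b"
  assumes f: "f \<in> generator_domain T"
    and u0: "u 0 = f"
    and u: "\<And>t. 0 < t \<Longrightarrow> u t = orbit_integral (heat t) f"
begin

lemma has_generator_heat_average:
  assumes "0 < t"
  shows "has_generator (u t) (orbit_integral (heat t) (generator T f))"
  unfolding u[OF assms]
  by (rule has_generator_orbit_integral[OF heat_integrable(1)[OF assms] has_generator_generator[OF f]])

lemma second_order_ivp_solution_heat_average: "second_order_ivp_solution T f u"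
  unfolding second_order_ivp_solution_def
proof (intro conjI allI impI)
  show "continuous_on {0..} u" by (rule heat_average_continuous[OF u0 u])
  show "u 0 = f" by (rule u0)
  fix t :: real assume t: "0 < t"
  note g1 = has_generator_imp[OF has_generator_heat_average[OF t]]
  note g2 = has_generator_imp[OF has_generator_orbit_integral_heat[OF t]]
  show "u t \<in> generator_domain T" by (rule g1(1))
  show "generator T (u t) \<in> generator_domain T" unfolding g1(2) by (rule g2(1))
  \<comment> \<open>The boundary term from the second application of the generator cancels the first
    summand; the rest, \<open>- orbit_integral (heat_ds t) (generator T f)\<close>, is the time
    derivative by \<open>orbit_integral_heat_dt\<close>.\<close>
  have "(1 / sqrt (pi * t)) *\<^sub>R generator T f + generator T (generator T (u t)) = orbit_integral (heat_dt t) f"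
    unfolding g1(2) g2(2) orbit_integral_heat_dt[OF t has_generator_generator[OF f]] by simp
  moreover have "(u has_vector_derivative orbit_integral (heat_dt t) f) (at t)"
    by (rule has_vector_derivative_transform_within_open[OF orbit_integral_heat_has_vector_derivative[OF t], of "{0<..}"])
      (use t u in auto)
  ultimately show "(u has_vector_derivative (1 / sqrt (pi * t)) *\<^sub>R generator T f + generator T (generator T (u t))) (at t)"
    by simp
qed

lemma fractional_cauchy_solution_heat_average: "fractional_cauchy_solution (1 / 2) T f u"
  unfolding fractional_cauchy_solution_def has_caputo_derivative_def
proof (intro conjI allI impI)
  show "continuous_on {0..} u" by (rule heat_average_continuous[OF u0 u])
  show "u 0 = f" by (rule u0)
  show "u t \<in> generator_domain T" if "0 < t" for t
    by (rule has_generator_imp(1)[OF has_generator_heat_average[OF that]])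
  have Lu: "generator T (u t) = orbit_integral (heat t) (generator T f)" if "0 < t" for t
    by (rule has_generator_imp(2)[OF has_generator_heat_average[OF that]])
  show "\<forall>\<^sub>F s in at_top. laplace_integrable u s \<and> laplace_integrable (\<lambda>t. generator T (u t)) s \<and>
      laplace (\<lambda>t. generator T (u t)) s = s powr (1 / 2) *\<^sub>R laplace u s - s powr (1 / 2 - 1) *\<^sub>R u 0"
    \<comment> \<open>Then \<open>sqrt s \<ge> 1\<close>, as the resolvent identity demands. Writing
      \<open>R\<close> for the orbit integral of the exponential kernel, the transform of the
      right-hand side is \<open>R (L f) / sqrt s = R f - f / sqrt s\<close>, and \<open>R f\<close>
      is \<open>sqrt s\<close> times the transform of \<open>u\<close>.\<close>
    using eventually_ge_at_top[of 1]
  proof eventually_elim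
    case (elim s)
    then have s: "0 < s" "1 \<le> sqrt s" by auto
    have "s powr - (1 / 2) = 1 / sqrt s"
      using s(1) by (simp add: powr_minus_divide powr_half_sqrt)
    then show ?case
      using laplace_orbit_integral_heat[OF s(1) u] laplace_orbit_integral_heat[OF s(1) Lu]
        orbit_integral_exp_generator[OF s(2) has_generator_generator[OF f]] s
      by (simp add: powr_half_sqrt u0 scaleR_diff_right)
  qed
qed

end

end

section \<open>Uniqueness from a separating family of eigenfunctionals\<close>

text \<open>Abstract form of the Fourier picture: \<open>F k\<close> reads the transform at
  frequency \<open>k\<close>, and \<open>\<phi> t k\<close> is the number by which
  \<open>T t\<close> multiplies it there. Uniqueness thereby becomes a scalar question for each
  \<open>k\<close>.\<close>

locale separated_contraction_semigroup = contraction_semigroup T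
  for T :: "real \<Rightarrow> 'b \<Rightarrow> 'b::{banach, second_countable_topology}" +
  fixes F :: "'k \<Rightarrow> 'b \<Rightarrow> complex" and \<phi> :: "real \<Rightarrow> 'k \<Rightarrow> complex"
  assumes bounded_linear_F: "bounded_linear (F k)"
    and F_T: "0 \<le> t \<Longrightarrow> F k (T t g) = \<phi> t k * F k g"
    and F_separates: "(\<And>k. F k g = 0) \<Longrightarrow> g = 0"
begin

text \<open>The limit exists as soon as \<open>F k\<close> is nonzero at some point of the domain; otherwise the value of
  \<open>symbol k\<close> is irrelevant, since it is only used multiplied by \<open>F k g\<close>.\<close>

definition symbol :: "'k \<Rightarrow> complex" where
  "symbol k = Lim (at_right 0) (\<lambda>t. (\<phi> t k - 1) / of_real t)"

text \<open>If \<open>F k g\<close> is nonzero, dividing by it shows that the difference quotients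
  of \<open>\<phi>\<close> converge. If it is zero, all quotients multiplied by it are 0, and so is
  their limit.\<close>

lemma F_generator:
  assumes "g \<in> generator_domain T"
  shows "F k (generator T g) = symbol k * F k g"
proof -
  interpret F: bounded_linear "F k" by (rule bounded_linear_F)
  have "((\<lambda>t. F k ((T t g - g) /\<^sub>R t)) \<longlongrightarrow> F k (generator T g)) (at_right 0)"
    using has_generator_generator[OF assms] unfolding has_generator_def by (rule F.tendsto)
  moreover have "\<forall>\<^sub>F t in at_right 0. F k ((T t g - g) /\<^sub>R t) = (\<phi> t k - 1) / of_real t * F k g"
    using eventually_at_right_less[of 0]
    by eventually_elim (simp add: F.scaleR F.diff F_T scaleR_conv_of_real field_simps)
  ultimately have lim: "((\<lambda>t. (\<phi> t k - 1) / of_real t * F k g) \<longlongrightarrow> F k (generator T g)) (at_right 0)"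
    by (rule Lim_transform_eventually)
  show ?thesis
  proof (cases "F k g = 0")
    case True
    with lim have "((\<lambda>t. 0) \<longlongrightarrow> F k (generator T g)) (at_right (0::real))" by simp
    then have "F k (generator T g) = 0"
      by (rule tendsto_unique[rotated]) simp_all
    then show ?thesis using True by simp
  next
    case False
    have "((\<lambda>t. (\<phi> t k - 1) / of_real t * F k g / F k g) \<longlongrightarrow> F k (generator T g) / F k g) (at_right 0)"
      using False by (intro tendsto_divide lim tendsto_const)
    then have "((\<lambda>t. (\<phi> t k - 1) / of_real t) \<longlongrightarrow> F k (generator T g) / F k g) (at_right 0)"
      using False by simp
    then have "symbol k = F k (generator T g) / F k g"
      unfolding symbol_def by (intro tendsto_Lim) auto
    then show ?thesis using False by simp
  qed
qed

lemma second_order_ivp_unique: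
  assumes u: "second_order_ivp_solution T f u" and v: "second_order_ivp_solution T f v" and t: "0 \<le> t"
  shows "v t = u t"
proof -
  have "F k (v t - u t) = 0" for k
  proof -
    interpret F: bounded_linear "F k" by (rule bounded_linear_F)
    define c where "c = (symbol k)\<^sup>2"
    \<comment> \<open>The integrating factor makes \<open>w\<close> constant: the inhomogeneity is
      common to both solutions, so their difference obeys a homogeneous scalar equation with
      coefficient \<open>c\<close>.\<close>
    define w where "w r = exp (of_real r * (- c)) * F k (v r - u r)" for r :: real
    have FL: "F k (generator T (generator T (z r))) = c * F k (z r)"
      if "second_order_ivp_solution T f z" "0 < r" for z r
      using that by (simp add: second_order_ivp_solution_def F_generator c_def power2_eq_square)
    have deriv: "(w has_vector_derivative 0) (at r)" if r: "0 < r" for r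
    proof -
      have "((\<lambda>r. v r - u r) has_vector_derivative
          ((1 / sqrt (pi * r)) *\<^sub>R generator T f + generator T (generator T (v r)))
          - ((1 / sqrt (pi * r)) *\<^sub>R generator T f + generator T (generator T (u r)))) (at r)"
        using u v r by (intro has_vector_derivative_diff) (auto simp: second_order_ivp_solution_def)
      from F.has_vector_derivative[OF this]
      have 1: "((\<lambda>r. F k (v r - u r)) has_vector_derivative c * F k (v r - u r)) (at r)"
        using FL[OF u r] FL[OF v r] by (simp add: F.diff F.add right_diff_distrib)
      have "((\<lambda>r. exp (r *\<^sub>R (- c))) has_vector_derivative exp (r *\<^sub>R (- c)) * (- c)) (at r)"
        by (rule exp_scaleR_has_vector_derivative_right)
      from has_vector_derivative_mult[OF this 1] show ?thesis
        by (simp add: w_def[abs_def] scaleR_conv_of_real algebra_simps)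
    qed
    have "continuous_on {0..t} w"
      unfolding w_def using u v
      by (intro continuous_intros F.continuous_on)
        (auto simp: second_order_ivp_solution_def intro: continuous_on_subset)
    moreover have "w 0 = 0"
      using u v by (simp add: w_def second_order_ivp_solution_def F.zero)
    ultimately have "w t = 0"
      \<comment> \<open>The equation holds at positive times only, so 0 is an exceptional point,
        bridged by continuity.\<close>
      by (rule has_derivative_zero_unique_strong_interval[where k="{0}", rotated])
        (use t deriv in \<open>auto simp: has_vector_derivative_def intro: has_derivative_at_withinI\<close>)
    then show ?thesis by (simp add: w_def)
  qed
  then have "v t - u t = 0" by (rule F_separates)
  then show ?thesis by simp
qed

lemma fractional_cauchy_unique:
  assumes u: "fractional_cauchy_solution (1 / 2) T f u" and v: "fractional_cauchy_solution (1 / 2) T f v"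
    and t: "0 \<le> t"
  shows "v t = u t"
proof (cases "t = 0")
  case True
  then show ?thesis using u v by (simp add: fractional_cauchy_solution_def)
next
  case False
  with t have t: "0 < t" by simp
  have "F k (v t - u t) = 0" for k
  proof -
    interpret F: bounded_linear "F k" by (rule bounded_linear_F)
    have F_laplace: "laplace_integrable (\<lambda>t. F k (z t)) s" "laplace (\<lambda>t. F k (z t)) s = F k (laplace z s)"
      if "laplace_integrable z s" for z s
    proof -
      have *: "F k (indicat_real {0<..} t *\<^sub>R exp (- (s * t)) *\<^sub>R z t)
          = indicat_real {0<..} t *\<^sub>R exp (- (s * t)) *\<^sub>R F k (z t)" for t
        by (simp only: F.scaleR)
      show "laplace_integrable (\<lambda>t. F k (z t)) s"
        using integrable_bounded_linear[OF bounded_linear_F that[unfolded laplace_integrable_def set_integrable_def], of k]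
        unfolding laplace_integrable_def set_integrable_def * .
      show "laplace (\<lambda>t. F k (z t)) s = F k (laplace z s)"
        using integral_bounded_linear[OF bounded_linear_F that[unfolded laplace_integrable_def set_integrable_def], of k]
        unfolding laplace_def set_lebesgue_integral_def * .
    qed
    have ev: "\<forall>\<^sub>F s in at_top. laplace_integrable (\<lambda>t. F k (z t)) s \<and>
        symbol k * laplace (\<lambda>t. F k (z t)) s = of_real (s powr (1/2)) * laplace (\<lambda>t. F k (z t)) s
          - of_real (s powr (1/2 - 1)) * F k f"
      if z: "fractional_cauchy_solution (1 / 2) T f z" for z
    proof -
      have "\<forall>\<^sub>F s in at_top. laplace_integrable z s \<and> laplace_integrable (\<lambda>t. generator T (z t)) s \<and>
         laplace (\<lambda>t. generator T (z t)) s = s powr (1 / 2) *\<^sub>R laplace z s - s powr (1 / 2 - 1) *\<^sub>R f"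
        using z unfolding fractional_cauchy_solution_def has_caputo_derivative_def by metis
      then show ?thesis
      proof eventually_elim
        case (elim s)
        have dom: "F k (generator T (z t)) = symbol k * F k (z t)" if "0 < t" for t
          using z that by (intro F_generator) (simp add: fractional_cauchy_solution_def)
        have "F k (laplace (\<lambda>t. generator T (z t)) s) = laplace (\<lambda>t. F k (generator T (z t))) s"
          using F_laplace(2)[of "\<lambda>t. generator T (z t)" s] elim by simp
        \<comment> \<open>Domain membership is known for positive times only, and the Laplace
          integral sees no others.\<close>
        also have "\<dots> = laplace (\<lambda>t. symbol k * F k (z t)) s"
          unfolding laplace_def by (intro set_lebesgue_integral_cong) (auto simp: dom)
        also have "\<dots> = symbol k * laplace (\<lambda>t. F k (z t)) s"
          by (simp add: laplace_def set_lebesgue_integral_def mult_scaleR_right[symmetric] del: mult_scaleR_right)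
        finally show ?case
          using elim F_laplace[of z s] by (simp add: F.diff F.scaleR scaleR_conv_of_real)
      qed
    qed
    have "\<forall>\<^sub>F s in at_top. laplace_integrable (\<lambda>t. F k (v t) - F k (u t)) s \<and>
        laplace (\<lambda>t. F k (v t) - F k (u t)) s = 0"
      \<comment> \<open>Beyond this threshold \<open>sqrt s\<close> exceeds the modulus of
        \<open>symbol k\<close>, so the two differ and the factor can be cancelled. The threshold
        depends on \<open>k\<close>, which is harmless because injectivity is applied separately for
        each \<open>k\<close>.\<close>
      using ev[OF u] ev[OF v] eventually_gt_at_top[of "(norm (symbol k))\<^sup>2"] eventually_ge_at_top[of 0]
    proof eventually_elim
      case (elim s)
      have diff: "laplace_integrable (\<lambda>t. F k (v t) - F k (u t)) s"
        "laplace (\<lambda>t. F k (v t) - F k (u t)) s = laplace (\<lambda>t. F k (v t)) s - laplace (\<lambda>t. F k (u t)) s"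
        using elim set_integral_diff[of lborel "{0<..}" "\<lambda>t. exp (- (s * t)) *\<^sub>R F k (v t)" "\<lambda>t. exp (- (s * t)) *\<^sub>R F k (u t)"]
        by (simp_all add: laplace_integrable_def laplace_def scaleR_diff_right)
      have "norm (symbol k) < sqrt s"
        using elim by (simp add: real_less_rsqrt)
      moreover have "norm (complex_of_real (s powr (1/2))) = sqrt s"
        using elim by (simp add: powr_half_sqrt)
      ultimately have "of_real (s powr (1/2)) \<noteq> symbol k" by (metis less_irrefl)
      moreover have "symbol k * laplace (\<lambda>t. F k (v t) - F k (u t)) s
          = of_real (s powr (1/2)) * laplace (\<lambda>t. F k (v t) - F k (u t)) s"
        using elim by (simp add: diff right_diff_distrib)
      ultimately show ?case using diff(1) by auto
    qed
    moreover have "continuous_on {0<..} (\<lambda>t. F k (v t) - F k (u t))"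
      using u v by (intro continuous_intros F.continuous_on)
        (auto simp: fractional_cauchy_solution_def intro: continuous_on_subset)
    ultimately have "F k (v t) - F k (u t) = 0"
      using laplace_eq_0_imp_eq_0 t by blast
    then show ?thesis by (simp add: F.diff)
  qed
  then have "v t - u t = 0" by (rule F_separates)
  then show ?thesis by simp
qed

end

section \<open>The semigroup of a Levy process\<close>

lemma
  fixes f :: "'a::euclidean_space \<Rightarrow> 'b::{banach, second_countable_topology}"
  shows lborel_integrable_translate: "integrable lborel f \<Longrightarrow> integrable lborel (\<lambda>x. f (x + y))"
    and lborel_integral_translate: "(LINT x|lborel. f (x + y)) = (LINT x|lborel. f x)"
proof -
  have *: "distr lborel borel (\<lambda>x. x + y) = lborel" for y :: 'a
  proof -
    have "(\<lambda>x. x + y) = (+) y" by (auto simp: add.commute)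
    then show ?thesis by (simp add: lborel_distr_plus)
  qed
  have "integrable lborel (\<lambda>x. f (x + y))" if f: "integrable lborel f" for f :: "'a \<Rightarrow> 'b"
  proof -
    have "integrable (distr lborel borel (\<lambda>x. x + y)) f" using f by (simp add: *)
    then show ?thesis using f by (subst (asm) integrable_distr_eq) auto
  qed
  note int = this
  show "integrable lborel f \<Longrightarrow> integrable lborel (\<lambda>x. f (x + y))" by (rule int)
  show "(LINT x|lborel. f (x + y)) = (LINT x|lborel. f x)"
  proof (cases "integrable lborel f")
    case True
    have "(LINT x|distr lborel borel (\<lambda>x. x + y). f x) = (LINT x|lborel. f (x + y))"
      using True by (intro integral_distr) auto
    then show ?thesis by (simp add: *)
  next
    \<comment> \<open>Both integrals are then 0 by convention, provided the translate is not
      integrable either.\<close>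
    case False
    have "\<not> integrable lborel (\<lambda>x. f (x + y))"
    proof
      assume i: "integrable lborel (\<lambda>x. f (x + y))"
      have **: "distr lborel borel (\<lambda>x. x - y) = lborel"
        using *[of "- y"] by simp
      have "integrable (distr lborel borel (\<lambda>x. x - y)) (\<lambda>x. f (x + y))" using i by (simp add: **)
      then have "integrable lborel f" using i by (subst (asm) integrable_distr_eq) auto
      with False show False by simp
    qed
    then show ?thesis using False by (simp add: not_integrable_integral_eq)
  qed
qed

text \<open>The claim is direct for indicators of open sets of finite measure, passes to Borel sets
  by outer regularity, and then to all integrable functions because it survives sums and L1
  approximation.\<close>

lemma tendsto_L1_translate:
  fixes f :: "'a::euclidean_space \<Rightarrow> 'b::{banach, second_countable_topology}"
  assumes "integrable lborel f"
  shows "((\<lambda>y. LINT x|lborel. norm (f (x + y) - f x)) \<longlongrightarrow> 0) (at 0)"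
proof -
  define D where "D f y = (LINT x|lborel. norm (f (x + y) - f x))" for f :: "'a \<Rightarrow> 'b" and y
  have D_nonneg: "0 \<le> D f y" for f y by (simp add: D_def)
  \<comment> \<open>An argument with thirds of \<open>e\<close>: by translation invariance the
    shifted approximation error equals the unshifted one.\<close>
  have approx: "(D f \<longlongrightarrow> 0) (at 0)" if f: "integrable lborel f"
    and g: "\<And>e. 0 < e \<Longrightarrow> \<exists>g. integrable lborel g \<and> (D g \<longlongrightarrow> 0) (at 0) \<and> (LINT x|lborel. norm (f x - g x)) < e" for f
  proof (rule tendstoI)
    fix e :: real assume e: "0 < e"
    obtain g where g: "integrable lborel g" "(D g \<longlongrightarrow> 0) (at 0)" "(LINT x|lborel. norm (f x - g x)) < e / 3"
      using g[of "e / 3"] e by auto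
    have "\<forall>\<^sub>F y in at 0. D g y < e / 3" using g(2) e by (intro order_tendstoD(2)) auto
    then show "\<forall>\<^sub>F y in at 0. dist (D f y) 0 < e"
    proof eventually_elim
      case (elim y)
      have fg: "integrable lborel (\<lambda>x. norm (f x - g x))" using f g by simp
      have "D f y \<le> (LINT x|lborel. norm (f (x + y) - g (x + y)) + norm (f x - g x) + norm (g (x + y) - g x))"
        unfolding D_def
      proof (rule integral_mono)
        show "norm (f (x + y) - f x) \<le> norm (f (x + y) - g (x + y)) + norm (f x - g x) + norm (g (x + y) - g x)" for x
        proof -
          have "f (x + y) - f x = (f (x + y) - g (x + y)) + (- (f x - g x)) + (g (x + y) - g x)" by simp
          also have "norm \<dots> \<le> norm ((f (x + y) - g (x + y)) + (- (f x - g x))) + norm (g (x + y) - g x)"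
            by (rule norm_triangle_ineq)
          also have "\<dots> \<le> norm (f (x + y) - g (x + y)) + norm (- (f x - g x)) + norm (g (x + y) - g x)"
            by (intro add_right_mono norm_triangle_ineq)
          finally show ?thesis by (simp only: norm_minus_cancel)
        qed
      qed (use f g lborel_integrable_translate[of f y] lborel_integrable_translate[of g y] in auto)
      also have "\<dots> = (LINT x|lborel. norm (f (x + y) - g (x + y))) + (LINT x|lborel. norm (f x - g x)) + D g y"
        unfolding D_def using f g lborel_integrable_translate[of f y] lborel_integrable_translate[of g y]
        by simp
      also have "(LINT x|lborel. norm (f (x + y) - g (x + y))) = (LINT x|lborel. norm (f x - g x))"
        by (rule lborel_integral_translate)
      finally show ?case using g(3) elim D_nonneg[of f y] by simp
    qed
  qed
  \<comment> \<open>The symmetric difference of \<open>U\<close> and its translate is expressed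
    through their overlap. For the overlap only points of \<open>U\<close> matter, and there
    openness gives pointwise convergence; nothing has to be known about the boundary.\<close>
  have openD: "(D (\<lambda>x. indicat_real U x *\<^sub>R c) \<longlongrightarrow> 0) (at 0)"
    if U: "open U" "emeasure lborel U < \<infinity>" for U :: "'a set" and c
  proof -
    have iU: "integrable lborel (indicat_real U)" using U by (intro integrable_real_indicator) auto
    note iUy = lborel_integrable_translate[OF iU]
    have [measurable]: "U \<in> sets borel" using U by simp
    have iUU: "integrable lborel (\<lambda>x. indicat_real U x * indicat_real U (x + y))" for y
      by (rule Bochner_Integration.integrable_bound[OF iU]) (auto simp: indicator_def)
    have eq: "D (\<lambda>x. indicat_real U x *\<^sub>R c) y = (2 * (LINT x|lborel. indicat_real U x)
        - 2 * (LINT x|lborel. indicat_real U x * indicat_real U (x + y))) * norm c" for y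
    proof -
      have "D (\<lambda>x. indicat_real U x *\<^sub>R c) y
          = (LINT x|lborel. (indicat_real U (x + y) + indicat_real U x - 2 * (indicat_real U x * indicat_real U (x + y))) * norm c)"
        unfolding D_def by (intro Bochner_Integration.integral_cong) (auto simp: indicator_def)
      also have "\<dots> = (LINT x|lborel. indicat_real U (x + y) + indicat_real U x - 2 * (indicat_real U x * indicat_real U (x + y))) * norm c"
        by (rule integral_mult_left_zero)
      also have "(LINT x|lborel. indicat_real U (x + y) + indicat_real U x - 2 * (indicat_real U x * indicat_real U (x + y)))
          = (LINT x|lborel. indicat_real U (x + y)) + (LINT x|lborel. indicat_real U x)
            - 2 * (LINT x|lborel. indicat_real U x * indicat_real U (x + y))"
        using iU iUy[of y] iUU[of y] by simp
      also have "(LINT x|lborel. indicat_real U (x + y)) = (LINT x|lborel. indicat_real U x)"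
        by (rule lborel_integral_translate)
      finally show ?thesis by simp
    qed
    have "((\<lambda>y. LINT x|lborel. indicat_real U x * indicat_real U (x + y)) \<longlongrightarrow> (LINT x|lborel. indicat_real U x)) (at 0)"
    proof (rule integral_dominated_convergence_at[OF _ _ iU])
      show "AE x in lborel. ((\<lambda>y. indicat_real U x * indicat_real U (x + y)) \<longlongrightarrow> indicat_real U x) (at 0)"
      proof (rule AE_I2)
        fix x
        show "((\<lambda>y. indicat_real U x * indicat_real U (x + y)) \<longlongrightarrow> indicat_real U x) (at 0)"
        proof (cases "x \<in> U")
          case True
          have "((\<lambda>y. x + y) \<longlongrightarrow> x) (at 0)" by (intro tendsto_eq_intros) auto
          then have "\<forall>\<^sub>F y in at 0. x + y \<in> U" using U(1) True by (rule topological_tendstoD)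
          then have "\<forall>\<^sub>F y in at 0. indicat_real U x * indicat_real U (x + y) = indicat_real U x"
            by eventually_elim (use True in simp)
          then show ?thesis by (rule tendsto_eventually)
        qed simp
      qed
      show "\<forall>\<^sub>F y in at 0. AE x in lborel. norm (indicat_real U x * indicat_real U (x + y)) \<le> indicat_real U x"
        by (auto intro!: always_eventually simp: indicator_def)
    qed (use iUU in \<open>auto intro: always_eventually\<close>)
    then have "((\<lambda>y. (2 * (LINT x|lborel. indicat_real U x)
        - 2 * (LINT x|lborel. indicat_real U x * indicat_real U (x + y))) * norm c) \<longlongrightarrow>
      (2 * (LINT x|lborel. indicat_real U x) - 2 * (LINT x|lborel. indicat_real U x)) * norm c) (at 0)"
      by (intro tendsto_intros)
    then show ?thesis by (simp add: eq[abs_def])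
  qed
  have "(D f \<longlongrightarrow> 0) (at 0)"
    using assms
  proof (induction rule: integrable_induct)
    case (base A c)
    have [measurable]: "A \<in> sets borel" using base by simp
    have iA: "integrable lborel (indicat_real A)" using base by (intro integrable_real_indicator) auto
    show ?case
    proof (rule approx)
      show "integrable lborel (\<lambda>x. indicat_real A x *\<^sub>R c)" using iA by simp
      fix e :: real assume e: "0 < e"
      define e' where "e' = e / (norm c + 1)"
      have nc: "0 < norm c + 1" using norm_ge_zero[of c] by linarith
      have e': "0 < e'" using e nc by (simp add: e'_def)
      obtain U where U: "open U" "A \<subseteq> U" "emeasure lborel (U - A) < ennreal e'"
        using outer_regular_lborel[OF _ e', of A] by auto
      have [measurable]: "U \<in> sets borel" using U by simp
      have "emeasure lborel U = emeasure lborel A + emeasure lborel (U - A)"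
        using U by (subst plus_emeasure) (auto intro!: arg_cong[where f="emeasure lborel"])
      also have "\<dots> < \<infinity>" using base U(3) by (auto simp: less_top[symmetric] ennreal_add_eq_top)
      finally have Ufin: "emeasure lborel U < \<infinity>" .
      have "(LINT x|lborel. norm (indicat_real A x *\<^sub>R c - indicat_real U x *\<^sub>R c))
          = (LINT x|lborel. indicat_real (U - A) x * norm c)"
        using U(2) by (intro Bochner_Integration.integral_cong) (auto simp: indicator_def)
      also have "\<dots> = measure lborel (U - A) * norm c" by simp
      also have "\<dots> \<le> e' * norm c"
      proof (intro mult_right_mono)
        have "ennreal (measure lborel (U - A)) < ennreal e'"
          using U(3) by (subst emeasure_eq_ennreal_measure[symmetric]) auto
        then show "measure lborel (U - A) \<le> e'" using e' by (simp add: ennreal_less_iff)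
      qed simp
      also have "\<dots> < e" using e nc by (simp add: e'_def field_simps)
      finally have "(LINT x|lborel. norm (indicat_real A x *\<^sub>R c - indicat_real U x *\<^sub>R c)) < e" .
      moreover have "integrable lborel (\<lambda>x. indicat_real U x *\<^sub>R c)"
        using Ufin by (intro integrable_scaleR_left integrable_real_indicator) auto
      ultimately show "\<exists>g. integrable lborel g \<and> (D g \<longlongrightarrow> 0) (at 0) \<and>
          (LINT x|lborel. norm (indicat_real A x *\<^sub>R c - g x)) < e"
        using openD[OF U(1) Ufin] by blast
    qed
  next
    case (add f g)
    have "((\<lambda>y. D f y + D g y) \<longlongrightarrow> 0) (at 0)"
      using tendsto_add[OF add.IH] by simp
    then show ?case
    proof (rule Lim_null_comparison[rotated], intro always_eventually allI)
      fix y
      have "D (\<lambda>x. f x + g x) y \<le> (LINT x|lborel. norm (f (x + y) - f x) + norm (g (x + y) - g x))"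
        unfolding D_def
      proof (rule integral_mono)
        show "norm (f (x + y) + g (x + y) - (f x + g x)) \<le> norm (f (x + y) - f x) + norm (g (x + y) - g x)" for x
          by (metis add_diff_add norm_triangle_ineq)
      qed (use add lborel_integrable_translate[of f y] lborel_integrable_translate[of g y] in auto)
      also have "\<dots> = D f y + D g y"
        unfolding D_def using add lborel_integrable_translate[of f y] lborel_integrable_translate[of g y] by simp
      finally show "norm (D (\<lambda>x. f x + g x) y) \<le> D f y + D g y" using D_nonneg by simp
    qed
  next
    case (lim f s)
    show ?case
    proof (rule approx)
      show "integrable lborel f" by fact
      fix e :: real assume e: "0 < e"
      have "(\<lambda>i. LINT x|lborel. norm (f x - s i x)) \<longlonglongrightarrow> (LINT (x::'a)|lborel. (0::real))"
      proof (rule integral_dominated_convergence)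
        show "integrable lborel (\<lambda>x. 3 * norm (f x))" using lim by simp
        show "AE x in lborel. (\<lambda>i. norm (f x - s i x)) \<longlonglongrightarrow> 0"
        proof (intro AE_I2)
          fix x
          have "(\<lambda>i. s i x) \<longlonglongrightarrow> f x" using lim by simp
          then have "(\<lambda>i. norm (f x - s i x)) \<longlonglongrightarrow> norm (f x - f x)" by (intro tendsto_intros)
          then show "(\<lambda>i. norm (f x - s i x)) \<longlonglongrightarrow> 0" by simp
        qed
        show "AE x in lborel. norm (norm (f x - s i x)) \<le> 3 * norm (f x)" for i
        proof (intro AE_I2)
          fix x
          have "norm (f x - s i x) \<le> norm (f x) + norm (s i x)" by (rule norm_triangle_ineq4)
          also have "norm (s i x) \<le> 2 * norm (f x)" using lim by simp
          finally show "norm (norm (f x - s i x)) \<le> 3 * norm (f x)" by simp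
        qed
      qed (use lim in auto)
      then have "\<forall>\<^sub>F i in sequentially. (LINT x|lborel. norm (f x - s i x)) < e"
        by (intro order_tendstoD(2)) (use e in auto)
      then obtain i where "(LINT x|lborel. norm (f x - s i x)) < e"
        by (auto simp: eventually_sequentially)
      then show "\<exists>g. integrable lborel g \<and> (D g \<longlongrightarrow> 0) (at 0) \<and> (LINT x|lborel. norm (f x - g x)) < e"
        using lim by blast
    qed
  qed
  then show ?thesis by (simp add: D_def[abs_def])
qed

section \<open>The Fourier transform on classes of integrable functions\<close>

definition fourier :: "'a::euclidean_space \<Rightarrow> 'a L1 \<Rightarrow> complex" where
  "fourier k g = (LINT x|lborel. cis (- (k \<bullet> x)) * rep_L1 g x)"

lemma AE_rep_abs_L1:
  assumes "integrable lborel h"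
  shows "AE x in lborel. rep_L1 (abs_L1 h) x = h x"
proof -
  have "L1_rel h h" using assms by (simp add: L1_rel_def)
  then have "L1_rel (rep_L1 (abs_L1 h)) h" by (rule Quotient_rep_abs[OF Quotient_L1])
  then show ?thesis by (simp add: L1_rel_def)
qed

text \<open>\<open>fourier\<close> reads a chosen representative; any other differs from it on a
  null set, which the integral ignores.\<close>

lemma fourier_abs_L1:
  assumes h: "integrable lborel h"
  shows "fourier k (abs_L1 h) = (LINT x|lborel. cis (- (k \<bullet> x)) * h x)"
  unfolding fourier_def
proof (rule integral_cong_AE)
  show "AE x in lborel. cis (- (k \<bullet> x)) * rep_L1 (abs_L1 h) x = cis (- (k \<bullet> x)) * h x"
    using AE_rep_abs_L1[OF h] by eventually_elim simp
  show "(\<lambda>x. cis (- (k \<bullet> x)) * rep_L1 (abs_L1 h) x) \<in> borel_measurable lborel"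
    "(\<lambda>x. cis (- (k \<bullet> x)) * h x) \<in> borel_measurable lborel"
    using borel_measurable_integrable[OF integrable_cis_mult[OF integrable_rep_L1], of "\<lambda>x. - (k \<bullet> x)" "abs_L1 h"]
      borel_measurable_integrable[OF integrable_cis_mult[OF h], of "\<lambda>x. - (k \<bullet> x)"] by simp_all
qed

lemma bounded_linear_fourier: "bounded_linear (fourier k)"
proof (rule bounded_linear_intro[where K=1])
  fix g h :: "'a L1" and c :: real
  define a where "a = rep_L1 g"
  define b where "b = rep_L1 h"
  have ab: "integrable lborel a" "integrable lborel b" "g = abs_L1 a" "h = abs_L1 b"
    by (simp_all add: a_def b_def)
  have rel: "L1_rel a a" "L1_rel b b" using ab by (simp_all add: L1_rel_def)
  have "fourier k (g + h) = (LINT x|lborel. cis (- (k \<bullet> x)) * (a x + b x))"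
    unfolding ab(3,4) plus_L1.abs_eq[OF rel] using ab by (intro fourier_abs_L1) simp
  also have "\<dots> = fourier k g + fourier k h"
    unfolding ab(3,4) fourier_abs_L1[OF ab(1)] fourier_abs_L1[OF ab(2)] distrib_left
    using ab by (intro Bochner_Integration.integral_add integrable_cis_mult) auto
  finally show "fourier k (g + h) = fourier k g + fourier k h" .
  have "fourier k (c *\<^sub>R g) = (LINT x|lborel. cis (- (k \<bullet> x)) * (c *\<^sub>R a x))"
    unfolding ab(3) scaleR_L1.abs_eq[OF rel(1)] using ab by (intro fourier_abs_L1) simp
  also have "\<dots> = c *\<^sub>R fourier k g"
    unfolding ab(3) fourier_abs_L1[OF ab(1)] mult_scaleR_right by (rule integral_scaleR_right)
  finally show "fourier k (c *\<^sub>R g) = c *\<^sub>R fourier k g" .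
  have "norm (fourier k g) \<le> (LINT x|lborel. norm (cis (- (k \<bullet> x)) * a x))"
    unfolding ab(3) fourier_abs_L1[OF ab(1)] by (rule integral_norm_bound)
  also have "\<dots> = norm g"
    unfolding ab(3) norm_L1.abs_eq[OF rel(1)] by (simp add: norm_mult)
  finally show "norm (fourier k g) \<le> norm g * 1" by simp
qed

lemma fourier_injective:
  assumes "\<And>k. fourier k g = 0"
  shows "g = 0"
proof -
  have "AE x in lborel. rep_L1 g x = 0"
    using assms by (intro fourier_eq_0_imp_AE_eq_0) (simp_all add: fourier_def)
  then have "L1_rel (rep_L1 g) (\<lambda>_. 0)" by (simp add: L1_rel_def)
  then have "abs_L1 (rep_L1 g) = abs_L1 (\<lambda>_. 0)" by (rule Quotient_rel_abs[OF Quotient_L1])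
  then show ?thesis by (simp add: zero_L1_def)
qed

text \<open>The algebraic laws of the semigroup are verified on transforms, where they become
  identities between numbers. This avoids tracking null sets through the representative inside
  \<open>levy_semigroup\<close>.\<close>

lemma fourier_eqI:
  assumes "\<And>k. fourier k g = fourier k h"
  shows "g = h"
proof -
  have "fourier k (g - h) = 0" for k
    using assms by (simp add: linear_diff[OF bounded_linear.linear[OF bounded_linear_fourier]])
  then have "g - h = 0" by (rule fourier_injective)
  then show ?thesis by simp
qed

section \<open>From the process to a strongly continuous contraction semigroup\<close>

context levy_process
begin

definition characteristic :: "real \<Rightarrow> 'a \<Rightarrow> complex" where
  "characteristic t k = (LINT \<omega>|M. cis (k \<bullet> X t \<omega>))"

lemma pair_sigma_finite_lborel: "pair_sigma_finite M (lborel :: 'a measure)"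
  by (intro pair_sigma_finite.intro) unfold_locales

lemma
  fixes f :: "'a \<Rightarrow> 'b::{banach, second_countable_topology}"
  assumes f: "integrable lborel f" and t: "0 \<le> t"
  shows integrable_pair_shift: "integrable (M \<Otimes>\<^sub>M lborel) (\<lambda>(\<omega>, x). f (x + X t \<omega>))"
    and integrable_expectation_shift: "integrable lborel (\<lambda>x. LINT \<omega>|M. f (x + X t \<omega>))"
proof -
  interpret P: pair_sigma_finite M "lborel :: 'a measure" by (rule pair_sigma_finite_lborel)
  have [measurable]: "X t \<in> borel_measurable M" using t by (rule measurable_process)
  have [measurable]: "f \<in> borel_measurable borel" using f by simp
  show *: "integrable (M \<Otimes>\<^sub>M lborel) (\<lambda>(\<omega>, x). f (x + X t \<omega>))"
  proof (rule P.Fubini_integrable)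
    show "(\<lambda>(\<omega>, x). f (x + X t \<omega>)) \<in> borel_measurable (M \<Otimes>\<^sub>M lborel)" by measurable
    show "integrable M (\<lambda>\<omega>. LINT x|lborel. norm (case (\<omega>, x) of (\<omega>, x) \<Rightarrow> f (x + X t \<omega>)))"
      using lborel_integral_translate[of "\<lambda>x. norm (f x)"] by simp
    show "AE \<omega> in M. integrable lborel (\<lambda>x. case (\<omega>, x) of (\<omega>, x) \<Rightarrow> f (x + X t \<omega>))"
      using lborel_integrable_translate[OF f] by simp
  qed
  show "integrable lborel (\<lambda>x. LINT \<omega>|M. f (x + X t \<omega>))"
    using P.integrable_snd[OF *] .
qed

lemma AE_integrable_shift:
  fixes f :: "'a \<Rightarrow> 'b::{banach, second_countable_topology}"
  assumes "integrable lborel f" "0 \<le> t"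
  shows "AE x in lborel. integrable M (\<lambda>\<omega>. f (x + X t \<omega>))"
proof -
  interpret P: pair_sigma_finite M "lborel :: 'a measure" by (rule pair_sigma_finite_lborel)
  show ?thesis using P.AE_integrable_snd[OF integrable_pair_shift[OF assms]] .
qed

text \<open>Fubini brings the spatial integral inside the expectation, and translating by
  \<open>X t \<omega>\<close> there leaves the phase \<open>cis (k \<bullet> X t \<omega>)\<close>.
  Hence the sign in \<open>characteristic\<close> is opposite to that in
  \<open>fourier\<close>.\<close>

lemma fourier_levy_semigroup:
  assumes t: "0 \<le> t"
  shows "fourier k (levy_semigroup M X t g) = characteristic t k * fourier k g"
proof -
  interpret P: pair_sigma_finite M "lborel :: 'a measure" by (rule pair_sigma_finite_lborel)
  have [measurable]: "X t \<in> borel_measurable M" using t by (rule measurable_process)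
  define f where "f = rep_L1 g"
  have f: "integrable lborel f" by (simp add: f_def)
  define h where "h x = cis (- (k \<bullet> x)) * f x" for x
  have "(\<lambda>p. - (k \<bullet> snd p)) \<in> borel_measurable (M \<Otimes>\<^sub>M (lborel :: 'a measure))" by measurable
  from integrable_cis_mult[OF integrable_pair_shift[OF f t] this]
  have int: "integrable (M \<Otimes>\<^sub>M lborel) (\<lambda>(\<omega>, x). cis (- (k \<bullet> x)) * f (x + X t \<omega>))"
    by (simp add: case_prod_unfold)
  have "fourier k (levy_semigroup M X t g) = (LINT x|lborel. cis (- (k \<bullet> x)) * (LINT \<omega>|M. f (x + X t \<omega>)))"
    unfolding levy_semigroup_def f_def[symmetric]
    by (rule fourier_abs_L1[OF integrable_expectation_shift[OF f t]])
  also have "\<dots> = (LINT x|lborel. LINT \<omega>|M. cis (- (k \<bullet> x)) * f (x + X t \<omega>))"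
    by simp
  also have "\<dots> = (LINT \<omega>|M. LINT x|lborel. cis (- (k \<bullet> x)) * f (x + X t \<omega>))"
    by (rule P.Fubini_integral[OF int])
  also have "\<dots> = (LINT \<omega>|M. cis (k \<bullet> X t \<omega>) * fourier k g)"
  proof (intro Bochner_Integration.integral_cong refl)
    fix \<omega>
    have "cis (- (k \<bullet> x)) * f (x + X t \<omega>) = cis (k \<bullet> X t \<omega>) * h (x + X t \<omega>)" for x
      by (simp add: h_def mult.assoc[symmetric] cis_mult inner_add_right)
    then have "(LINT x|lborel. cis (- (k \<bullet> x)) * f (x + X t \<omega>)) = cis (k \<bullet> X t \<omega>) * (LINT x|lborel. h (x + X t \<omega>))"
      by simp
    also have "(LINT x|lborel. h (x + X t \<omega>)) = (LINT x|lborel. h x)"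
      by (rule lborel_integral_translate)
    also have "\<dots> = fourier k g" by (simp add: fourier_def h_def f_def)
    finally show "(LINT x|lborel. cis (- (k \<bullet> x)) * f (x + X t \<omega>)) = cis (k \<bullet> X t \<omega>) * fourier k g" .
  qed
  also have "\<dots> = characteristic t k * fourier k g"
    unfolding characteristic_def by (rule integral_mult_left_zero)
  finally show ?thesis .
qed

lemma characteristic_0: "characteristic 0 k = 1"
proof -
  have "AE \<omega> in M. cis (k \<bullet> X 0 \<omega>) = 1"
    using start_at_zero by eventually_elim simp
  then have "characteristic 0 k = (LINT \<omega>|M. 1)"
    unfolding characteristic_def
    by (intro integral_cong_AE integrable_cis_mult[of M "\<lambda>_. 1", simplified, THEN borel_measurable_integrable])
      (use measurable_process[of 0] in auto)
  then show ?thesis by (simp add: prob_space)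
qed

text \<open>\<open>X (s + t)\<close> is almost surely the sum of the increments over [0, s] and
  [s, s + t]. Independence factors the expectation, and stationarity gives the second factor the law
  of \<open>X t\<close>.\<close>

lemma characteristic_add:
  assumes s: "0 \<le> s" and t: "0 \<le> t"
  shows "characteristic (s + t) k = characteristic s k * characteristic t k"
proof -
  have [measurable]: "X 0 \<in> borel_measurable M" "X s \<in> borel_measurable M" "X (s + t) \<in> borel_measurable M"
      "X t \<in> borel_measurable M"
    using s t by (auto intro: measurable_process)
  have cis_measurable[measurable]: "cis \<in> borel_measurable borel"
    by (intro borel_measurable_continuous_onI continuous_intros)
  \<comment> \<open>The grid 0, s, s + t, kept constant afterwards so that it is an increasing
    sequence.\<close>
  define \<tau> where "\<tau> i = (if i = 0 then 0 else if i = 1 then s else s + t)" for i :: nat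
  define Y where "Y i \<omega> = X (\<tau> (Suc i)) \<omega> - X (\<tau> i) \<omega>" for i \<omega>
  have Y: "Y 0 \<omega> = X s \<omega> - X 0 \<omega>" "Y 1 \<omega> = X (s + t) \<omega> - X s \<omega>" for \<omega>
    by (simp_all add: Y_def \<tau>_def)
  have "indep_vars (\<lambda>_. borel) Y {..<2}"
    unfolding Y_def using s t by (intro independent_increments) (auto simp: \<tau>_def incseq_def)
  then have ind: "indep_vars (\<lambda>_. borel) (\<lambda>i \<omega>. cis (k \<bullet> Y i \<omega>)) {..<2}"
    by (rule indep_vars_compose2[where Y="\<lambda>_ y. cis (k \<bullet> y)"]) measurable
  have meas: "Y i \<in> borel_measurable M" if "i < 2" for i
  proof -
    have "Y 0 = (\<lambda>\<omega>. X s \<omega> - X 0 \<omega>)" "Y 1 = (\<lambda>\<omega>. X (s + t) \<omega> - X s \<omega>)" using Y by auto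
    moreover have "i = 0 \<or> i = 1" using that by linarith
    ultimately show ?thesis by (elim disjE) simp_all
  qed
  have int: "integrable M (\<lambda>\<omega>. cis (k \<bullet> Y i \<omega>))" if "i \<in> {..<2}" for i
    using integrable_cis_mult[of M "\<lambda>_. 1" "\<lambda>\<omega>. k \<bullet> Y i \<omega>"] meas[of i] that by simp
  have "(LINT \<omega>|M. (\<Prod>i<2. cis (k \<bullet> Y i \<omega>))) = (\<Prod>i<2. LINT \<omega>|M. cis (k \<bullet> Y i \<omega>))"
    by (rule indep_vars_lebesgue_integral[OF _ ind int]) auto
  then have "(LINT \<omega>|M. cis (k \<bullet> Y 0 \<omega>) * cis (k \<bullet> Y 1 \<omega>))
      = (LINT \<omega>|M. cis (k \<bullet> Y 0 \<omega>)) * (LINT \<omega>|M. cis (k \<bullet> Y 1 \<omega>))"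
    by (simp add: numeral_2_eq_2)
  moreover have "(LINT \<omega>|M. cis (k \<bullet> Y 0 \<omega>)) = characteristic s k"
    unfolding characteristic_def Y
    by (rule integral_cong_AE) (use start_at_zero in \<open>auto elim: eventually_mono\<close>)
  moreover have "(LINT \<omega>|M. cis (k \<bullet> Y 1 \<omega>)) = characteristic t k"
  proof -
    have "(LINT \<omega>|M. cis (k \<bullet> Y 1 \<omega>)) = (LINT y|distr M borel (\<lambda>\<omega>. X (s + t) \<omega> - X s \<omega>). cis (k \<bullet> y))"
      unfolding Y by (subst integral_distr) auto
    also have "distr M borel (\<lambda>\<omega>. X (s + t) \<omega> - X s \<omega>) = distr M borel (X t)"
      using stationary_increments[of s "s + t"] s t by simp
    also have "(LINT y|distr M borel (X t). cis (k \<bullet> y)) = characteristic t k"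
      unfolding characteristic_def by (subst integral_distr) auto
    finally show ?thesis .
  qed
  moreover have "(LINT \<omega>|M. cis (k \<bullet> Y 0 \<omega>) * cis (k \<bullet> Y 1 \<omega>)) = characteristic (s + t) k"
  proof -
    have "AE \<omega> in M. cis (k \<bullet> Y 0 \<omega>) * cis (k \<bullet> Y 1 \<omega>) = cis (k \<bullet> X (s + t) \<omega>)"
      unfolding Y using start_at_zero by eventually_elim (simp add: cis_mult inner_diff_right)
    then show ?thesis
      unfolding characteristic_def Y by (intro integral_cong_AE) auto
  qed
  ultimately show ?thesis by simp
qed

text \<open>After the norm is taken inside the expectation, Fubini and translation invariance make
  the inner integral the same for every \<open>\<omega>\<close>.\<close>

lemma levy_semigroup_contraction:
  assumes t: "0 \<le> t"
  shows "norm (levy_semigroup M X t g) \<le> norm g"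
proof -
  interpret P: pair_sigma_finite M "lborel :: 'a measure" by (rule pair_sigma_finite_lborel)
  define f where "f = rep_L1 g"
  have f: "integrable lborel f" and nf: "integrable lborel (\<lambda>x. norm (f x))" by (simp_all add: f_def)
  have h: "integrable lborel (\<lambda>x. LINT \<omega>|M. f (x + X t \<omega>))"
    by (rule integrable_expectation_shift[OF f t])
  have "norm (levy_semigroup M X t g) = (LINT x|lborel. norm (LINT \<omega>|M. f (x + X t \<omega>)))"
    unfolding levy_semigroup_def f_def[symmetric] using h by (simp add: norm_L1.abs_eq L1_rel_def)
  also have "\<dots> \<le> (LINT x|lborel. LINT \<omega>|M. norm (f (x + X t \<omega>)))"
    using h integrable_expectation_shift[OF nf t] by (intro integral_mono integral_norm_bound) auto
  also have "\<dots> = (LINT \<omega>|M. LINT x|lborel. norm (f (x + X t \<omega>)))"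
    by (rule P.Fubini_integral[OF integrable_pair_shift[OF nf t]])
  also have "\<dots> = (LINT x|lborel. norm (f x))"
    using lborel_integral_translate[of "\<lambda>x. norm (f x)"] by (simp add: prob_space)
  also have "\<dots> = norm g"
    using norm_L1.abs_eq[of f] f by (simp add: f_def L1_rel_def)
  finally show ?thesis .
qed

lemma levy_semigroup_linear:
  assumes "0 \<le> t"
  shows "linear (levy_semigroup M X t)"
proof (rule linearI)
  show "levy_semigroup M X t (g + h) = levy_semigroup M X t g + levy_semigroup M X t h" for g h
    by (rule fourier_eqI)
      (simp add: fourier_levy_semigroup[OF assms] linear_add[OF bounded_linear.linear[OF bounded_linear_fourier]] distrib_left)
  show "levy_semigroup M X t (c *\<^sub>R g) = c *\<^sub>R levy_semigroup M X t g" for c g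
    by (rule fourier_eqI)
      (simp add: fourier_levy_semigroup[OF assms] linear_scale[OF bounded_linear.linear[OF bounded_linear_fourier]])
qed

lemma levy_semigroup_0: "levy_semigroup M X 0 g = g"
  by (rule fourier_eqI) (simp add: fourier_levy_semigroup characteristic_0)

lemma levy_semigroup_add:
  "0 \<le> s \<Longrightarrow> 0 \<le> t \<Longrightarrow> levy_semigroup M X (s + t) g = levy_semigroup M X s (levy_semigroup M X t g)"
  by (rule fourier_eqI) (simp add: fourier_levy_semigroup characteristic_add)

text \<open>The norm is at most the expectation of \<open>D (X t \<omega>)\<close>, where
  \<open>D y\<close> is the L1 distance between \<open>f\<close> and its translate by
  \<open>y\<close>. \<open>D\<close> is small near 0 and at most \<open>2 * N\<close> everywhere,
  and stochastic continuity makes displacements away from 0 improbable.\<close>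

lemma levy_semigroup_tendsto_0:
  "((\<lambda>t. norm (levy_semigroup M X t g - g)) \<longlongrightarrow> 0) (at 0 within {0..})"
proof (rule tendstoI)
  interpret P: pair_sigma_finite M "lborel :: 'a measure" by (rule pair_sigma_finite_lborel)
  fix e :: real assume e: "0 < e"
  define f where "f = rep_L1 g"
  have f: "integrable lborel f" by (simp add: f_def)
  define D where "D y = (LINT x|lborel. norm (f (x + y) - f x))" for y
  define N where "N = (LINT x|lborel. norm (f x))"
  have N: "0 \<le> N" by (simp add: N_def)
  have "(D \<longlongrightarrow> 0) (at 0)" unfolding D_def by (rule tendsto_L1_translate[OF f])
  then have "\<forall>\<^sub>F y in at 0. D y < e / 2" using e by (intro order_tendstoD(2)) auto
  then obtain d where d: "0 < d" "\<And>y. y \<noteq> 0 \<Longrightarrow> dist y 0 < d \<Longrightarrow> D y < e / 2"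
    by (auto simp: eventually_at)
  have D_small: "D y \<le> e / 2" if "norm y < d" for y
    using d(2)[of y] that e by (cases "y = 0") (auto simp: D_def)
  have D_le: "D y \<le> 2 * N" for y
  proof -
    have "D y \<le> (LINT x|lborel. norm (f (x + y)) + norm (f x))"
      unfolding D_def using f lborel_integrable_translate[OF f, of y]
      by (intro integral_mono) (auto intro: norm_triangle_ineq4)
    also have "\<dots> = (LINT x|lborel. norm (f (x + y))) + N"
      unfolding N_def using f lborel_integrable_translate[OF f, of y] by simp
    also have "\<dots> = 2 * N" using lborel_integral_translate[of "\<lambda>x. norm (f x)" y] by (simp add: N_def)
    finally show ?thesis .
  qed
  \<comment> \<open>The radius \<open>d / 2\<close> leaves the strict bound
    \<open>norm (X t \<omega>) < d\<close> off the exceptional event. The threshold below keeps the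
    contribution of that event, \<open>2 * N\<close> times its probability, under
    \<open>e / 2\<close>, also when \<open>N = 0\<close>.\<close>
  have "((\<lambda>t. prob {\<omega> \<in> space M. d / 2 < dist (X t \<omega>) (X 0 \<omega>)}) \<longlongrightarrow> 0) (at 0 within {0..})"
    using d(1) by (intro stochastically_continuous) auto
  then have "\<forall>\<^sub>F t in at 0 within {0..}. prob {\<omega> \<in> space M. d / 2 < dist (X t \<omega>) (X 0 \<omega>)} < e / (2 * (2 * N + 1))"
    using e N by (intro order_tendstoD(2)) auto
  moreover have "\<forall>\<^sub>F t in at 0 within {0..}. 0 \<le> (t::real)"
    by (auto simp: eventually_at_filter)
  ultimately show "\<forall>\<^sub>F t in at 0 within {0..}. dist (norm (levy_semigroup M X t g - g)) 0 < e"
  proof eventually_elim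
    case (elim t)
    then have t: "0 \<le> t" by simp
    have [measurable]: "X t \<in> borel_measurable M" "X 0 \<in> borel_measurable M"
      using t by (auto intro: measurable_process)
    define A where "A = {\<omega> \<in> space M. d / 2 < dist (X t \<omega>) (X 0 \<omega>)}"
    have A[measurable]: "A \<in> sets M" unfolding A_def by measurable
    have int: "integrable (M \<Otimes>\<^sub>M lborel) (\<lambda>(\<omega>, x). norm (f (x + X t \<omega>) - f x))"
    proof -
      \<comment> \<open>This is the shift lemma at time 0, where the displacement vanishes almost
        surely.\<close>
      have "integrable (M \<Otimes>\<^sub>M lborel) (\<lambda>(\<omega>, x). f x)"
        using integrable_pair_shift[OF f order_refl]
      proof (rule integrable_cong_AE_imp)
        show "(\<lambda>(\<omega>, x). f x) \<in> borel_measurable (M \<Otimes>\<^sub>M lborel)" using f by measurable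
        have "AE p in M \<Otimes>\<^sub>M (lborel :: 'a measure). X 0 (fst p) = 0"
        proof (rule P.AE_pair_measure)
          show "{p \<in> space (M \<Otimes>\<^sub>M (lborel :: 'a measure)). X 0 (fst p) = 0} \<in> sets (M \<Otimes>\<^sub>M lborel)"
            by measurable
          show "AE \<omega> in M. AE x in (lborel :: 'a measure). X 0 (fst (\<omega>, x)) = 0"
            using start_at_zero by eventually_elim simp
        qed
        then show "AE p in M \<Otimes>\<^sub>M lborel. (case p of (\<omega>, x) \<Rightarrow> f (x + X 0 \<omega>)) = (case p of (\<omega>, x) \<Rightarrow> f x)"
          by eventually_elim (auto split: prod.split)
      qed
      with integrable_pair_shift[OF f t]
      have "integrable (M \<Otimes>\<^sub>M lborel) (\<lambda>p. norm ((case p of (\<omega>, x) \<Rightarrow> f (x + X t \<omega>)) - (case p of (\<omega>, x) \<Rightarrow> f x)))"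
        by (intro integrable_norm Bochner_Integration.integrable_diff)
      then show ?thesis by (simp add: case_prod_unfold)
    qed
    have h: "integrable lborel (\<lambda>x. LINT \<omega>|M. f (x + X t \<omega>))"
      by (rule integrable_expectation_shift[OF f t])
    have "norm (levy_semigroup M X t g - g) = norm (levy_semigroup M X t g - abs_L1 f)"
      by (simp add: f_def)
    also have "\<dots> = (LINT x|lborel. norm ((LINT \<omega>|M. f (x + X t \<omega>)) - f x))"
      unfolding levy_semigroup_def f_def[symmetric] by (rule norm_diff_abs_L1[OF h f])
    also have "\<dots> \<le> (LINT x|lborel. LINT \<omega>|M. norm (f (x + X t \<omega>) - f x))"
    proof (rule integral_mono_AE)
      show "integrable lborel (\<lambda>x. norm ((LINT \<omega>|M. f (x + X t \<omega>)) - f x))" using h f by simp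
      show "integrable lborel (\<lambda>x. LINT \<omega>|M. norm (f (x + X t \<omega>) - f x))"
        using P.integrable_snd[OF int] .
      show "AE x in lborel. norm ((LINT \<omega>|M. f (x + X t \<omega>)) - f x) \<le> (LINT \<omega>|M. norm (f (x + X t \<omega>) - f x))"
        using AE_integrable_shift[OF f t]
      proof eventually_elim
        case (elim x)
        then have "(LINT \<omega>|M. f (x + X t \<omega>)) - f x = (LINT \<omega>|M. f (x + X t \<omega>) - f x)"
          by (simp add: prob_space)
        then show ?case by (metis integral_norm_bound)
      qed
    qed
    also have "\<dots> = (LINT \<omega>|M. D (X t \<omega>))"
      unfolding D_def by (rule P.Fubini_integral[OF int])
    also have "\<dots> \<le> (LINT \<omega>|M. e / 2 + (2 * N) * indicat_real A \<omega>)"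
    proof (rule integral_mono_AE)
      show "integrable M (\<lambda>\<omega>. D (X t \<omega>))"
        unfolding D_def using P.integrable_fst[OF int] .
      show "integrable M (\<lambda>\<omega>. e / 2 + (2 * N) * indicat_real A \<omega>)"
        by (intro Bochner_Integration.integrable_add integrable_mult_right integrable_real_indicator)
          (auto simp: emeasure_eq_measure)
      show "AE \<omega> in M. D (X t \<omega>) \<le> e / 2 + (2 * N) * indicat_real A \<omega>"
        using start_at_zero AE_space
      proof eventually_elim
        case (elim \<omega>)
        show ?case
        proof (cases "\<omega> \<in> A")
          case True
          then show ?thesis using D_le[of "X t \<omega>"] e by simp
        next
          case False
          then have "norm (X t \<omega>) \<le> d / 2" using elim by (simp add: A_def)
          then have "norm (X t \<omega>) < d" using d(1) by simp
          then show ?thesis using D_small False by simp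
        qed
      qed
    qed
    also have "\<dots> = e / 2 + (2 * N) * prob A"
      by (subst Bochner_Integration.integral_add)
        (auto intro!: integrable_mult_right integrable_real_indicator simp: prob_space emeasure_eq_measure)
    also have "\<dots> < e"
    proof -
      have "(2 * N) * prob A \<le> (2 * N) * (e / (2 * (2 * N + 1)))"
        using elim(1) N unfolding A_def by (intro mult_left_mono) auto
      also have "\<dots> < e / 2" using e N by (simp add: field_simps)
      finally show ?thesis by simp
    qed
    finally show ?case by simp
  qed
qed

text \<open>By the semigroup law and contraction, values at two times differ by at most
  \<open>\<eta>\<close> of the time difference, so continuity at 0 yields continuity from both sides
  at every time.\<close>

lemma levy_semigroup_continuous: "continuous_on {0..} (\<lambda>t. levy_semigroup M X t g)"
  unfolding continuous_on_def
proof
  fix s :: real assume "s \<in> {0..}"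
  then have s: "0 \<le> s" by simp
  define \<eta> where "\<eta> h = norm (levy_semigroup M X h g - g)" for h
  have le: "norm (levy_semigroup M X b g - levy_semigroup M X a g) \<le> \<eta> (b - a)" if "0 \<le> a" "a \<le> b" for a b
  proof -
    have "levy_semigroup M X b g - levy_semigroup M X a g = levy_semigroup M X a (levy_semigroup M X (b - a) g - g)"
      using that levy_semigroup_add[of a "b - a" g] by (simp add: linear_diff[OF levy_semigroup_linear])
    then show ?thesis unfolding \<eta>_def using levy_semigroup_contraction that by simp
  qed
  have "(\<eta> \<longlongrightarrow> \<eta> 0) (at 0 within {0..})"
    using levy_semigroup_tendsto_0 by (simp add: \<eta>_def[abs_def] levy_semigroup_0)
  then have "continuous (at 0 within {0..}) \<eta>" by (simp add: continuous_within)
  then have "((\<lambda>r. \<eta> \<bar>r - s\<bar>) \<longlongrightarrow> \<eta> 0) (at s within {0..})"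
  proof (rule continuous_within_tendsto_compose)
    show "((\<lambda>r. \<bar>r - s\<bar>) \<longlongrightarrow> 0) (at s within {0..})" by (intro tendsto_eq_intros) auto
  qed simp
  then have lim: "((\<lambda>r. \<eta> \<bar>r - s\<bar>) \<longlongrightarrow> 0) (at s within {0..})" by (simp add: \<eta>_def levy_semigroup_0)
  have "\<forall>\<^sub>F r in at s within {0..}. norm (levy_semigroup M X r g - levy_semigroup M X s g) \<le> \<eta> \<bar>r - s\<bar>"
  proof -
    have "\<forall>\<^sub>F r in at s within {0..}. 0 \<le> (r::real)" by (auto simp: eventually_at_filter)
    then show ?thesis
    proof eventually_elim
      case (elim r)
      then show ?case
        using le[of s r] le[of r s] s by (cases "s \<le> r") (auto simp: norm_minus_commute)
    qed
  qed
  from Lim_null_comparison[OF this lim]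
  show "((\<lambda>t. levy_semigroup M X t g) \<longlongrightarrow> levy_semigroup M X s g) (at s within {0..})"
    by (rule LIM_zero_cancel)
qed

lemma separated_contraction_semigroup_levy:
  "separated_contraction_semigroup (levy_semigroup M X) fourier characteristic"
  by (intro separated_contraction_semigroup.intro contraction_semigroup.intro
      separated_contraction_semigroup_axioms.intro levy_semigroup_linear levy_semigroup_contraction
      levy_semigroup_0 levy_semigroup_add levy_semigroup_continuous bounded_linear_fourier
      fourier_levy_semigroup fourier_injective)

end

text \<open>The integral formula degenerates at \<open>t = 0\<close>, so the initial value is
  prescribed separately. Equality in \<open>'a L1\<close> is equality almost everywhere.\<close>

theorem theorem3p6:
  fixes M :: "'w measure" and X :: "real \<Rightarrow> 'w \<Rightarrow> 'a::euclidean_space"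
    and f :: "'a L1" and u :: "real \<Rightarrow> 'a L1"
  assumes "levy_process M X"
    and "f \<in> generator_domain (levy_semigroup M X)"
    and "u 0 = f"
    and "\<And>t. 0 < t \<Longrightarrow>
      u t = (2 / sqrt (4 * pi * t)) *\<^sub>R
        (LINT s:{0<..}|lborel. exp (- (s\<^sup>2 / (4 * t))) *\<^sub>R levy_semigroup M X s f)"
  shows "second_order_ivp_solution (levy_semigroup M X) f u \<and>
    (\<forall>v. second_order_ivp_solution (levy_semigroup M X) f v \<longrightarrow> (\<forall>t\<ge>0. v t = u t)) \<and>
    fractional_cauchy_solution (1 / 2) (levy_semigroup M X) f u \<and>
    (\<forall>v. fractional_cauchy_solution (1 / 2) (levy_semigroup M X) f v \<longrightarrow> (\<forall>t\<ge>0. v t = u t))"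
proof -
  interpret levy_process M X by fact
  interpret separated_contraction_semigroup "levy_semigroup M X" fourier characteristic
    by (rule separated_contraction_semigroup_levy)
  have u: "u t = orbit_integral (heat t) f" if "0 < t" for t
    unfolding assms(4)[OF that] by (rule orbit_integral_heat_eq[OF that])
  have ivp: "second_order_ivp_solution (levy_semigroup M X) f u"
    using assms(2,3) u by (rule second_order_ivp_solution_heat_average)
  have frac: "fractional_cauchy_solution (1 / 2) (levy_semigroup M X) f u"
    using assms(2,3) u by (rule fractional_cauchy_solution_heat_average)
  show ?thesis
    using ivp frac second_order_ivp_unique[OF ivp] fractional_cauchy_unique[OF frac] by blast
qed

end
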